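(* Assume that $\tau$ is in the limit circle case at $a$ and $b$, and let $\{v_j(i,\cdot)\}_{j=1,2}$ be the orthonormal basis of $\mathcal N_i$ obtained from $\{u_j(i,\cdot)\}_{j=1,2}$ by the Gram–Schmidt process (given explicitly in the context). The Donoghue $m$-function $M_{T_{0,0},\mathcal N_i}^{Do}(\cdot):\mathbb C\setminus\mathbb R\to\mathcal B(\mathcal N_i)$ for $T_{0,0}$ satisfies $$M_{T_{0,0},\mathcal N_i}^{Do}(\pm i)=\pm i\,I_{\mathcal N_i},$$ $$M_{T_{0,0},\mathcal N_i}^{Do}(z)=-\sum_{j,k=1}^2\big[i\delta_{j,k}+W_{j,k}(z)\big](v_k(i,\cdot),\cdot)_{L^2_r((a,b))}v_j(i,\cdot)\big|_{\mathcal N_i}$$ $$\qquad=-iI_{\mathcal N_i}-\sum_{j,k=1}^2W_{j,k}(z)\,(v_k(i,\cdot),\cdot)_{L^2_r((a,b))}v_j(i,\cdot)\big|_{\mathcal N_i},\qquad z\in\mathbb C\setminus\mathbb R,\ z\ne\pm i,$$ where, with $\kappa=\operatorname{Im}(\widetilde u_2^{\,\prime}(i,b))/\operatorname{Im}(\widetilde u_1^{\,\prime}(i,b))$, $$W_{1,1}(z)=[c_1(i)]^2\big[\widetilde u_1^{\,\prime}(z,b)-\widetilde u_1^{\,\prime}(-i,b)\big],$$ $$W_{1,2}(z)=c_1(i)c_2(i)\Big\{\kappa\big[\widetilde u_1^{\,\prime}(-i,b)-\widetilde u_1^{\,\prime}(z,b)\big]+\widetilde u_2^{\,\prime}(z,b)+\widetilde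 u_1^{\,\prime}(-i,a)\Big\},$$ $$W_{2,1}(z)=-c_1(i)c_2(i)\Big\{\kappa\big[\widetilde u_1^{\,\prime}(z,b)-\widetilde u_1^{\,\prime}(-i,b)\big]+\widetilde u_2^{\,\prime}(-i,b)+\widetilde u_1^{\,\prime}(z,a)\Big\},$$ $$W_{2,2}(z)=[c_2(i)]^2\Big\{\Big[\widetilde u_2^{\,\prime}(-i,b)-\widetilde u_2^{\,\prime}(z,b)+\kappa\big[\widetilde u_1^{\,\prime}(z,b)-\widetilde u_1^{\,\prime}(-i,b)\big]\Big]\kappa+\widetilde u_2^{\,\prime}(-i,a)-\widetilde u_2^{\,\prime}(z,a)+\kappa\big[\widetilde u_1^{\,\prime}(z,a)-\widetilde u_1^{\,\prime}(-i,a)\big]\Big\}.$$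
   Context: Let $(a,b)\subseteq\mathbb R$ (possibly unbounded) and let $p,q,r$ be Lebesgue measurable functions on $(a,b)$ with $r>0$ a.e., $r\in L^1_{loc}((a,b))$; $p>0$ a.e., $1/p\in L^1_{loc}((a,b))$; $q$ real-valued a.e., $q\in L^1_{loc}((a,b))$. Put $\tau f=\frac1r\big[-(pf')'+qf\big]$, $f^{[1]}=pf'$, and $W(f,g)(x)=f(x)g^{[1]}(x)-f^{[1]}(x)g(x)$. Let $L^2_r((a,b))=L^2((a,b);r\,dx)$ with inner product $(\cdot,\cdot)_{L^2_r((a,b))}$ linear in the second argument. The maximal operator is $T_{max}f=\tau f$ with $\mathrm{dom}(T_{max})=\{g\in L^2_r((a,b)) : g,g^{[1]}\in AC_{loc}((a,b)),\ \tau g\in L^2_r((a,b))\}$. The minimal operator $T_{min}$ is the closure of the restriction of $T_{max}$ to those $g\in\mathrm{dom}(T_{max})$ with compact support in $(a,b)$. For $f,g\in\mathrm{dom}(T_{max})$ the limits $W(f,g)(a)=\lim_{x\downarrow a}W(f,g)(x)$ and $W(f,g)(b)=\lim_{x\uparrow b}W(f,g)(x)$ exist. $\tau$ is in the limit circle case at an endpoint if for every $z\in\mathbb C$ all solutions of $\tau u=zu$ are in $L^2_r$ near that endpoint. Put $\mathcal N_z=\ker(T_{max}-zI)$; in the present situation $\dim\mathcal N_{\pm i}=2$. Generalized boundary values: fix real-valued $v_1,v_2\in\mathrm{dom}(T_{max})$ with $W(v_1,v_2)(a)=W(v_1,v_2)(b)=1$ and, for $g\in\mathrm{dom}(T_{max})$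 and $d\in\{a,b\}$, set $\widetilde g(d)=-W(v_2,g)(d)$ and $\widetilde g^{\,\prime}(d)=W(v_1,g)(d)$. (If $T_{min}$ is bounded from below one takes $v_1,v_2$ equal near each endpoint $d$ to a nonprincipal solution $\widehat u_d(\lambda_0,\cdot)$ and a principal solution $u_d(\lambda_0,\cdot)$ of $\tau u=\lambda_0u$ with $W(\widehat u_d,u_d)=1$, $\lambda_0\in\mathbb R$. These functions $v_1,v_2$ are unrelated to the basis functions $v_j(i,\cdot)$ below.) $T_{0,0}$ is the self-adjoint extension of $T_{min}$ given by restricting $T_{max}$ to $\{g\in\mathrm{dom}(T_{max}) : \widetilde g(a)=\widetilde g(b)=0\}$. For $z\in\rho(T_{0,0})$, $u_1(z,\cdot),u_2(z,\cdot)$ are the solutions of $\tau u=zu$ with $\widetilde u_1(z,a)=0$, $\widetilde u_1(z,b)=1$, $\widetilde u_2(z,a)=1$, $\widetilde u_2(z,b)=0$; $\widetilde u_j^{\,\prime}(z,d)$ denotes the second generalized boundary value of $u_j(z,\cdot)$ at $d\in\{a,b\}$. The orthonormal basis of $\mathcal N_i$ is $$v_1(i,\cdot)=c_1(i)u_1(i,\cdot),\qquad v_2(i,\cdot)=c_2(i)\Big[u_2(i,\cdot)-\frac{\operatorname{Im}(\widetilde u_2^{\,\prime}(i,b))}{\operatorname{Im}(\widetilde u_1^{\,\prime}(i,b))}u_1(i,\cdot)\Big],$$ $$c_1(i)=\|u_1(i,\cdot)\|_{L^2_r((a,b))}^{-1}=\big[-\operatorname{Im}(\widetilde u_1^{\,\prime}(i,b))\big]^{-1/2},$$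 $$c_2(i)=\Big\|u_2(i,\cdot)-\frac{\operatorname{Im}(\widetilde u_2^{\,\prime}(i,b))}{\operatorname{Im}(\widetilde u_1^{\,\prime}(i,b))}u_1(i,\cdot)\Big\|_{L^2_r((a,b))}^{-1}=\Big[\operatorname{Im}(\widetilde u_2^{\,\prime}(i,a))+\frac{[\operatorname{Im}(\widetilde u_2^{\,\prime}(i,b))]^2}{\operatorname{Im}(\widetilde u_1^{\,\prime}(i,b))}\Big]^{-1/2}.$$ For a self-adjoint extension $T$ of $T_{min}$, the Donoghue $m$-function is $M_{T,\mathcal N_i}^{Do}(z)=zI_{\mathcal N_i}+(z^2+1)P_{\mathcal N_i}(T-zI)^{-1}P_{\mathcal N_i}\big|_{\mathcal N_i}$, $z\in\mathbb C\setminus\mathbb R$, where $P_{\mathcal N_i}$ is the orthogonal projection onto $\mathcal N_i$ and $I_{\mathcal N_i}$ the identity on $\mathcal N_i$. The symbol $(f,\cdot)_{L^2_r((a,b))}\,h$ denotes the rank-one operator $g\mapsto(f,g)_{L^2_r((a,b))}h$. *)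

theory Defs
  imports "HOL-Analysis.Analysis"
begin

section \<open>Sturm--Liouville coefficients and local function spaces\<close>

record sl_problem =
  sl_a :: ereal
  sl_b :: ereal
  sl_p :: "real \<Rightarrow> real"
  sl_q :: "real \<Rightarrow> real"
  sl_r :: "real \<Rightarrow> real"

definition sl_int :: "sl_problem \<Rightarrow> real set" where
  "sl_int S = einterval (sl_a S) (sl_b S)"

definition L1_loc :: "sl_problem \<Rightarrow> (real \<Rightarrow> real) \<Rightarrow> bool" where
  "L1_loc S f \<longleftrightarrow> (\<forall>K. compact K \<and> K \<subseteq> sl_int S \<longrightarrow> f absolutely_integrable_on K)"

definition sl_coefficients :: "sl_problem \<Rightarrow> bool" where
  "sl_coefficients S \<longleftrightarrow>
     sl_a S < sl_b S \<and>
     sl_p S \<in> borel_measurable (lebesgue_on (sl_int S)) \<and>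
     sl_q S \<in> borel_measurable (lebesgue_on (sl_int S)) \<and>
     sl_r S \<in> borel_measurable (lebesgue_on (sl_int S)) \<and>
     (AE x in lebesgue_on (sl_int S). sl_r S x > 0) \<and> L1_loc S (sl_r S) \<and>
     (AE x in lebesgue_on (sl_int S). sl_p S x > 0) \<and> L1_loc S (\<lambda>x. 1 / sl_p S x) \<and>
     L1_loc S (sl_q S)"

text \<open>A set \<open>D\<close> with \<open>D division_of \<Union>D\<close> is a finite family of non-overlapping nonempty compact
  intervals \<open>k = {Inf k..Sup k}\<close>, so this is the usual epsilon-delta definition of absolute
  continuity on the compact interval \<open>{c..d}\<close>.\<close>

definition abs_continuous_on :: "real \<Rightarrow> real \<Rightarrow> (real \<Rightarrow> complex) \<Rightarrow> bool" where
  "abs_continuous_on c d f \<longleftrightarrow>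
     (\<forall>\<epsilon>>0. \<exists>\<delta>>0. \<forall>D. D division_of \<Union>D \<and> \<Union>D \<subseteq> {c..d} \<and> (\<Sum>k\<in>D. Sup k - Inf k) < \<delta>
        \<longrightarrow> (\<Sum>k\<in>D. cmod (f (Sup k) - f (Inf k))) < \<epsilon>)"

definition AC_loc :: "sl_problem \<Rightarrow> (real \<Rightarrow> complex) \<Rightarrow> bool" where
  "AC_loc S f \<longleftrightarrow> (\<forall>c\<in>sl_int S. \<forall>d\<in>sl_int S. abs_continuous_on c d f)"

section \<open>The differential expression\<close>

text \<open>The product \<open>p g'\<close> is only determined almost everywhere, so \<open>g\<^sup>[\<^sup>1\<^sup>] \<in> AC\<^sub>l\<^sub>o\<^sub>c\<close> means that it has a
  locally absolutely continuous representative. That representative is unique on \<open>(a,b)\<close>; it is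
  the one whose point values enter the Wronskian. All functions are total on the reals and their
  values outside \<open>(a,b)\<close> are irrelevant.\<close>

definition is_quasi_deriv :: "sl_problem \<Rightarrow> (real \<Rightarrow> complex) \<Rightarrow> (real \<Rightarrow> complex) \<Rightarrow> bool" where
  "is_quasi_deriv S g h \<longleftrightarrow> AC_loc S h \<and>
     (AE x in lebesgue_on (sl_int S).
        \<exists>d. (g has_vector_derivative d) (at x) \<and> h x = of_real (sl_p S x) * d)"

definition quasi_deriv :: "sl_problem \<Rightarrow> (real \<Rightarrow> complex) \<Rightarrow> real \<Rightarrow> complex" where
  "quasi_deriv S g = (SOME h. is_quasi_deriv S g h)"

text \<open>\<open>tau_eq S g w\<close>: \<open>g\<close> and \<open>g\<^sup>[\<^sup>1\<^sup>]\<close> are locally absolutely continuous and \<open>\<tau> g = w\<close> almost everywhere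
  in \<open>(a,b)\<close>.\<close>

definition tau_eq :: "sl_problem \<Rightarrow> (real \<Rightarrow> complex) \<Rightarrow> (real \<Rightarrow> complex) \<Rightarrow> bool" where
  "tau_eq S g w \<longleftrightarrow> AC_loc S g \<and> is_quasi_deriv S g (quasi_deriv S g) \<and>
     (AE x in lebesgue_on (sl_int S).
        \<exists>d. (quasi_deriv S g has_vector_derivative d) (at x) \<and>
            w x = (- d + of_real (sl_q S x) * g x) / of_real (sl_r S x))"

definition solves :: "sl_problem \<Rightarrow> complex \<Rightarrow> (real \<Rightarrow> complex) \<Rightarrow> bool" where
  "solves S z u \<longleftrightarrow> tau_eq S u (\<lambda>x. z * u x)"

definition wronskian ::
  "sl_problem \<Rightarrow> (real \<Rightarrow> complex) \<Rightarrow> (real \<Rightarrow> complex) \<Rightarrow> real \<Rightarrow> complex" where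
  "wronskian S f g x = f x * quasi_deriv S g x - quasi_deriv S f x * g x"

text \<open>The endpoints \<open>a\<close>, \<open>b\<close> are represented by the filters \<open>x \<down> a\<close> and \<open>x \<up> b\<close>
  on the reals, so that infinite endpoints are covered uniformly.\<close>

definition end_a :: "sl_problem \<Rightarrow> real filter" where
  "end_a S = filtermap real_of_ereal (at_right (sl_a S))"

definition end_b :: "sl_problem \<Rightarrow> real filter" where
  "end_b S = filtermap real_of_ereal (at_left (sl_b S))"

definition wronskian_at ::
  "sl_problem \<Rightarrow> (real \<Rightarrow> complex) \<Rightarrow> (real \<Rightarrow> complex) \<Rightarrow> real filter \<Rightarrow> complex" where
  "wronskian_at S f g F = Lim F (wronskian S f g)"

section \<open>The Hilbert space of square integrable functions with weight r\<close>

text \<open>Elements are represented by functions; equality of elements is \<open>L2_eq\<close>.\<close>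

definition wmeasure :: "sl_problem \<Rightarrow> real measure" where
  "wmeasure S = density (lebesgue_on (sl_int S)) (\<lambda>x. ennreal (sl_r S x))"

definition L2 :: "sl_problem \<Rightarrow> (real \<Rightarrow> complex) set" where
  "L2 S = {f \<in> borel_measurable (wmeasure S). integrable (wmeasure S) (\<lambda>x. (cmod (f x))\<^sup>2)}"

definition L2_eq :: "sl_problem \<Rightarrow> (real \<Rightarrow> complex) \<Rightarrow> (real \<Rightarrow> complex) \<Rightarrow> bool" where
  "L2_eq S f g \<longleftrightarrow> (AE x in wmeasure S. f x = g x)"

definition L2_inner :: "sl_problem \<Rightarrow> (real \<Rightarrow> complex) \<Rightarrow> (real \<Rightarrow> complex) \<Rightarrow> complex" where
  "L2_inner S f g = (\<integral>x. cnj (f x) * g x \<partial>wmeasure S)"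

definition L2_norm :: "sl_problem \<Rightarrow> (real \<Rightarrow> complex) \<Rightarrow> real" where
  "L2_norm S f = sqrt (\<integral>x. (cmod (f x))\<^sup>2 \<partial>wmeasure S)"

definition limit_circle_a :: "sl_problem \<Rightarrow> bool" where
  "limit_circle_a S \<longleftrightarrow> (\<forall>z u. solves S z u \<longrightarrow>
     (\<exists>c\<in>sl_int S. set_integrable (wmeasure S) {..c} (\<lambda>x. (cmod (u x))\<^sup>2)))"

definition limit_circle_b :: "sl_problem \<Rightarrow> bool" where
  "limit_circle_b S \<longleftrightarrow> (\<forall>z u. solves S z u \<longrightarrow>
     (\<exists>c\<in>sl_int S. set_integrable (wmeasure S) {c..} (\<lambda>x. (cmod (u x))\<^sup>2)))"

section \<open>Operators, given by their graphs\<close>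

type_synonym L2_graph = "((real \<Rightarrow> complex) \<times> (real \<Rightarrow> complex)) set"

definition T_max :: "sl_problem \<Rightarrow> L2_graph" where
  "T_max S = {(g, w). g \<in> L2 S \<and> w \<in> L2 S \<and> tau_eq S g w}"

definition op_kernel :: "sl_problem \<Rightarrow> L2_graph \<Rightarrow> complex \<Rightarrow> (real \<Rightarrow> complex) set" where
  "op_kernel S T z = {g. \<exists>w. (g, w) \<in> T \<and> L2_eq S (\<lambda>x. w x - z * g x) (\<lambda>x. 0)}"

definition deficiency_space :: "sl_problem \<Rightarrow> complex \<Rightarrow> (real \<Rightarrow> complex) set" where
  "deficiency_space S z = op_kernel S (T_max S) z"

definition is_resolvent_of ::
  "sl_problem \<Rightarrow> L2_graph \<Rightarrow> complex \<Rightarrow> (real \<Rightarrow> complex) \<Rightarrow> (real \<Rightarrow> complex) \<Rightarrow> bool" where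
  "is_resolvent_of S T z f g \<longleftrightarrow> (\<exists>w. (g, w) \<in> T \<and> L2_eq S (\<lambda>x. w x - z * g x) f)"

definition resolvent_set :: "sl_problem \<Rightarrow> L2_graph \<Rightarrow> complex set" where
  "resolvent_set S T = {z.
     (\<forall>f\<in>L2 S. \<exists>g. is_resolvent_of S T z f g \<and> (\<forall>h. is_resolvent_of S T z f h \<longrightarrow> L2_eq S h g)) \<and>
     (\<exists>C. \<forall>f\<in>L2 S. \<forall>g. is_resolvent_of S T z f g \<longrightarrow> L2_norm S g \<le> C * L2_norm S f)}"

definition resolvent ::
  "sl_problem \<Rightarrow> L2_graph \<Rightarrow> complex \<Rightarrow> (real \<Rightarrow> complex) \<Rightarrow> real \<Rightarrow> complex" where
  "resolvent S T z f = (SOME g. is_resolvent_of S T z f g)"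

definition orth_proj ::
  "sl_problem \<Rightarrow> (real \<Rightarrow> complex) set \<Rightarrow> (real \<Rightarrow> complex) \<Rightarrow> real \<Rightarrow> complex" where
  "orth_proj S N f = (SOME g. g \<in> N \<and> (\<forall>n\<in>N. L2_inner S n (\<lambda>x. f x - g x) = 0))"

definition bounded_op_on ::
  "sl_problem \<Rightarrow> (real \<Rightarrow> complex) set \<Rightarrow> ((real \<Rightarrow> complex) \<Rightarrow> (real \<Rightarrow> complex)) \<Rightarrow> bool" where
  "bounded_op_on S N A \<longleftrightarrow>
     (\<forall>f\<in>N. A f \<in> N) \<and>
     (\<forall>f\<in>N. \<forall>g\<in>N. \<forall>\<alpha> \<beta>.
        L2_eq S (A (\<lambda>x. \<alpha> * f x + \<beta> * g x)) (\<lambda>x. \<alpha> * A f x + \<beta> * A g x)) \<and>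
     (\<exists>C. \<forall>f\<in>N. L2_norm S (A f) \<le> C * L2_norm S f)"

definition donoghue_m ::
  "sl_problem \<Rightarrow> L2_graph \<Rightarrow> (real \<Rightarrow> complex) set \<Rightarrow> complex \<Rightarrow> (real \<Rightarrow> complex) \<Rightarrow> real \<Rightarrow> complex"
  where
  "donoghue_m S T N z f =
     (\<lambda>x. z * f x + (z\<^sup>2 + 1) * orth_proj S N (resolvent S T z (orth_proj S N f)) x)"

section \<open>Generalized boundary values\<close>

text \<open>The reference functions \<open>w1, w2\<close> are the real-valued elements of the maximal domain with
  Wronskian 1 at both endpoints.\<close>

definition boundary_reference ::
  "sl_problem \<Rightarrow> (real \<Rightarrow> complex) \<Rightarrow> (real \<Rightarrow> complex) \<Rightarrow> bool" where
  "boundary_reference S w1 w2 \<longleftrightarrow>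
     w1 \<in> Domain (T_max S) \<and> w2 \<in> Domain (T_max S) \<and>
     (\<forall>x\<in>sl_int S. w1 x \<in> \<real> \<and> w2 x \<in> \<real>) \<and>
     wronskian_at S w1 w2 (end_a S) = 1 \<and> wronskian_at S w1 w2 (end_b S) = 1"

definition bval :: "sl_problem \<Rightarrow> (real \<Rightarrow> complex) \<Rightarrow> (real \<Rightarrow> complex) \<Rightarrow> real filter \<Rightarrow> complex" where
  "bval S w2 g F = - wronskian_at S w2 g F"

definition bval' :: "sl_problem \<Rightarrow> (real \<Rightarrow> complex) \<Rightarrow> (real \<Rightarrow> complex) \<Rightarrow> real filter \<Rightarrow> complex" where
  "bval' S w1 g F = wronskian_at S w1 g F"

definition T_00 :: "sl_problem \<Rightarrow> (real \<Rightarrow> complex) \<Rightarrow> L2_graph" where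
  "T_00 S w2 = {(g, w) \<in> T_max S. bval S w2 g (end_a S) = 0 \<and> bval S w2 g (end_b S) = 0}"

end

theory Submission
  imports Defs
begin

text \<open>For a nonreal \<open>z\<close> write \<open>f(z) = f~(b) u\<^sub>1(z) + f~(a) u\<^sub>2(z)\<close> for the solution of
  \<open>\<tau> y = z y\<close> that has the generalized boundary values of \<open>f\<close>. For \<open>f\<close> in the deficiency space
  \<open>N\<close> of \<open>\<i>\<close> one has \<open>f = f(\<i>)\<close>, and the resolvent of the realization with vanishing boundary values
  is explicit: \<open>(T - z)\<^sup>-\<^sup>1 f = (f - f(z)) / (\<i> - z)\<close> for \<open>z \<noteq> \<i>\<close> (\<open>resolvent_N\<close>), because the right-hand
  side has zero boundary values and solves \<open>\<tau> h - z h = f\<close>. Since \<open>z\<^sup>2 + 1 = -(z + \<i>)(\<i> - z)\<close>, this gives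
  \<open>M(z) f = -\<i> f + (z + \<i>) P f(z)\<close> (\<open>M_formula\<close>). The matrix of the last term in the orthonormal basis
  \<open>v\<^sub>1, v\<^sub>2\<close> consists of inner products of solutions, which Green's formula turns into boundary
  forms: \<open>-(z + \<i>) (v\<^sub>j, v\<^sub>k(z)) = W(cnj v\<^sub>j, v\<^sub>k(z))(b) - W(cnj v\<^sub>j, v\<^sub>k(z))(a)\<close>
  (\<open>inner_solutions\<close>). With the Pluecker identity
  \<open>W(f, g)(d) = f~(d) g~'(d) - f~'(d) g~(d)\<close> (\<open>wronskian_at_bval\<close>) and \<open>cnj (u\<^sub>j(\<i>)) = u\<^sub>j(-\<i>)\<close> these are
  the stated entries (\<open>Wform_values\<close>). At \<open>z = \<plusminus>\<i>\<close> the factor \<open>z\<^sup>2 + 1\<close> vanishes.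

  What precedes this computation is the analysis that gives it a meaning. The solutions
  \<open>u\<^sub>1, u\<^sub>2\<close> are only available for \<open>z\<close> in the resolvent set, so every nonreal \<open>z\<close> has to be shown to
  lie there (\<open>nonreal_in_resolvent_set\<close>). Existence of a solution of \<open>\<tau> g = z g + f\<close> comes from the
  initial value problem with locally integrable coefficients (\<open>initial_value_exists\<close>), solved by
  Picard iteration of a Volterra equation; in the limit circle case it is square integrable
  (\<open>inhomogeneous_solution_L2\<close>). Symmetry gives \<open>|Im z| \<parallel>g\<parallel> \<le> \<parallel>(T - z) g\<parallel>\<close> (\<open>T_00_estimate\<close>), hence
  uniqueness and boundedness of the resolvent, and injectivity of the boundary value map on the
  span of a fundamental system; by a determinant argument that map is then onto, so the boundary
  values of \<open>g\<close> can be corrected to zero (\<open>solution_with_bvals\<close>). Lagrange's identity and the passage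
  between differential and integral equations rest on the fundamental theorem of calculus for
  absolutely continuous functions (\<open>has_integral_abs_continuous\<close>,
  \<open>indefinite_integral_has_vector_derivative_ae\<close>, \<open>abs_continuous_on_indefinite_integral\<close>).\<close>

section \<open>Absolutely continuous functions and the fundamental theorem of calculus\<close>

lemma abs_continuous_onD:
  assumes "abs_continuous_on c d f" "\<epsilon> > 0"
  shows "\<exists>\<delta>>0. \<forall>D. D division_of \<Union>D \<longrightarrow> \<Union>D \<subseteq> {c..d} \<longrightarrow> (\<Sum>k\<in>D. Sup k - Inf k) < \<delta>
      \<longrightarrow> (\<Sum>k\<in>D. cmod (f (Sup k) - f (Inf k))) < \<epsilon>"
  using assms(1)[unfolded abs_continuous_on_def, rule_format, OF assms(2)] by (simp only: imp_conjL)

lemma real_division_intervals: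
  assumes "D division_of X" "k \<in> D"
  shows "k = {Inf k..Sup k}" "Inf k \<le> Sup k" "measure lborel k = Sup k - Inf k" "(k::real set) \<subseteq> X"
proof -
  obtain a b where ab: "k = cbox a b" using division_ofD(4)[OF assms] by blast
  have "k \<noteq> {}" using division_ofD(3)[OF assms] .
  then have le: "a \<le> b" by (simp add: ab)
  have IS: "Inf k = a" "Sup k = b" using le by (simp_all add: ab)
  show "k = {Inf k..Sup k}" unfolding IS by (simp add: ab)
  show "Inf k \<le> Sup k" unfolding IS by (rule le)
  show "measure lborel k = Sup k - Inf k" unfolding IS using le by (simp add: ab)
  show "k \<subseteq> X" using division_ofD(2)[OF assms] .
qed

lemma sum_length_division:
  assumes "D division_of (X::real set)"
  shows "X \<in> lmeasurable" "(\<Sum>k\<in>D. Sup k - Inf k) = measure lebesgue X"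
proof -
  have one: "((\<lambda>x. 1::real) has_integral sum (measure lborel) D) X"
  proof (rule has_integral_combine_division[OF assms])
    fix k assume "k \<in> D"
    then obtain a b where k: "k = cbox a b" using division_ofD(4)[OF assms] by blast
    show "((\<lambda>x. 1::real) has_integral measure lborel k) k"
      unfolding k using has_integral_const[of "1::real" a b] by simp
  qed
  show X: "X \<in> lmeasurable"
  proof -
    have "compact (\<Union>D)"
      using division_of_finite[OF assms] division_ofD(4)[OF assms]
      by (intro compact_Union) (auto intro: compact_cbox)
    then show ?thesis using division_ofD(6)[OF assms] lmeasurable_compact by simp
  qed
  from one X have "sum (measure lborel) D = measure lebesgue X"
    by (simp add: lmeasure_integral integral_unique)
  moreover have "sum (measure lborel) D = (\<Sum>k\<in>D. Sup k - Inf k)"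
    using real_division_intervals(3)[OF assms] by (rule sum.cong[OF refl])
  ultimately show "(\<Sum>k\<in>D. Sup k - Inf k) = measure lebesgue X" by simp
qed

lemma abs_continuous_on_imp_continuous_on:
  assumes "abs_continuous_on c d f" shows "continuous_on {c..d} f"
  unfolding continuous_on_iff
proof (intro ballI allI impI)
  fix x \<epsilon> :: real assume x: "x \<in> {c..d}" and "\<epsilon> > 0"
  obtain \<delta> where \<delta>: "\<delta> > 0"
    "\<forall>D. D division_of \<Union>D \<longrightarrow> \<Union>D \<subseteq> {c..d} \<longrightarrow> (\<Sum>k\<in>D. Sup k - Inf k) < \<delta>
       \<longrightarrow> (\<Sum>k\<in>D. cmod (f (Sup k) - f (Inf k))) < \<epsilon>"
    using abs_continuous_onD[OF assms \<open>\<epsilon> > 0\<close>] by blast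
  have *: "cmod (f v - f u) < \<epsilon>" if "u \<le> v" "c \<le> u" "v \<le> d" "v - u < \<delta>" for u v
  proof -
    have "{{u..v}} division_of \<Union>{{u..v}}"
      using that division_of_self[of u v] by simp
    then show ?thesis using \<delta>(2)[rule_format, of "{{u..v}}"] that by simp
  qed
  have "dist (f y) (f x) < \<epsilon>" if "y \<in> {c..d}" "dist y x < \<delta>" for y
    using *[of x y] *[of y x] that x
    by (cases "x \<le> y") (auto simp: dist_norm norm_minus_commute abs_real_def)
  then show "\<exists>\<delta>>0. \<forall>y\<in>{c..d}. dist y x < \<delta> \<longrightarrow> dist (f y) (f x) < \<epsilon>"
    using \<delta>(1) by blast
qed

text \<open>A criterion that compares increments; linear combinations and products reduce to it.\<close>

lemma abs_continuous_on_dominated: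
  assumes f: "abs_continuous_on c d f" and g: "abs_continuous_on c d g" and "K \<ge> 0"
    and le: "\<And>x y. \<lbrakk>x \<in> {c..d}; y \<in> {c..d}\<rbrakk> \<Longrightarrow>
               cmod (h y - h x) \<le> K * cmod (f y - f x) + K * cmod (g y - g x)"
  shows "abs_continuous_on c d h"
  unfolding abs_continuous_on_def
proof (intro allI impI)
  fix \<epsilon> :: real assume "\<epsilon> > 0"
  define e where "e = \<epsilon> / (2 * (K + 1))"
  have e: "e > 0" using \<open>\<epsilon> > 0\<close> \<open>K \<ge> 0\<close> by (simp add: e_def)
  obtain \<delta>1 where \<delta>1: "\<delta>1 > 0" "\<forall>D. D division_of \<Union>D \<longrightarrow> \<Union>D \<subseteq> {c..d} \<longrightarrow> (\<Sum>k\<in>D. Sup k - Inf k) < \<delta>1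
       \<longrightarrow> (\<Sum>k\<in>D. cmod (f (Sup k) - f (Inf k))) < e"
    using abs_continuous_onD[OF f e] by blast
  obtain \<delta>2 where \<delta>2: "\<delta>2 > 0" "\<forall>D. D division_of \<Union>D \<longrightarrow> \<Union>D \<subseteq> {c..d} \<longrightarrow> (\<Sum>k\<in>D. Sup k - Inf k) < \<delta>2
       \<longrightarrow> (\<Sum>k\<in>D. cmod (g (Sup k) - g (Inf k))) < e"
    using abs_continuous_onD[OF g e] by blast
  have "(\<Sum>k\<in>D. cmod (h (Sup k) - h (Inf k))) < \<epsilon>"
    if D: "D division_of \<Union>D" "\<Union>D \<subseteq> {c..d}" "(\<Sum>k\<in>D. Sup k - Inf k) < min \<delta>1 \<delta>2" for D
  proof -
    have "(\<Sum>k\<in>D. cmod (h (Sup k) - h (Inf k)))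
        \<le> (\<Sum>k\<in>D. K * cmod (f (Sup k) - f (Inf k)) + K * cmod (g (Sup k) - g (Inf k)))"
    proof (rule sum_mono)
      fix k assume k: "k \<in> D"
      have "Inf k \<in> k" "Sup k \<in> k"
        using real_division_intervals(1,2)[OF D(1) k] by (metis atLeastAtMost_iff order_refl)+
      then show "cmod (h (Sup k) - h (Inf k)) \<le> K * cmod (f (Sup k) - f (Inf k)) + K * cmod (g (Sup k) - g (Inf k))"
        using D(2) k by (intro le) blast+
    qed
    also have "\<dots> = K * (\<Sum>k\<in>D. cmod (f (Sup k) - f (Inf k))) + K * (\<Sum>k\<in>D. cmod (g (Sup k) - g (Inf k)))"
      by (simp add: sum.distrib sum_distrib_left)
    also have "\<dots> \<le> K * e + K * e"
      using \<delta>1(2)[rule_format, OF D(1,2)] \<delta>2(2)[rule_format, OF D(1,2)] D(3) \<open>K \<ge> 0\<close> by (intro add_mono mult_left_mono) auto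
    also have "\<dots> < 2 * (K + 1) * e" using e by (simp add: algebra_simps)
    also have "\<dots> = \<epsilon>" using \<open>K \<ge> 0\<close> by (simp add: e_def)
    finally show ?thesis .
  qed
  then show "\<exists>\<delta>>0. \<forall>D. D division_of \<Union>D \<and> \<Union>D \<subseteq> {c..d} \<and> (\<Sum>k\<in>D. Sup k - Inf k) < \<delta> \<longrightarrow>
     (\<Sum>k\<in>D. cmod (h (Sup k) - h (Inf k))) < \<epsilon>"
    using \<delta>1(1) \<delta>2(1) by (intro exI[of _ "min \<delta>1 \<delta>2"]) auto
qed

lemma abs_continuous_on_lincomb:
  assumes "abs_continuous_on c d f" "abs_continuous_on c d g"
  shows "abs_continuous_on c d (\<lambda>x. \<alpha> * f x + \<beta> * g x)"
proof (rule abs_continuous_on_dominated[OF assms, of "cmod \<alpha> + cmod \<beta>"])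
  fix x y
  have "cmod (\<alpha> * f y + \<beta> * g y - (\<alpha> * f x + \<beta> * g x)) = cmod (\<alpha> * (f y - f x) + \<beta> * (g y - g x))"
    by (simp add: algebra_simps)
  also have "\<dots> \<le> cmod \<alpha> * cmod (f y - f x) + cmod \<beta> * cmod (g y - g x)"
    by (metis norm_mult norm_triangle_ineq)
  also have "\<dots> \<le> (cmod \<alpha> + cmod \<beta>) * cmod (f y - f x) + (cmod \<alpha> + cmod \<beta>) * cmod (g y - g x)"
    by (intro add_mono mult_right_mono) auto
  finally show "cmod (\<alpha> * f y + \<beta> * g y - (\<alpha> * f x + \<beta> * g x)) \<le> \<dots>" .
qed auto

lemma abs_continuous_on_mult:
  assumes f: "abs_continuous_on c d f" and g: "abs_continuous_on c d g"
  shows "abs_continuous_on c d (\<lambda>x. f x * g x)"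
proof -
  have "bounded (f ` {c..d})" "bounded (g ` {c..d})"
    using f g by (auto intro!: compact_imp_bounded compact_continuous_image abs_continuous_on_imp_continuous_on)
  then obtain A B where "\<forall>y\<in>f ` {c..d}. cmod y \<le> A" "A > 0" "\<forall>y\<in>g ` {c..d}. cmod y \<le> B" "B > 0"
    unfolding bounded_pos by blast
  then have A: "\<And>x. x \<in> {c..d} \<Longrightarrow> cmod (f x) \<le> A" "A > 0"
    and B: "\<And>x. x \<in> {c..d} \<Longrightarrow> cmod (g x) \<le> B" "B > 0" by auto
  show ?thesis
  proof (rule abs_continuous_on_dominated[OF f g, of "A + B"])
    fix x y assume xy: "x \<in> {c..d}" "y \<in> {c..d}"
    have "cmod (f y * g y - f x * g x) = cmod (g y * (f y - f x) + f x * (g y - g x))"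
      by (simp add: algebra_simps)
    also have "\<dots> \<le> cmod (g y) * cmod (f y - f x) + cmod (f x) * cmod (g y - g x)"
      by (metis norm_mult norm_triangle_ineq)
    also have "\<dots> \<le> (A + B) * cmod (f y - f x) + (A + B) * cmod (g y - g x)"
      using A(1)[OF xy(1)] B(1)[OF xy(2)] A(2) B(2) by (intro add_mono mult_right_mono) auto
    finally show "cmod (f y * g y - f x * g x) \<le> \<dots>" .
  qed (use A B in auto)
qed

lemma abs_continuous_on_cnj:
  "abs_continuous_on c d f \<Longrightarrow> abs_continuous_on c d (\<lambda>x. cnj (f x))"
  unfolding abs_continuous_on_def by (simp flip: complex_cnj_diff)

lemma abs_continuous_on_cong:
  assumes "abs_continuous_on c d f" "\<And>x. x \<in> {c..d} \<Longrightarrow> f x = g x"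
  shows "abs_continuous_on c d g"
  by (rule abs_continuous_on_dominated[OF assms(1) assms(1), of 1]) (use assms(2) in auto)

text \<open>The fundamental theorem of calculus, with a gauge integral, so that no integrability of the
  derivative has to be assumed. A gauge that keeps the cells tagged
  in the exceptional null set inside an open set of small measure reduces the contribution of
  these cells to absolute continuity; the other cells are handled by differentiability.\<close>

lemma has_integral_abs_continuous:
  assumes ac: "abs_continuous_on c d F" and "c \<le> d" and E: "negligible E"
    and der: "\<And>x. x \<in> {c..d} - E \<Longrightarrow> (F has_vector_derivative f x) (at x within {c..d})"
  shows "(f has_integral (F d - F c)) {c..d}"
proof -
  define g where "g = (\<lambda>x. if x \<in> E then 0 else f x)"
  have "(g has_integral (F d - F c)) {c..d}"
    unfolding has_integral_real
  proof (intro allI impI)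
    fix e :: real assume "e > 0"
    define e' where "e' = e / (2 * (d - c + 1))"
    have e': "e' > 0" using \<open>e > 0\<close> \<open>c \<le> d\<close> by (simp add: e'_def)
    obtain \<delta> where \<delta>: "\<delta> > 0" "\<forall>D. D division_of \<Union>D \<longrightarrow> \<Union>D \<subseteq> {c..d} \<longrightarrow> (\<Sum>k\<in>D. Sup k - Inf k) < \<delta>
       \<longrightarrow> (\<Sum>k\<in>D. cmod (F (Sup k) - F (Inf k))) < e/2"
      using abs_continuous_onD[OF ac half_gt_zero[OF \<open>e > 0\<close>]] by blast
    have E0: "E \<in> null_sets lebesgue" using E negligible_iff_null_sets by blast
    obtain U where U0: "open U" "E \<subseteq> U" "U - E \<in> lmeasurable" "emeasure lebesgue (U - E) < ennreal \<delta>"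
      by (rule sets_lebesgue_outer_open[OF null_setsD2[OF E0] \<delta>(1)])
    have "emeasure lebesgue U < ennreal \<delta>"
      using U0 E0 by (simp add: emeasure_Diff_null_set)
    moreover from this have "emeasure lebesgue U \<noteq> \<infinity>" by (auto simp: top_unique)
    moreover from this have "emeasure lebesgue U = ennreal (measure lebesgue U)"
      by (simp add: emeasure_eq_ennreal_measure)
    ultimately have U: "open U" "E \<subseteq> U" "U \<in> lmeasurable" "measure lebesgue U < \<delta>"
      using U0 by (auto simp: fmeasurable_def less_top[symmetric] ennreal_less_iff)
    have "\<forall>x. \<exists>r. r > 0 \<and> (x \<in> {c..d} - E \<longrightarrow> (\<forall>y\<in>{c..d}. \<bar>y - x\<bar> < r \<longrightarrow>
               cmod (F y - F x - (y - x) *\<^sub>R f x) \<le> e' * \<bar>y - x\<bar>))"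
    proof
      fix x
      show "\<exists>r. r > 0 \<and> (x \<in> {c..d} - E \<longrightarrow> (\<forall>y\<in>{c..d}. \<bar>y - x\<bar> < r \<longrightarrow>
               cmod (F y - F x - (y - x) *\<^sub>R f x) \<le> e' * \<bar>y - x\<bar>))"
      proof (cases "x \<in> {c..d} - E")
        case True
        have "\<forall>e>0. \<exists>r>0. \<forall>y\<in>{c..d}. norm (y - x) < r \<longrightarrow>
               norm (F y - F x - (y - x) *\<^sub>R f x) \<le> e * norm (y - x)"
          using der[OF True] unfolding has_vector_derivative_def has_derivative_within_alt by (rule conjunct2)
        from this[rule_format, OF e'] show ?thesis unfolding real_norm_def by blast
      qed (auto intro: exI[of _ 1])
    qed
    from choice[OF this] obtain r where r0: "\<forall>x. r x > 0 \<and> (x \<in> {c..d} - E \<longrightarrow> (\<forall>y\<in>{c..d}. \<bar>y - x\<bar> < r x \<longrightarrow>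
               cmod (F y - F x - (y - x) *\<^sub>R f x) \<le> e' * \<bar>y - x\<bar>))" ..
    have r: "r x > 0" "\<lbrakk>x \<in> {c..d} - E; y \<in> {c..d}; \<bar>y - x\<bar> < r x\<rbrakk> \<Longrightarrow>
               cmod (F y - F x - (y - x) *\<^sub>R f x) \<le> e' * \<bar>y - x\<bar>" for x y
      using r0 by blast+
    define \<gamma> where "\<gamma> = (\<lambda>x. if x \<in> E then U else ball x (r x))"
    have gauge: "gauge \<gamma>" unfolding gauge_def \<gamma>_def using U r(1) by auto
    have "norm ((\<Sum>(x,k)\<in>p. measure lborel k *\<^sub>R g x) - (F d - F c)) < e"
      if p: "p tagged_division_of {c..d}" and fine: "\<gamma> fine p" for p
    proof -
      note pD = tagged_division_ofD[OF p]
      have cell: "measure lborel k = Sup k - Inf k \<and> Inf k \<le> x \<and> x \<le> Sup k \<and> Inf k \<in> k \<and> Sup k \<in> k \<and> Inf k \<in> {c..d} \<and> Sup k \<in> {c..d}"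
        if xk: "(x,k) \<in> p" for x k
      proof -
        obtain a b where k: "k = cbox a b" using pD(4)[OF xk] by blast
        have x: "x \<in> k" using pD(2)[OF xk] .
        then have "a \<le> b" "Inf k = a" "Sup k = b" using k by auto
        then show ?thesis using k x pD(3)[OF xk] by auto
      qed
      define pE where "pE = {(x,k)\<in>p. x \<in> E}"
      have pE: "pE \<subseteq> p" by (auto simp: pE_def)
      have fin: "finite p" using pD(1) .
      have tot: "(\<Sum>(x,k)\<in>p. F (Sup k) - F (Inf k)) = F d - F c"
        using additive_tagged_division_1[OF \<open>c \<le> d\<close> p] .
      have "norm ((\<Sum>(x,k)\<in>p. measure lborel k *\<^sub>R g x) - (F d - F c))
          = norm (\<Sum>(x,k)\<in>p. (F (Sup k) - F (Inf k)) - measure lborel k *\<^sub>R g x)"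
        unfolding tot[symmetric] by (subst norm_minus_commute) (simp add: sum_subtractf case_prod_unfold)
      also have "\<dots> \<le> (\<Sum>(x,k)\<in>p. norm ((F (Sup k) - F (Inf k)) - measure lborel k *\<^sub>R g x))"
        unfolding case_prod_unfold by (rule norm_sum)
      also have "\<dots> = (\<Sum>(x,k)\<in>p - pE. norm ((F (Sup k) - F (Inf k)) - measure lborel k *\<^sub>R g x))
                   + (\<Sum>(x,k)\<in>pE. norm ((F (Sup k) - F (Inf k)) - measure lborel k *\<^sub>R g x))"
        using sum.subset_diff[OF pE fin] by simp
      also have "\<dots> \<le> e' * (d - c) + (\<Sum>(x,k)\<in>pE. norm ((F (Sup k) - F (Inf k)) - measure lborel k *\<^sub>R g x))"
      proof -
        have "(\<Sum>(x,k)\<in>p - pE. norm ((F (Sup k) - F (Inf k)) - measure lborel k *\<^sub>R g x))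
             \<le> (\<Sum>(x,k)\<in>p - pE. e' * measure lborel k)"
        proof (rule sum_mono, safe)
          fix x k assume xk: "(x,k) \<in> p" "(x,k) \<notin> pE"
          then have xE: "x \<notin> E" by (auto simp: pE_def)
          note c = cell[OF xk(1)]
          have "k \<subseteq> ball x (r x)" using fine xk(1) xE by (fastforce simp: fine_def \<gamma>_def)
          then have b: "\<bar>Inf k - x\<bar> < r x" "\<bar>Sup k - x\<bar> < r x"
            using c by (auto simp: dist_real_def subset_iff abs_minus_commute)
          have x: "x \<in> {c..d} - E" using pD(2,3)[OF xk(1)] xE by auto
          have "(F (Sup k) - F (Inf k)) - measure lborel k *\<^sub>R g x
             = (F (Sup k) - F x - (Sup k - x) *\<^sub>R f x) - (F (Inf k) - F x - (Inf k - x) *\<^sub>R f x)"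
            unfolding c[THEN conjunct1] using xE by (simp add: g_def algebra_simps)
          then have "norm ((F (Sup k) - F (Inf k)) - measure lborel k *\<^sub>R g x) \<le>
             norm (F (Sup k) - F x - (Sup k - x) *\<^sub>R f x) + norm (F (Inf k) - F x - (Inf k - x) *\<^sub>R f x)"
            by (metis norm_triangle_ineq4)
          also have "\<dots> \<le> e' * \<bar>Sup k - x\<bar> + e' * \<bar>Inf k - x\<bar>"
            using c b by (intro add_mono r(2)[OF x]) auto
          also have "\<dots> = e' * measure lborel k"
            unfolding c[THEN conjunct1] using c[THEN conjunct2] by (simp add: algebra_simps)
          finally show "norm ((F (Sup k) - F (Inf k)) - measure lborel k *\<^sub>R g x) \<le> e' * measure lborel k" .
        qed
        also have "\<dots> \<le> (\<Sum>(x,k)\<in>p. e' * measure lborel k)"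
          using e' fin by (intro sum_mono2) (auto simp: zero_le_mult_iff)
        also have "\<dots> = e' * (d - c)"
          using additive_content_tagged_division[of p c d] p \<open>c \<le> d\<close>
          by (simp add: sum_distrib_left[symmetric] case_prod_unfold)
        finally show ?thesis by simp
      qed
      also have "(\<Sum>(x,k)\<in>pE. norm ((F (Sup k) - F (Inf k)) - measure lborel k *\<^sub>R g x))
                = (\<Sum>(x,k)\<in>pE. norm (F (Sup k) - F (Inf k)))"
        by (intro sum.cong) (auto simp: pE_def g_def)
      also have "\<dots> < e/2"
      proof -
        have part: "pE tagged_division_of \<Union>(snd ` pE)"
          using tagged_partial_division_of_Union_self[OF tagged_partial_division_subset[OF _ pE]] p
          by (auto simp: tagged_division_of_def)
        define G where "G = (\<lambda>k. if k = {} then 0 else norm (F (Sup k) - F (Inf k)))"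
        have div: "snd ` pE division_of \<Union>(snd ` pE)"
          using division_of_tagged_division[OF part] .
        have "(\<Sum>(x,k)\<in>pE. norm (F (Sup k) - F (Inf k))) = (\<Sum>(x,k)\<in>pE. G k)"
        proof (intro sum.cong refl, clarify)
          fix x k assume "(x, k) \<in> pE"
          then have "x \<in> k" using pD(2) pE by blast
          then show "norm (F (Sup k) - F (Inf k)) = G k" by (auto simp: G_def)
        qed
        also have "\<dots> = (\<Sum>k\<in>snd ` pE. G k)"
        proof (rule sum.over_tagged_division_lemma[OF part])
          fix u v :: real assume "box u v = {}"
          then show "G (cbox u v) = 0" by (cases "u = v") (auto simp: G_def)
        qed
        also have "\<dots> = (\<Sum>k\<in>snd ` pE. norm (F (Sup k) - F (Inf k)))"
          using division_ofD(3)[OF div] by (intro sum.cong) (auto simp: G_def)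
        also have "\<dots> < e/2"
        proof (rule \<delta>(2)[rule_format, OF div])
          show "\<Union>(snd ` pE) \<subseteq> {c..d}" using pD(3) pE by fastforce
          have "\<Union>(snd ` pE) \<subseteq> U"
            using fine unfolding pE_def fine_def \<gamma>_def by fastforce
          moreover have "\<Union>(snd ` pE) \<in> lmeasurable"
            using sum_length_division(1)[OF div] .
          ultimately have "measure lebesgue (\<Union>(snd ` pE)) \<le> measure lebesgue U"
            using U by (intro measure_mono_fmeasurable) (auto simp: fmeasurableD)
          then show "(\<Sum>k\<in>snd ` pE. Sup k - Inf k) < \<delta>"
            using sum_length_division(2)[OF div] U(4) by simp
        qed
        finally show ?thesis .
      qed
      finally have "norm ((\<Sum>(x,k)\<in>p. measure lborel k *\<^sub>R g x) - (F d - F c)) < e' * (d - c) + e / 2" by simp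
      also have "\<dots> \<le> e" using \<open>e > 0\<close> \<open>c \<le> d\<close> by (simp add: e'_def field_simps)
      finally show ?thesis .
    qed
    with gauge show "\<exists>\<gamma>. gauge \<gamma> \<and> (\<forall>p. p tagged_division_of {c..d} \<and> \<gamma> fine p \<longrightarrow>
        norm ((\<Sum>(x,k)\<in>p. measure lborel k *\<^sub>R g x) - (F d - F c)) < e)"
      by (intro exI[of _ \<gamma>] conjI allI impI) simp_all
  qed
  note g = this
  show ?thesis
  proof (rule has_integral_spike[OF E _ g])
    show "f x = g x" if "x \<in> {c..d} - E" for x using that by (simp add: g_def)
  qed
qed


section \<open>Indefinite integrals\<close>

text \<open>The set of points at which some short interval violates the differentiability estimate by a
  fixed factor is negligible: by Henstock's lemma any disjoint family of such intervals that is fine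
  for a suitable gauge has small total length, and by the Vitali covering lemma the fivefold
  enlargements of such a family cover the set.\<close>

lemma negligible_bad_points:
  fixes f :: "real \<Rightarrow> 'a::euclidean_space"
  assumes int: "f integrable_on {a..b}" and "\<epsilon> > 0"
  shows "negligible {x. \<forall>\<eta>>0. \<exists>u v. a \<le> u \<and> u \<le> x \<and> x \<le> v \<and> v \<le> b \<and> u < v \<and> v - u < \<eta> \<and>
            norm ((v - u) *\<^sub>R f x - integral {u..v} f) > \<epsilon> * (v - u)}" (is "negligible ?B")
  unfolding negligible_outer_le
proof (intro allI impI)
  fix e :: real assume "e > 0"
  define e' where "e' = \<epsilon> * e / 5"
  have "e' > 0" using \<open>e > 0\<close> \<open>\<epsilon> > 0\<close> by (simp add: e'_def)
  have "\<exists>\<gamma>. gauge \<gamma> \<and> (\<forall>p. p tagged_partial_division_of (cbox a b) \<longrightarrow> \<gamma> fine p \<longrightarrow>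
      (\<Sum>(x,k)\<in>p. norm (measure lborel k *\<^sub>R f x - integral k f)) < e')"
  proof (rule Henstock_lemma[of f a b e'])
    fix \<gamma> assume "gauge \<gamma>" "\<And>p. \<lbrakk>p tagged_partial_division_of (cbox a b); \<gamma> fine p\<rbrakk> \<Longrightarrow>
      (\<Sum>(x,k)\<in>p. norm (measure lborel k *\<^sub>R f x - integral k f)) < e'"
    then show ?thesis by (intro exI[of _ \<gamma>] conjI allI impI)
  qed (use int \<open>e' > 0\<close> in auto)
  then obtain \<gamma> where \<gamma>: "gauge \<gamma>" "\<forall>p. p tagged_partial_division_of (cbox a b) \<longrightarrow> \<gamma> fine p \<longrightarrow>
      (\<Sum>(x,k)\<in>p. norm (measure lborel k *\<^sub>R f x - integral k f)) < e'"
    by blast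
  define Q where "Q = (\<lambda>x u v. a \<le> u \<and> u \<le> x \<and> x \<le> v \<and> v \<le> b \<and> u < v \<and>
       norm ((v - u) *\<^sub>R f x - integral {u..v} f) > \<epsilon> * (v - u))"
  have BQ: "\<exists>u v. Q x u v \<and> v - u < \<eta>" if "x \<in> ?B" "\<eta> > 0" for x \<eta>
    using that unfolding Q_def by blast
  define B where "B = ?B"
  have "\<exists>u v. Q x u v \<and> {u..v} \<subseteq> \<gamma> x" if xB: "x \<in> B" for x
  proof -
    have "open (\<gamma> x)" "x \<in> \<gamma> x" using \<gamma>(1) unfolding gauge_def by blast+
    then obtain \<eta> where \<eta>: "\<eta> > 0" "ball x \<eta> \<subseteq> \<gamma> x" by (rule openE)
    obtain u v where uv: "Q x u v" "v - u < \<eta>"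
      using BQ[OF xB[unfolded B_def] \<eta>(1)] by blast
    have "{u..v} \<subseteq> ball x \<eta>" using uv by (auto simp: dist_real_def Q_def)
    then show ?thesis using uv \<eta>(2) by blast
  qed
  then obtain u v where "\<And>x. x \<in> B \<Longrightarrow> Q x (u x) (v x) \<and> {u x..v x} \<subseteq> \<gamma> x"
    by metis
  then have uv: "a \<le> u x \<and> u x \<le> x \<and> x \<le> v x \<and> v x \<le> b \<and> u x < v x \<and> {u x..v x} \<subseteq> \<gamma> x \<and>
       norm ((v x - u x) *\<^sub>R f x - integral {u x..v x} f) > \<epsilon> * (v x - u x)" if "x \<in> B" for x
    using that unfolding Q_def by blast
  define m where "m = (\<lambda>x. (u x + v x) / 2)"
  define r where "r = (\<lambda>x. (v x - u x) / 2)"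
  have cb: "cball (m x) (r x) = {u x..v x}" if "x \<in> B" for x
    using uv[OF that] by (auto simp: m_def r_def cball_eq_atLeastAtMost field_simps)
  obtain C where C: "countable C" "C \<subseteq> B"
     "pairwise (\<lambda>i j. disjnt (cball (m i) (r i)) (cball (m j) (r j))) C"
     "B \<subseteq> (\<Union>i\<in>C. cball (m i) (5 * r i))"
  proof (rule Vitali_covering_lemma_cballs[where S = B and K = B and a = m and r = r and B = "b - a"])
    show "B \<subseteq> (\<Union>i\<in>B. cball (m i) (r i))"
    proof
      fix x assume x: "x \<in> B"
      then have "x \<in> cball (m x) (r x)" using cb[OF x] uv[OF x] by simp
      then show "x \<in> (\<Union>i\<in>B. cball (m i) (r i))" using x by blast
    qed
    show "0 < r i \<and> r i \<le> b - a" if "i \<in> B" for i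
      using uv[OF that] by (auto simp: r_def)
  qed (rule that)
  have total: "measure lebesgue (\<Union>i\<in>I. cball (m i) (5 * r i)) \<le> e" if I: "I \<subseteq> C" "finite I" for I
  proof -
    define p where "p = (\<lambda>x. (x, {u x..v x})) ` I"
    have IB: "i \<in> B" if "i \<in> I" for i using that I C by blast
    have disj: "{u i..v i} \<inter> {u j..v j} = {}" if "i \<in> I" "j \<in> I" "i \<noteq> j" for i j
    proof -
      have "disjnt (cball (m i) (r i)) (cball (m j) (r j))"
        using C(3) that I(1) unfolding pairwise_def by blast
      then show ?thesis using cb[OF IB[OF that(1)]] cb[OF IB[OF that(2)]] by (simp add: disjnt_def)
    qed
    have "p tagged_partial_division_of (cbox a b)"
      unfolding tagged_partial_division_of_def
    proof (intro conjI allI impI)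
      show "finite p" using I by (simp add: p_def)
      fix x K assume xK: "(x, K) \<in> p"
      then have x: "x \<in> I" "K = {u x..v x}" by (auto simp: p_def)
      show "x \<in> K" "K \<subseteq> cbox a b" "\<exists>a b. K = cbox a b"
        using uv[OF IB[OF x(1)]] x(2) by (auto intro: exI[of _ "u x"] exI[of _ "v x"])
    next
      fix x1 K1 x2 K2 assume "(x1, K1) \<in> p \<and> (x2, K2) \<in> p \<and> (x1, K1) \<noteq> (x2, K2)"
      then have "x1 \<in> I" "x2 \<in> I" "x1 \<noteq> x2" "K1 = {u x1..v x1}" "K2 = {u x2..v x2}"
        by (auto simp: p_def)
      then have "K1 \<inter> K2 = {}" using disj by simp
      then show "interior K1 \<inter> interior K2 = {}"
        using interior_subset by blast
    qed
    moreover have "\<gamma> fine p"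
      using uv IB by (auto simp: fine_def p_def)
    ultimately have less: "(\<Sum>(x,k)\<in>p. norm (measure lborel k *\<^sub>R f x - integral k f)) < e'"
      by (rule \<gamma>(2)[rule_format])
    have inj: "inj_on (\<lambda>x. (x, {u x..v x})) I" by (auto simp: inj_on_def)
    have "(\<Sum>x\<in>I. \<epsilon> * (v x - u x)) \<le> (\<Sum>x\<in>I. norm (measure lborel {u x..v x} *\<^sub>R f x - integral {u x..v x} f))"
    proof (rule sum_mono)
      fix x assume "x \<in> I"
      then show "\<epsilon> * (v x - u x) \<le> norm (measure lborel {u x..v x} *\<^sub>R f x - integral {u x..v x} f)"
        using uv[OF IB] by (auto simp: less_eq_real_def)
    qed
    also have "\<dots> = (\<Sum>(x,k)\<in>p. norm (measure lborel k *\<^sub>R f x - integral k f))"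
      unfolding p_def by (subst sum.reindex[OF inj]) (simp add: o_def)
    finally have len: "\<epsilon> * (\<Sum>x\<in>I. v x - u x) < e'" using less by (simp add: sum_distrib_left)
    have "measure lebesgue (\<Union>i\<in>I. cball (m i) (5 * r i)) \<le> (\<Sum>i\<in>I. measure lebesgue (cball (m i) (5 * r i)))"
      by (intro measure_UNION_le I) auto
    also have "\<dots> = (\<Sum>i\<in>I. 5 * (v i - u i))"
    proof (rule sum.cong)
      fix i assume "i \<in> I"
      then have "r i \<ge> 0" using uv[OF IB] by (fastforce simp: r_def)
      then show "measure lebesgue (cball (m i) (5 * r i)) = 5 * (v i - u i)"
        by (simp add: cball_eq_atLeastAtMost) (simp add: r_def)
    qed simp
    also have "\<dots> = 5 * (\<Sum>i\<in>I. v i - u i)" by (simp add: sum_distrib_left)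
    also have "\<dots> \<le> e"
      using len \<open>\<epsilon> > 0\<close> by (simp add: e'_def field_simps)
    finally show ?thesis .
  qed
  show "\<exists>T. ?B \<subseteq> T \<and> T \<in> lmeasurable \<and> measure lebesgue T \<le> e"
  proof (intro exI conjI)
    show "(\<Union>i\<in>C. cball (m i) (5 * r i)) \<in> lmeasurable"
      by (rule fmeasurable_UN_bound[OF C(1) _ total]) auto
    show "measure lebesgue (\<Union>i\<in>C. cball (m i) (5 * r i)) \<le> e"
      by (rule measure_UN_bound[OF C(1) _ total]) auto
  qed (use C(4) B_def in blast)
qed

text \<open>Lebesgue's differentiation theorem on the line.\<close>

theorem indefinite_integral_has_vector_derivative_ae:
  fixes f :: "real \<Rightarrow> 'a::euclidean_space"
  assumes int: "f integrable_on {a..b}"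
    and F: "\<And>x y. \<lbrakk>a \<le> x; x \<le> y; y \<le> b\<rbrakk> \<Longrightarrow> F y - F x = integral {x..y} f"
  obtains E where "negligible E" "\<And>x. x \<in> {a<..<b} - E \<Longrightarrow> (F has_vector_derivative f x) (at x)"
proof -
  define B where "B = (\<lambda>n. {x. \<forall>\<eta>>0. \<exists>u v. a \<le> u \<and> u \<le> x \<and> x \<le> v \<and> v \<le> b \<and> u < v \<and> v - u < \<eta> \<and>
            norm ((v - u) *\<^sub>R f x - integral {u..v} f) > inverse (real (Suc n)) * (v - u)})"
  have neg: "negligible (\<Union>n. B n)"
    unfolding B_def by (intro negligible_Union_nat negligible_bad_points int) auto
  have "(F has_vector_derivative f x) (at x)" if x: "x \<in> {a<..<b} - (\<Union>n. B n)" for x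
    unfolding has_vector_derivative_def has_derivative_at_alt
  proof (intro conjI allI impI bounded_linear_scaleR_left)
    fix e :: real assume "e > 0"
    then obtain n where n: "inverse (real (Suc n)) < e" using reals_Archimedean by blast
    have "x \<notin> B n" using x by blast
    then obtain \<eta> where "\<eta> > 0" and \<eta>0: "\<not> (\<exists>u v. a \<le> u \<and> u \<le> x \<and> x \<le> v \<and> v \<le> b \<and> u < v \<and> v - u < \<eta> \<and>
            norm ((v - u) *\<^sub>R f x - integral {u..v} f) > inverse (real (Suc n)) * (v - u))"
      unfolding B_def by blast
    then have \<eta>: "\<eta> > 0" "\<lbrakk>a \<le> u; u \<le> x; x \<le> v; v \<le> b; u < v; v - u < \<eta>\<rbrakk> \<Longrightarrow>
            norm ((v - u) *\<^sub>R f x - integral {u..v} f) \<le> inverse (real (Suc n)) * (v - u)" for u v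
      using not_less by blast+
    have "norm (F y - F x - (y - x) *\<^sub>R f x) \<le> e * norm (y - x)"
      if y: "norm (y - x) < min \<eta> (min (x - a) (b - x))" for y
    proof -
      consider "x < y" | "y < x" | "y = x" by linarith
      then show ?thesis
      proof cases
        case 1
        then have "norm (F y - F x - (y - x) *\<^sub>R f x) \<le> inverse (real (Suc n)) * (y - x)"
          using \<eta>(2)[of x y] F[of x y] y x by (simp add: norm_minus_commute)
        also have "\<dots> \<le> e * norm (y - x)" using 1 n \<open>e > 0\<close> by (intro mult_mono) auto
        finally show ?thesis .
      next
        case 2
        have "F y - F x - (y - x) *\<^sub>R f x = (x - y) *\<^sub>R f x - integral {y..x} f"
          using F[of y x] 2 y x by (simp add: algebra_simps)
        then have "norm (F y - F x - (y - x) *\<^sub>R f x) \<le> inverse (real (Suc n)) * (x - y)"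
          using \<eta>(2)[of y x] 2 y x by simp
        also have "\<dots> \<le> e * norm (y - x)" using 2 n \<open>e > 0\<close> by (intro mult_mono) auto
        finally show ?thesis .
      qed simp
    qed
    then show "\<exists>d>0. \<forall>y. norm (y - x) < d \<longrightarrow> norm (F y - F x - (y - x) *\<^sub>R f x) \<le> e * norm (y - x)"
      using \<eta>(1) x by (intro exI[of _ "min \<eta> (min (x - a) (b - x))"]) auto
  qed
  then show ?thesis using that neg by blast
qed

text \<open>The integrand is split into a bounded part, controlled by the total length, and a part with
  small integral.\<close>

lemma abs_continuous_on_indefinite_integral:
  fixes f :: "real \<Rightarrow> complex"
  assumes f: "f absolutely_integrable_on {a..b}"
    and F: "\<And>x y. \<lbrakk>a \<le> x; x \<le> y; y \<le> b\<rbrakk> \<Longrightarrow> F y - F x = integral {x..y} f"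
  shows "abs_continuous_on a b F"
  unfolding abs_continuous_on_def
proof (intro allI impI)
  fix \<epsilon> :: real assume "\<epsilon> > 0"
  define g where "g = (\<lambda>n x. min (norm (f x)) (real n))"
  have nf: "(\<lambda>x. norm (f x)) absolutely_integrable_on {a..b}"
    using absolutely_integrable_norm[OF f] by (simp add: o_def)
  have g_ai: "g n absolutely_integrable_on {a..b}" for n
    unfolding g_def by (intro absolutely_integrable_min_1 nf) auto
  have "(\<lambda>n. integral {a..b} (g n)) \<longlonglongrightarrow> integral {a..b} (\<lambda>x. norm (f x))"
  proof (rule dominated_convergence(2)[where h = "\<lambda>x. norm (f x)"])
    show "(\<lambda>n. g n x) \<longlonglongrightarrow> norm (f x)" for x
    proof (rule tendsto_eventually)
      obtain N where "norm (f x) \<le> real N" using real_arch_simple by blast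
      then show "\<forall>\<^sub>F n in sequentially. g n x = norm (f x)"
        unfolding eventually_sequentially g_def by (intro exI[of _ N]) auto
    qed
  qed (use g_ai nf in \<open>auto simp: g_def intro: set_lebesgue_integral_eq_integral(1)\<close>)
  then obtain n where n: "\<bar>integral {a..b} (g n) - integral {a..b} (\<lambda>x. norm (f x))\<bar> < \<epsilon>/2"
    using \<open>\<epsilon> > 0\<close> unfolding LIMSEQ_iff by (metis half_gt_zero order_refl real_norm_def)
  define h where "h = (\<lambda>x. norm (f x) - g n x)"
  have h_ai: "h absolutely_integrable_on {a..b}"
    unfolding h_def using nf g_ai by (rule set_integral_diff)
  have h_int: "h integrable_on {a..b}" using h_ai by (rule set_lebesgue_integral_eq_integral(1))
  have h_nn: "h x \<ge> 0" for x by (simp add: h_def g_def)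
  have hI: "integral {a..b} h < \<epsilon>/2"
    using n unfolding h_def
    by (subst integral_diff[OF set_lebesgue_integral_eq_integral(1)[OF nf] set_lebesgue_integral_eq_integral(1)[OF g_ai]]) linarith
  define \<delta> where "\<delta> = \<epsilon> / (2 * (real n + 1))"
  have "(\<Sum>k\<in>D. cmod (F (Sup k) - F (Inf k))) < \<epsilon>"
    if D: "D division_of \<Union>D" "\<Union>D \<subseteq> {a..b}" "(\<Sum>k\<in>D. Sup k - Inf k) < \<delta>" for D
  proof -
    have "cmod (F (Sup k) - F (Inf k)) \<le> real n * (Sup k - Inf k) + integral k h" if k: "k \<in> D" for k
    proof -
      define u v where "u = Inf k" "v = Sup k"
      have uv: "k = {u..v}" "u \<le> v"
        using real_division_intervals(1,2)[OF D(1) k] by (simp_all add: u_v_def)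
      have sub: "{u..v} \<subseteq> {a..b}" using D(2) k uv(1) by blast
      then have ab: "a \<le> u" "v \<le> b" using uv(2) by auto
      have ik: "f integrable_on {u..v}" "(\<lambda>x. norm (f x)) integrable_on {u..v}" "h integrable_on {u..v}"
        using set_lebesgue_integral_eq_integral(1)[OF f] set_lebesgue_integral_eq_integral(1)[OF nf] h_int sub
        by (auto intro: integrable_subinterval_real)
      have "F v - F u = integral {u..v} f"
        using F[OF ab(1) uv(2) ab(2)] .
      then have "cmod (F v - F u) \<le> integral {u..v} (\<lambda>x. norm (f x))"
        using integral_norm_bound_integral[OF ik(1,2)] by simp
      also have "\<dots> \<le> integral {u..v} (\<lambda>x. real n + h x)"
        by (rule integral_le) (use ik in \<open>auto simp: h_def g_def intro: integrable_add\<close>)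
      also have "\<dots> = integral {u..v} (\<lambda>x. real n) + integral {u..v} h"
        using ik(3) by (intro integral_add) auto
      also have "integral {u..v} (\<lambda>x. real n) = real n * (v - u)"
        using uv(2) by simp
      finally show ?thesis unfolding u_v_def(1)[symmetric] u_v_def(2)[symmetric] uv(1)[symmetric] .
    qed
    then have "(\<Sum>k\<in>D. cmod (F (Sup k) - F (Inf k))) \<le> (\<Sum>k\<in>D. real n * (Sup k - Inf k) + integral k h)"
      by (rule sum_mono)
    also have "\<dots> = real n * (\<Sum>k\<in>D. Sup k - Inf k) + (\<Sum>k\<in>D. integral k h)"
      by (simp add: sum.distrib sum_distrib_left)
    also have "(\<Sum>k\<in>D. integral k h) \<le> integral {a..b} h"
    proof -
      have hD: "(h has_integral (\<Sum>k\<in>D. integral k h)) (\<Union>D)"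
      proof (rule has_integral_combine_division[OF D(1)])
        fix k assume k: "k \<in> D"
        have "k \<subseteq> {a..b}" using D(2) k by blast
        then have "h integrable_on k"
          using real_division_intervals(1)[OF D(1) k] h_int by (metis integrable_subinterval_real)
        then show "(h has_integral integral k h) k" by blast
      qed
      show ?thesis
        by (rule has_integral_subset_le[OF D(2) hD integrable_integral[OF h_int]]) (simp add: h_nn)
    qed
    also note hI
    also have "real n * (\<Sum>k\<in>D. Sup k - Inf k) \<le> real n * \<delta>" using D(3) by (intro mult_left_mono) auto
    also have "real n * \<delta> \<le> \<epsilon> / 2"
      using \<open>\<epsilon> > 0\<close> by (simp add: \<delta>_def field_simps)
    finally show ?thesis by simp
  qed
  moreover have "\<delta> > 0" using \<open>\<epsilon> > 0\<close> by (simp add: \<delta>_def)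
  ultimately show "\<exists>\<delta>>0. \<forall>D. D division_of \<Union>D \<and> \<Union>D \<subseteq> {a..b} \<and> (\<Sum>k\<in>D. Sup k - Inf k) < \<delta> \<longrightarrow>
     (\<Sum>k\<in>D. cmod (F (Sup k) - F (Inf k))) < \<epsilon>"
    by blast
qed

section \<open>Volterra integral equations with locally integrable coefficients\<close>

text \<open>Absolute integrability on every compact segment with endpoints in \<open>J\<close>; for an interval \<open>J\<close>
  this is local integrability on \<open>J\<close>. For \<open>d < c\<close> the condition is vacuous.\<close>

definition locally_integrable :: "real set \<Rightarrow> (real \<Rightarrow> 'a::euclidean_space) \<Rightarrow> bool" where
  "locally_integrable J f \<longleftrightarrow> (\<forall>c\<in>J. \<forall>d\<in>J. f absolutely_integrable_on {c..d})"

text \<open>The oriented integral of \<open>f\<close> from \<open>c\<close> to \<open>x\<close>.\<close>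

definition iv :: "real \<Rightarrow> (real \<Rightarrow> 'a::euclidean_space) \<Rightarrow> real \<Rightarrow> 'a" where
  "iv c f x = (if c \<le> x then integral {c..x} f else - integral {x..c} f)"

lemma locally_integrableD:
  "locally_integrable J f \<Longrightarrow> c \<in> J \<Longrightarrow> d \<in> J \<Longrightarrow> f absolutely_integrable_on {c..d}"
  "locally_integrable J f \<Longrightarrow> c \<in> J \<Longrightarrow> d \<in> J \<Longrightarrow> f integrable_on {c..d}"
  unfolding locally_integrable_def using set_lebesgue_integral_eq_integral(1) by blast+

lemma locally_integrable_norm:
  "locally_integrable J f \<Longrightarrow> locally_integrable J (\<lambda>x. norm (f x))"
  unfolding locally_integrable_def using absolutely_integrable_norm by (fastforce simp: o_def)

lemma locally_integrable_add:
  "locally_integrable J f \<Longrightarrow> locally_integrable J g \<Longrightarrow> locally_integrable J (\<lambda>x. f x + g x)"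
  unfolding locally_integrable_def using set_integral_add(1) by blast

lemma is_intervalD_real:
  "is_interval (J::real set) \<Longrightarrow> c \<in> J \<Longrightarrow> d \<in> J \<Longrightarrow> {c..d} \<subseteq> J"
  unfolding is_interval_1 by (meson atLeastAtMost_iff subsetI)

lemma locally_integrable_mult_continuous:
  fixes f g :: "real \<Rightarrow> complex"
  assumes J: "is_interval J" and f: "locally_integrable J f" and g: "continuous_on J g"
  shows "locally_integrable J (\<lambda>x. f x * g x)"
  unfolding locally_integrable_def
proof (intro ballI)
  fix c d assume cd: "c \<in> J" "d \<in> J"
  have cont: "continuous_on {c..d} g" using continuous_on_subset[OF g is_intervalD_real[OF J cd]] .
  have "(\<lambda>x. g x * f x) absolutely_integrable_on {c..d}"
  proof (rule absolutely_integrable_bounded_measurable_product[where h = "(*)"])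
    show "bilinear ((*) :: complex \<Rightarrow> complex \<Rightarrow> complex)"
      by (simp add: bilinear_conv_bounded_bilinear bounded_bilinear_mult)
    show "g \<in> borel_measurable (lebesgue_on {c..d})"
      using cont by (rule continuous_imp_measurable_on_sets_lebesgue) simp
    show "bounded (g ` {c..d})"
      using cont by (intro compact_imp_bounded compact_continuous_image) auto
    show "f absolutely_integrable_on {c..d}" using f cd by (rule locally_integrableD(1))
  qed auto
  then show "(\<lambda>x. f x * g x) absolutely_integrable_on {c..d}" by (simp add: mult.commute)
qed

lemma iv_self [simp]: "iv c f c = 0"
  by (simp add: iv_def)

lemma iv_diff:
  assumes f: "locally_integrable J f" and "c \<in> J" "x \<in> J" "y \<in> J" "x \<le> y"
  shows "iv c f y - iv c f x = integral {x..y} f"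
proof -
  note int = locally_integrableD(2)[OF f]
  consider "c \<le> x" | "x < c" "c \<le> y" | "y < c" by linarith
  then show ?thesis
  proof cases
    case 1
    then show ?thesis
      using Henstock_Kurzweil_Integration.integral_combine[OF 1 assms(5) int[OF assms(2,4)]] assms(5)
      by (simp add: iv_def algebra_simps)
  next
    case 2
    then show ?thesis
      using Henstock_Kurzweil_Integration.integral_combine[of x c y f] int[OF assms(3,4)]
      by (simp add: iv_def algebra_simps)
  next
    case 3
    then show ?thesis
      using Henstock_Kurzweil_Integration.integral_combine[of x y c f] int[OF assms(3,2)] assms(5)
      by (simp add: iv_def algebra_simps)
  qed
qed

lemma iv_cong:
  assumes "is_interval J" "c \<in> J" "x \<in> J" "\<And>t. t \<in> J \<Longrightarrow> f t = g t"
  shows "iv c f x = iv c g x"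
proof -
  have "integral {c..x} f = integral {c..x} g" "integral {x..c} f = integral {x..c} g"
    using assms(4) is_intervalD_real[OF assms(1,2,3)] is_intervalD_real[OF assms(1,3,2)]
    by (auto intro!: integral_cong)
  then show ?thesis by (simp add: iv_def)
qed

lemma iv_add:
  assumes "locally_integrable J f" "locally_integrable J g" "c \<in> J" "x \<in> J"
  shows "iv c (\<lambda>t. f t + g t) x = iv c f x + iv c g x"
  using assms by (simp add: iv_def integral_add locally_integrableD(2))

lemma norm_iv_le:
  fixes f :: "real \<Rightarrow> 'a::euclidean_space"
  assumes f: "locally_integrable J f" and h: "locally_integrable J h" and "c \<in> J" "x \<in> J"
    and le: "\<And>t. t \<in> {min c x..max c x} \<Longrightarrow> norm (f t) \<le> h t"
  shows "norm (iv c f x) \<le> integral {min c x..max c x} h"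
proof -
  note int = locally_integrableD(2)
  show ?thesis
  proof (cases "c \<le> x")
    case True
    then show ?thesis
      using integral_norm_bound_integral[OF int[OF f assms(3,4)] int[OF h assms(3,4)]] le
      by (simp add: iv_def)
  next
    case False
    then show ?thesis
      using integral_norm_bound_integral[OF int[OF f assms(4,3)] int[OF h assms(4,3)]] le
      by (simp add: iv_def)
  qed
qed

lemma iv_abs_continuous_on:
  fixes f :: "real \<Rightarrow> complex"
  assumes J: "is_interval J" and f: "locally_integrable J f" and "c \<in> J" "a \<in> J" "b \<in> J"
  shows "abs_continuous_on a b (iv c f)"
proof (rule abs_continuous_on_indefinite_integral[OF locally_integrableD(1)[OF f assms(4,5)]])
  fix x y assume "a \<le> x" "x \<le> y" "y \<le> b"
  then have "x \<in> J" "y \<in> J" using is_intervalD_real[OF J assms(4,5)] by auto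
  then show "iv c f y - iv c f x = integral {x..y} f"
    using iv_diff[OF f assms(3)] \<open>x \<le> y\<close> by blast
qed

lemma open_interval_between:
  assumes "open (J::real set)" "x \<in> J"
  obtains a b where "a \<in> J" "b \<in> J" "a < x" "x < b"
proof -
  obtain e where e: "e > 0" "cball x e \<subseteq> J" using assms open_contains_cball by blast
  have "x - e \<in> cball x e" "x + e \<in> cball x e" using e(1) by (simp_all add: dist_real_def)
  then have "x - e \<in> J" "x + e \<in> J" using e(2) by blast+
  then show ?thesis using that[of "x - e" "x + e"] e(1) by simp
qed

lemma continuous_on_open_interval:
  fixes f :: "real \<Rightarrow> 'a::topological_space"
  assumes "open J" "\<And>a b. a \<in> J \<Longrightarrow> b \<in> J \<Longrightarrow> continuous_on {a..b} f"
  shows "continuous_on J f"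
  unfolding continuous_on_eq_continuous_at[OF assms(1)]
proof
  fix x assume "x \<in> J"
  then obtain a b where ab: "a \<in> J" "b \<in> J" "a < x" "x < b"
    using open_interval_between[OF assms(1)] by blast
  then show "isCont f x"
    using continuous_on_interior[OF assms(2)[OF ab(1,2)], of x] by simp
qed

lemma iv_continuous_on:
  fixes f :: "real \<Rightarrow> complex"
  assumes "open J" "is_interval J" "locally_integrable J f" "c \<in> J"
  shows "continuous_on J (iv c f)"
  using assms(1) by (rule continuous_on_open_interval)
    (use iv_abs_continuous_on[OF assms(2,3,4)] abs_continuous_on_imp_continuous_on in blast)

lemma iv_has_vector_derivative:
  fixes f :: "real \<Rightarrow> complex"
  assumes J: "is_interval J" and f: "locally_integrable J f" and "c \<in> J" "a \<in> J" "b \<in> J"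
  shows "\<exists>E. negligible E \<and> (\<forall>x\<in>{a<..<b} - E. (iv c f has_vector_derivative f x) (at x))"
proof (rule indefinite_integral_has_vector_derivative_ae[OF locally_integrableD(2)[OF f assms(4,5)]])
  fix x y assume "a \<le> x" "x \<le> y" "y \<le> b"
  then have "x \<in> J" "y \<in> J" using is_intervalD_real[OF J assms(4,5)] by auto
  then show "iv c f y - iv c f x = integral {x..y} f"
    using iv_diff[OF f assms(3)] \<open>x \<le> y\<close> by blast
qed blast

lemma abs_continuous_on_power:
  "abs_continuous_on a b f \<Longrightarrow> abs_continuous_on a b (\<lambda>x. f x ^ Suc n)"
  by (induction n) (simp_all add: abs_continuous_on_mult)

lemma has_integral_power_iv:
  fixes f :: "real \<Rightarrow> complex"
  assumes J: "is_interval J" and f: "locally_integrable J f" and "c \<in> J" "a \<in> J" "b \<in> J" "a \<le> b"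
  shows "((\<lambda>t. of_nat (Suc n) * iv c f t ^ n * f t) has_integral
            (iv c f b ^ Suc n - iv c f a ^ Suc n)) {a..b}"
proof -
  obtain E where E: "negligible E" "\<forall>x\<in>{a<..<b} - E. (iv c f has_vector_derivative f x) (at x)"
    using iv_has_vector_derivative[OF assms(1-5)] by blast
  show ?thesis
  proof (rule has_integral_abs_continuous[where E = "E \<union> {a, b}"])
    show "abs_continuous_on a b (\<lambda>t. iv c f t ^ Suc n)"
      by (intro abs_continuous_on_power iv_abs_continuous_on[OF assms(1-5)])
    show "negligible (E \<union> {a, b})" using E(1) by simp
    fix x assume "x \<in> {a..b} - (E \<union> {a, b})"
    then have "(iv c f has_vector_derivative f x) (at x within {a..b})"
      using E(2) by (auto intro: has_vector_derivative_at_within)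
    then have "((\<lambda>t. iv c f t ^ Suc n) has_derivative (\<lambda>h. of_nat (Suc n) * (h *\<^sub>R f x) * iv c f x ^ n))
        (at x within {a..b})"
      unfolding has_vector_derivative_def
      by (rule has_derivative_eq_rhs[OF has_derivative_power[where n = "Suc n"]]) (simp add: fun_eq_iff mult_ac)
    then show "((\<lambda>t. iv c f t ^ Suc n) has_vector_derivative of_nat (Suc n) * iv c f x ^ n * f x)
        (at x within {a..b})"
      unfolding has_vector_derivative_def by (simp add: mult_ac)
  qed fact
qed

text \<open>The unoriented integral of \<open>|A|\<close> between \<open>c\<close> and \<open>x\<close>. Unlike the oriented integral it grows
  away from \<open>c\<close> in both directions, so that both sides of \<open>c\<close> can be estimated at once.\<close>

definition mass :: "real \<Rightarrow> (real \<Rightarrow> complex) \<Rightarrow> real \<Rightarrow> real" where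
  "mass c A x = integral {min c x..max c x} (\<lambda>t. cmod (A t))"

lemma integral_cmod_nonneg: "integral X (\<lambda>t. cmod (f t)) \<ge> 0"
  by (cases "(\<lambda>t. cmod (f t)) integrable_on X") (auto intro: integral_nonneg simp: not_integrable_integral)

lemma mass_nonneg: "mass c A x \<ge> 0"
  unfolding mass_def by (rule integral_cmod_nonneg)

lemma mass_mono:
  assumes "locally_integrable J A" "c \<in> J" "x \<in> J" "t \<in> {min c x..max c x}"
  shows "mass c A t \<le> mass c A x"
proof -
  have i: "(\<lambda>t. cmod (A t)) integrable_on {min c x..max c x}"
    using locally_integrableD(2)[OF locally_integrable_norm[OF assms(1)]] assms(2,3)
    by (simp add: min_def max_def)
  have "{min c t..max c t} \<subseteq> {min c x..max c x}" using assms(4) by auto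
  then show ?thesis
    unfolding mass_def using i integrable_subinterval_real[OF i] by (intro integral_subset_le) auto
qed

lemma iv_norm_eq_mass:
  assumes "locally_integrable J A" "c \<in> J" "x \<in> J"
  shows "iv c (\<lambda>t. of_real (cmod (A t)) :: complex) x = (if c \<le> x then of_real (mass c A x) else - of_real (mass c A x))"
proof -
  have "integral {a..b} (\<lambda>t. of_real (cmod (A t)) :: complex) = of_real (integral {a..b} (\<lambda>t. cmod (A t)))"
    if "a \<in> J" "b \<in> J" for a b
    using has_integral_of_real[OF integrable_integral[OF locally_integrableD(2)[OF locally_integrable_norm[OF assms(1)] that]]]
    by (rule integral_unique)
  then show ?thesis using assms by (simp add: iv_def mass_def)
qed

text \<open>This identity produces the factorials in the Picard iteration. To the left of \<open>c\<close> the mass is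
  minus the oriented integral, and the signs cancel.\<close>

lemma has_integral_mass_power:
  assumes J: "is_interval J" and A: "locally_integrable J A" and c: "c \<in> J" and x: "x \<in> J"
  shows "((\<lambda>t. cmod (A t) * mass c A t ^ n) has_integral (mass c A x ^ Suc n / real (Suc n))) {min c x..max c x}"
proof -
  define M where "M = (\<lambda>t. of_real (cmod (A t)) :: complex)"
  have M: "locally_integrable J M"
  proof -
    have "(\<lambda>t. cmod (A t)) absolutely_integrable_on {a..b}" if "a \<in> J" "b \<in> J" for a b
      using locally_integrableD(1)[OF locally_integrable_norm[OF A] that] .
    from absolutely_integrable_linear[OF this bounded_linear_of_real[where 'a = complex]]
    show ?thesis unfolding locally_integrable_def M_def by (simp add: o_def)
  qed
  have m: "iv c M t = (if c \<le> t then of_real (mass c A t) else - of_real (mass c A t))" if "t \<in> J" for t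
    unfolding M_def using iv_norm_eq_mass[OF A c that] .
  have J1: "t \<in> J" if "t \<in> {min c x..max c x}" for t
    using that is_intervalD_real[OF J c x] is_intervalD_real[OF J x c] by (auto simp: min_def max_def split: if_splits)
  have m0: "mass c A c = 0" by (simp add: mass_def)
  have key: "((\<lambda>t. of_nat (Suc n) * (of_real (mass c A t) :: complex) ^ n * M t) has_integral (of_real (mass c A x) ^ Suc n)) {min c x..max c x}"
  proof (cases "c \<le> x")
    case True
    have "((\<lambda>t. of_nat (Suc n) * iv c M t ^ n * M t) has_integral (iv c M x ^ Suc n - iv c M c ^ Suc n)) {c..x}"
      by (rule has_integral_power_iv[OF J M c c x True])
    then show ?thesis
      using True m[OF x] J1 by (auto simp: m min_def max_def elim!: has_integral_eq[rotated])
  next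
    case False
    have "((\<lambda>t. of_nat (Suc n) * iv c M t ^ n * M t) has_integral (iv c M c ^ Suc n - iv c M x ^ Suc n)) {x..c}"
      using False by (intro has_integral_power_iv[OF J M c x c]) auto
    then have "((\<lambda>t. (-1)^n * (of_nat (Suc n) * iv c M t ^ n * M t)) has_integral (-1)^n * (iv c M c ^ Suc n - iv c M x ^ Suc n)) {x..c}"
      by (rule has_integral_mult_right)
    moreover have "(-1)^n * (iv c M c ^ Suc n - iv c M x ^ Suc n) = of_real (mass c A x) ^ Suc n"
      using False m[OF x] by (simp add: power_minus[of "of_real (mass c A x)"])
    moreover have "(-1)^n * (of_nat (Suc n) * iv c M t ^ n * M t) = of_nat (Suc n) * of_real (mass c A t) ^ n * M t"
      if "t \<in> {x..c}" for t
    proof -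
      have "iv c M t = - of_real (mass c A t)"
        using m[of t] J1[of t] that False m0 by (cases "t = c") auto
      then show ?thesis by (simp add: power_minus[of "of_real (mass c A t)"] mult_ac)
    qed
    ultimately show ?thesis using False by (auto elim!: has_integral_eq[rotated] simp: min_def max_def)
  qed
  have "((\<lambda>t. real (Suc n) * mass c A t ^ n * cmod (A t)) has_integral (mass c A x ^ Suc n)) {min c x..max c x}"
  proof -
    have "of_nat (Suc n) * (of_real (mass c A t) :: complex) ^ n * M t
        = of_real (real (Suc n) * mass c A t ^ n * cmod (A t))" for t
      by (simp add: M_def)
    moreover have "(of_real (mass c A x) :: complex) ^ Suc n = of_real (mass c A x ^ Suc n)" by simp
    ultimately show ?thesis using has_integral_linear[OF key bounded_linear_Re]
      by (simp only: o_def Re_complex_of_real)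
  qed
  then have "((\<lambda>t. (real (Suc n) * mass c A t ^ n * cmod (A t)) / real (Suc n)) has_integral (mass c A x ^ Suc n) / real (Suc n)) {min c x..max c x}"
    by (rule has_integral_divide)
  then show ?thesis by (simp add: mult_ac del: of_nat_Suc)
qed

text \<open>The Volterra operator of the system \<open>y' = A y\<^sub>1\<close>, \<open>y\<^sub>1' = B y\<close> after elimination of \<open>y\<^sub>1\<close>: with
  zero initial data at \<open>c\<close> the system reads \<open>y = volterra c A B y\<close>.\<close>

definition volterra :: "real \<Rightarrow> (real \<Rightarrow> complex) \<Rightarrow> (real \<Rightarrow> complex) \<Rightarrow> (real \<Rightarrow> complex) \<Rightarrow> real \<Rightarrow> complex" where
  "volterra c A B g = iv c (\<lambda>s. A s * iv c (\<lambda>t. B t * g t) s)"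

context
  fixes J :: "real set" and A B :: "real \<Rightarrow> complex" and c :: real
  assumes J: "open J" "is_interval J" and A: "locally_integrable J A" and B: "locally_integrable J B"
    and c: "c \<in> J"
begin

lemma locally_integrable_volterra:
  assumes "continuous_on J g"
  shows "locally_integrable J (\<lambda>t. B t * g t)" "locally_integrable J (\<lambda>s. A s * iv c (\<lambda>t. B t * g t) s)"
proof -
  show 1: "locally_integrable J (\<lambda>t. B t * g t)"
    by (rule locally_integrable_mult_continuous[OF J(2) B assms])
  show "locally_integrable J (\<lambda>s. A s * iv c (\<lambda>t. B t * g t) s)"
    by (rule locally_integrable_mult_continuous[OF J(2) A iv_continuous_on[OF J 1 c]])
qed

lemma volterra_continuous_on: "continuous_on J g \<Longrightarrow> continuous_on J (volterra c A B g)"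
  unfolding volterra_def by (intro iv_continuous_on[OF J _ c] locally_integrable_volterra)

lemma volterra_add:
  assumes g: "continuous_on J g" and h: "continuous_on J h" and x: "x \<in> J"
  shows "volterra c A B (\<lambda>t. g t + h t) x = volterra c A B g x + volterra c A B h x"
proof -
  note lg = locally_integrable_volterra[OF g] and lh = locally_integrable_volterra[OF h]
  have "volterra c A B (\<lambda>t. g t + h t) x
      = iv c (\<lambda>s. A s * iv c (\<lambda>t. B t * g t) s + A s * iv c (\<lambda>t. B t * h t) s) x"
    unfolding volterra_def
    by (rule iv_cong[OF J(2) c x]) (simp add: distrib_left iv_add[OF lg(1) lh(1) c])
  also have "\<dots> = volterra c A B g x + volterra c A B h x"
    unfolding volterra_def by (rule iv_add[OF lg(2) lh(2) c x])
  finally show ?thesis .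
qed

lemma volterra_estimate:
  assumes g: "continuous_on J g" and lo: "lo \<in> J" "lo \<le> c" and hi: "hi \<in> J" "c \<le> hi"
    and L: "L = integral {lo..hi} (\<lambda>t. cmod (B t))" and "C \<ge> 0"
    and bound: "\<And>t. t \<in> {lo..hi} \<Longrightarrow> cmod (g t) \<le> C * (L * mass c A t) ^ n / fact n"
    and x: "x \<in> {lo..hi}"
  shows "cmod (volterra c A B g x) \<le> C * (L * mass c A x) ^ Suc n / fact (Suc n)"
proof -
  have sub: "{lo..hi} \<subseteq> J" using is_intervalD_real[OF J(2) lo(1) hi(1)] .
  have xJ: "x \<in> J" using x sub by blast
  note li = locally_integrable_volterra[OF g]
  have nB: "locally_integrable J (\<lambda>t. cmod (B t))" by (rule locally_integrable_norm[OF B])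
  have "L \<ge> 0" unfolding L by (rule integral_cmod_nonneg)
  have inner: "cmod (iv c (\<lambda>t. B t * g t) s) \<le> L * (C * (L * mass c A s) ^ n / fact n)"
    if s: "s \<in> {lo..hi}" for s
  proof -
    define D where "D = C * (L * mass c A s) ^ n / fact n"
    have "D \<ge> 0" unfolding D_def using \<open>C \<ge> 0\<close> \<open>L \<ge> 0\<close> mass_nonneg by simp
    have sJ: "s \<in> J" using s sub by blast
    have seg: "{min c s..max c s} \<subseteq> {lo..hi}" using s lo hi by auto
    have li': "locally_integrable J (\<lambda>t. cmod (B t) * D)"
      using nB unfolding locally_integrable_def by (intro ballI set_integrable_mult_left) auto
    have "cmod (iv c (\<lambda>t. B t * g t) s) \<le> integral {min c s..max c s} (\<lambda>t. cmod (B t) * D)"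
    proof (rule norm_iv_le[OF li(1) li' c sJ])
      fix t assume t: "t \<in> {min c s..max c s}"
      have "cmod (g t) \<le> C * (L * mass c A t) ^ n / fact n" using bound t seg by blast
      also have "\<dots> \<le> D" unfolding D_def
        using \<open>C \<ge> 0\<close> \<open>L \<ge> 0\<close> mass_nonneg mass_mono[OF A c sJ t]
        by (intro divide_right_mono mult_left_mono power_mono) auto
      finally show "cmod (B t * g t) \<le> cmod (B t) * D"
        by (simp add: norm_mult mult_left_mono)
    qed
    also have "\<dots> = integral {min c s..max c s} (\<lambda>t. cmod (B t)) * D" by simp
    also have "\<dots> \<le> L * D"
    proof (rule mult_right_mono[OF _ \<open>D \<ge> 0\<close>])
      have "(\<lambda>t. cmod (B t)) integrable_on {lo..hi}" using locally_integrableD(2)[OF nB lo(1) hi(1)] .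
      then show "integral {min c s..max c s} (\<lambda>t. cmod (B t)) \<le> L"
        unfolding L using seg by (intro integral_subset_le integrable_subinterval_real[OF _ seg]) auto
    qed
    finally show ?thesis by (simp add: D_def)
  qed
  define k where "k = L * C * L ^ n / fact n"
  have hi: "((\<lambda>s. k * (cmod (A s) * mass c A s ^ n)) has_integral k * (mass c A x ^ Suc n / real (Suc n))) {min c x..max c x}"
    by (intro has_integral_mult_right has_integral_mass_power[OF J(2) A c xJ])
  have vol: "locally_integrable J (\<lambda>s. A s * iv c (\<lambda>t. B t * g t) s)" by (rule li)
  have seg: "{min c x..max c x} \<subseteq> {lo..hi}" using x lo assms(5) by auto
  have bd: "cmod (A s * iv c (\<lambda>t. B t * g t) s) \<le> k * (cmod (A s) * mass c A s ^ n)"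
    if "s \<in> {min c x..max c x}" for s
  proof -
    have "cmod (A s * iv c (\<lambda>t. B t * g t) s) \<le> cmod (A s) * (L * (C * (L * mass c A s) ^ n / fact n))"
      unfolding norm_mult using inner[OF subsetD[OF seg that]] by (rule mult_left_mono) simp
    also have "\<dots> = k * (cmod (A s) * mass c A s ^ n)" by (simp add: k_def power_mult_distrib)
    finally show ?thesis .
  qed
  have "cmod (volterra c A B g x) = cmod (integral {min c x..max c x} (\<lambda>s. A s * iv c (\<lambda>t. B t * g t) s))"
    by (simp add: volterra_def iv_def)
  also have "\<dots> \<le> k * (mass c A x ^ Suc n / real (Suc n))"
  proof -
    have "(\<lambda>s. A s * iv c (\<lambda>t. B t * g t) s) integrable_on {min c x..max c x}"
      using locally_integrableD(2)[OF vol] c xJ by (simp add: min_def max_def)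
    from integral_norm_bound_integral[OF this has_integral_integrable[OF hi] bd] integral_unique[OF hi]
    show ?thesis by simp
  qed
  also have "\<dots> = C * (L * mass c A x) ^ Suc n / fact (Suc n)"
    by (simp add: k_def power_mult_distrib field_simps)
  finally show ?thesis .
qed

lemma volterra_iterates_bound:
  assumes Y: "\<And>n. continuous_on J (Y n)" "\<And>n x. x \<in> J \<Longrightarrow> Y (Suc n) x = volterra c A B (Y n) x"
    and lo: "lo \<in> J" "lo \<le> c" and hi: "hi \<in> J" "c \<le> hi"
  obtains C K where "\<forall>n. \<forall>x\<in>{lo..hi}. cmod (Y n x) \<le> C * (K ^ n / fact n)"
proof -
  have sub: "{lo..hi} \<subseteq> J" using is_intervalD_real[OF J(2) lo(1) hi(1)] .
  define L where "L = integral {lo..hi} (\<lambda>t. cmod (B t))"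
  have "L \<ge> 0" unfolding L_def by (rule integral_cmod_nonneg)
  have "bounded (Y 0 ` {lo..hi})"
    using continuous_on_subset[OF Y(1) sub] by (intro compact_imp_bounded compact_continuous_image) auto
  then obtain C where C: "C > 0" "\<forall>y\<in>Y 0 ` {lo..hi}. cmod y \<le> C"
    unfolding bounded_pos by blast
  have 1: "\<forall>x\<in>{lo..hi}. cmod (Y n x) \<le> C * (L * mass c A x) ^ n / fact n" for n
  proof (induction n)
    case 0
    then show ?case using C by simp
  next
    case (Suc n)
    show ?case
    proof
      fix x assume x: "x \<in> {lo..hi}"
      have "cmod (volterra c A B (Y n) x) \<le> C * (L * mass c A x) ^ Suc n / fact (Suc n)"
        by (rule volterra_estimate[OF Y(1) lo hi L_def _ _ x]) (use C Suc in auto)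
      then show "cmod (Y (Suc n) x) \<le> C * (L * mass c A x) ^ Suc n / fact (Suc n)"
        using Y(2) x sub by (simp add: subset_iff)
    qed
  qed
  define K where "K = L * (mass c A lo + mass c A hi)"
  have "cmod (Y n x) \<le> C * (K ^ n / fact n)" if x: "x \<in> {lo..hi}" for n x
  proof -
    have "mass c A x \<le> mass c A lo + mass c A hi"
    proof (cases "x \<le> c")
      case True
      then have "mass c A x \<le> mass c A lo" using x by (intro mass_mono[OF A c lo(1)]) auto
      then show ?thesis using mass_nonneg[of c A hi] by simp
    next
      case False
      then have "mass c A x \<le> mass c A hi" using x by (intro mass_mono[OF A c hi(1)]) auto
      then show ?thesis using mass_nonneg[of c A lo] by simp
    qed
    then have "C * (L * mass c A x) ^ n / fact n \<le> C * K ^ n / fact n"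
      unfolding K_def using \<open>L \<ge> 0\<close> C(1) mass_nonneg[of c A x]
      by (intro divide_right_mono mult_left_mono power_mono) auto
    then show ?thesis using 1[of n] x by fastforce
  qed
  then show ?thesis using that by blast
qed

lemma volterra_exists:
  assumes y0: "continuous_on J y0"
  obtains y where "continuous_on J y" "\<forall>x\<in>J. y x = y0 x + volterra c A B y x"
proof -
  define Y where "Y = rec_nat y0 (\<lambda>_. volterra c A B)"
  have Y0: "Y 0 = y0" and YS: "Y (Suc n) = volterra c A B (Y n)" for n by (simp_all add: Y_def)
  have Yc: "continuous_on J (Y n)" for n
    by (induction n) (simp_all add: Y0 YS y0 volterra_continuous_on)
  define y where "y = (\<lambda>x. \<Sum>n. Y n x)"
  have unif: "uniform_limit {lo..hi} (\<lambda>N x. \<Sum>n<N. Y n x) y sequentially"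
    if lh: "lo \<in> J" "lo \<le> c" "hi \<in> J" "c \<le> hi" for lo hi
  proof -
    obtain C K where CK: "\<forall>n. \<forall>x\<in>{lo..hi}. cmod (Y n x) \<le> C * (K ^ n / fact n)"
      by (rule volterra_iterates_bound[where Y = Y, OF Yc fun_cong[OF YS] lh])
    show ?thesis unfolding y_def
    proof (rule Weierstrass_m_test)
      show "summable (\<lambda>n. C * (K ^ n / fact n))"
        by (intro summable_mult) (use summable_exp[of K] in \<open>simp add: divide_inverse mult.commute\<close>)
    qed (use CK in auto)
  qed
  define S where "S = (\<lambda>N x. \<Sum>n<N. Y n x)"
  have Sc: "continuous_on J (S N)" for N unfolding S_def by (intro continuous_on_sum Yc)
  have S: "S (Suc N) x = y0 x + volterra c A B (S N) x" if x: "x \<in> J" for N x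
  proof (induction N)
    case 0
    have "volterra c A B (S 0) x = 0" 
    proof -
      have "iv c (\<lambda>t. B t * S 0 t) s = 0" for s by (simp add: S_def iv_def)
      then show ?thesis by (simp add: volterra_def iv_def)
    qed
    then show ?case by (simp add: S_def Y0)
  next
    case (Suc N)
    have "S (Suc (Suc N)) x = S (Suc N) x + volterra c A B (Y N) x" by (simp add: S_def YS)
    also have "\<dots> = y0 x + (volterra c A B (S N) x + volterra c A B (Y N) x)" using Suc by simp
    also have "volterra c A B (S N) x + volterra c A B (Y N) x = volterra c A B (S (Suc N)) x"
      using volterra_add[OF Sc Yc x, of N N] by (simp add: S_def)
    finally show ?case .
  qed
  have yc: "continuous_on J y"
  proof (rule continuous_on_open_interval[OF J(1)])
    fix a b assume ab: "a \<in> J" "b \<in> J"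
    have "min a c \<in> J" "max b c \<in> J" using ab c by (auto simp: min_def max_def)
    then have u: "uniform_limit {min a c..max b c} S y sequentially"
      unfolding S_def by (intro unif) auto
    have "continuous_on {min a c..max b c} y"
    proof (rule uniform_limit_theorem[OF _ u])
      have "{min a c..max b c} \<subseteq> J"
        using \<open>min a c \<in> J\<close> \<open>max b c \<in> J\<close> by (rule is_intervalD_real[OF J(2)])
      then show "\<forall>\<^sub>F n in sequentially. continuous_on {min a c..max b c} (S n)"
        using Sc continuous_on_subset by (intro always_eventually) blast
    qed simp
    then show "continuous_on {a..b} y" by (rule continuous_on_subset) auto
  qed
  moreover have "y x = y0 x + volterra c A B y x" if x: "x \<in> J" for x
  proof -
    define lo hi where "lo = min c x" and "hi = max c x"
    have lh: "lo \<in> J" "lo \<le> c" "hi \<in> J" "c \<le> hi" "x \<in> {lo..hi}"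
      using c x by (auto simp: lo_def hi_def min_def max_def)
    have u: "uniform_limit {lo..hi} S y sequentially" unfolding S_def by (rule unif[OF lh(1-4)])
    have lim: "(\<lambda>N. S N x) \<longlonglongrightarrow> y x" using tendsto_uniform_limitI[OF u lh(5)] .
    define L where "L = integral {lo..hi} (\<lambda>t. cmod (B t))"
    define k where "k = L * mass c A x"
    have "(\<lambda>N. volterra c A B (S N) x) \<longlonglongrightarrow> volterra c A B y x"
      unfolding tendsto_iff
    proof (intro allI impI)
      fix e :: real assume "e > 0"
      have "k \<ge> 0" unfolding k_def L_def by (intro mult_nonneg_nonneg mass_nonneg integral_cmod_nonneg)
      define d where "d = e / (k + 1)"
      have "d > 0" using \<open>e > 0\<close> \<open>k \<ge> 0\<close> by (simp add: d_def)
      have "\<forall>\<^sub>F N in sequentially. \<forall>t\<in>{lo..hi}. dist (S N t) (y t) < d"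
        using u \<open>d > 0\<close> unfolding uniform_limit_iff by blast
      then show "\<forall>\<^sub>F N in sequentially. dist (volterra c A B (S N) x) (volterra c A B y x) < e"
      proof eventually_elim
        case (elim N)
        have dc: "continuous_on J (\<lambda>t. S N t - y t)" by (intro continuous_on_diff Sc yc)
        have "volterra c A B (\<lambda>t. (S N t - y t) + y t) x = volterra c A B (\<lambda>t. S N t - y t) x + volterra c A B y x"
          by (rule volterra_add[OF dc yc x])
        then have "dist (volterra c A B (S N) x) (volterra c A B y x) = cmod (volterra c A B (\<lambda>t. S N t - y t) x)"
          by (simp add: dist_norm)
        also have "\<dots> \<le> d * (L * mass c A x) ^ Suc 0 / fact (Suc 0)"
          by (rule volterra_estimate[OF dc lh(1-4) L_def _ _ lh(5)])
             (use \<open>d > 0\<close> elim in \<open>auto simp: dist_norm less_eq_real_def\<close>)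
        also have "\<dots> = d * k" by (simp add: k_def)
        also have "\<dots> < d * (k + 1)" using \<open>d > 0\<close> by simp
        also have "\<dots> = e" using \<open>k \<ge> 0\<close> by (simp add: d_def)
        finally show ?case .
      qed
    qed
    then have "(\<lambda>N. y0 x + volterra c A B (S N) x) \<longlonglongrightarrow> y0 x + volterra c A B y x"
      by (intro tendsto_add tendsto_const)
    then have "(\<lambda>N. S (Suc N) x) \<longlonglongrightarrow> y0 x + volterra c A B y x" using S[OF x] by simp
    moreover have "(\<lambda>N. S (Suc N) x) \<longlonglongrightarrow> y x" using lim by (rule LIMSEQ_Suc)
    ultimately show ?thesis using LIMSEQ_unique by blast
  qed
  ultimately show ?thesis using that by blast
qed

text \<open>Caratheodory's existence theorem for the inhomogeneous system, in integrated form.\<close>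

theorem linear_system_exists:
  assumes F: "locally_integrable J F"
  shows "\<exists>y y1. continuous_on J y \<and> continuous_on J y1 \<and>
    (\<forall>x\<in>J. y x = \<alpha> + iv c (\<lambda>t. A t * y1 t) x \<and> y1 x = \<beta> + iv c (\<lambda>t. B t * y t + F t) x)"
proof -
  define b where "b = (\<lambda>s. \<beta> + iv c F s)"
  have bc: "continuous_on J b" unfolding b_def by (intro continuous_intros iv_continuous_on[OF J F c])
  note Ab = locally_integrable_mult_continuous[OF J(2) A bc]
  have "continuous_on J (\<lambda>x. \<alpha> + iv c (\<lambda>s. A s * b s) x)"
    by (intro continuous_intros iv_continuous_on[OF J _ c] Ab)
  then obtain y where y: "continuous_on J y"
    "\<forall>x\<in>J. y x = \<alpha> + iv c (\<lambda>s. A s * b s) x + volterra c A B y x"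
    by (rule volterra_exists)
  define y1 where "y1 = (\<lambda>x. \<beta> + iv c (\<lambda>t. B t * y t + F t) x)"
  note By = locally_integrable_volterra[OF y(1)]
  have y1c: "continuous_on J y1"
    unfolding y1_def by (intro continuous_intros iv_continuous_on[OF J _ c] locally_integrable_add By F)
  have y1: "y1 s = b s + iv c (\<lambda>t. B t * y t) s" if "s \<in> J" for s
    unfolding y1_def b_def using iv_add[OF By(1) F c that] by simp
  have "y x = \<alpha> + iv c (\<lambda>t. A t * y1 t) x" if x: "x \<in> J" for x
  proof -
    have "iv c (\<lambda>t. A t * y1 t) x = iv c (\<lambda>s. A s * b s + A s * iv c (\<lambda>t. B t * y t) s) x"
      by (rule iv_cong[OF J(2) c x]) (simp add: y1 distrib_left)
    also have "\<dots> = iv c (\<lambda>s. A s * b s) x + volterra c A B y x"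
      unfolding volterra_def by (rule iv_add[OF Ab By(2) c x])
    finally show ?thesis using y(2) x by simp
  qed
  then show ?thesis using y(1) y1c unfolding y1_def by blast
qed

end

section \<open>The Sturm--Liouville differential expression\<close>

text \<open>Statements that hold almost everywhere are handled through negligible exceptional sets, the
  form required by the gauge integral.\<close>

lemma AE_lebesgue_on_iff_negligible:
  assumes "J \<in> sets lebesgue"
  shows "(AE x in lebesgue_on J. P x) \<longleftrightarrow> (\<exists>E. negligible E \<and> (\<forall>x\<in>J - E. P x))"
proof
  assume "AE x in lebesgue_on J. P x"
  then have "AE x in lebesgue. x \<in> J \<longrightarrow> P x"
    using assms by (simp add: AE_restrict_space_iff)
  then obtain E where "E \<in> null_sets lebesgue" "{x \<in> space lebesgue. \<not> (x \<in> J \<longrightarrow> P x)} \<subseteq> E"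
    by (auto simp: eventually_ae_filter)
  then show "\<exists>E. negligible E \<and> (\<forall>x\<in>J - E. P x)"
    using negligible_iff_null_sets by (intro exI[of _ E]) auto
next
  assume "\<exists>E. negligible E \<and> (\<forall>x\<in>J - E. P x)"
  then obtain E where E: "negligible E" "\<forall>x\<in>J - E. P x" by blast
  then have "AE x in lebesgue. x \<in> J \<longrightarrow> P x"
    using negligible_iff_null_sets
    by (auto simp: eventually_ae_filter intro!: bexI[of _ E])
  then show "AE x in lebesgue_on J. P x"
    using assms by (simp add: AE_restrict_space_iff)
qed

lemma continuous_on_ae_eq:
  fixes f g :: "real \<Rightarrow> complex"
  assumes J: "open J" and f: "continuous_on J f" and g: "continuous_on J g"
    and ae: "AE x in lebesgue_on J. f x = g x" and x: "x \<in> J"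
  shows "f x = g x"
proof -
  obtain E where E: "negligible E" "\<forall>x\<in>J - E. f x = g x"
    using ae AE_lebesgue_on_iff_negligible[of J] J by auto
  define D where "D = J \<inter> (\<lambda>x. f x - g x) -` (- {0})"
  have "open D"
    unfolding D_def using J f g by (intro continuous_open_preimage continuous_on_diff) auto
  moreover have "D \<subseteq> E" using E(2) by (auto simp: D_def)
  then have "negligible D" using E(1) negligible_subset by blast
  ultimately have "D = {}" using open_not_negligible by blast
  then show ?thesis using x by (auto simp: D_def)
qed

text \<open>A Sturm--Liouville problem on the open interval \<open>J\<close>, with no assumption on the behaviour at the endpoints.\<close>

locale sturm_liouville =
  fixes S :: sl_problem
  assumes coeffs: "sl_coefficients S"
begin

abbreviation "J \<equiv> sl_int S"
abbreviation "p \<equiv> sl_p S"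
abbreviation "q \<equiv> sl_q S"
abbreviation "r \<equiv> sl_r S"
abbreviation "qd \<equiv> quasi_deriv S"

lemma J_open: "open J" and J_interval: "is_interval J"
proof -
  show "open J" by (simp add: sl_int_def open_einterval)
  show "is_interval J"
    unfolding is_interval_1 sl_int_def
  proof (intro ballI allI impI)
    fix a b x assume "a \<in> einterval (sl_a S) (sl_b S)" "b \<in> einterval (sl_a S) (sl_b S)" "a \<le> x \<and> x \<le> b"
    then show "x \<in> einterval (sl_a S) (sl_b S)"
      unfolding einterval_iff using less_le_trans[of "sl_a S" "ereal a" "ereal x"] le_less_trans[of "ereal x" "ereal b" "sl_b S"]
      by simp
  qed
qed

lemma J_lebesgue [simp, measurable]: "J \<in> sets lebesgue"
  using J_open by simp

lemma J_segment: "c \<in> J \<Longrightarrow> d \<in> J \<Longrightarrow> {c..d} \<subseteq> J"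
  using is_intervalD_real[OF J_interval] .

lemma ends_less: "sl_a S < sl_b S"
  using coeffs by (simp add: sl_coefficients_def)

lemma J_nonempty: "\<exists>c. c \<in> J"
  using ends_less ereal_dense2 unfolding sl_int_def einterval_iff by blast

lemmas AE_J = AE_lebesgue_on_iff_negligible[OF J_lebesgue]

lemma AE_in_J: "AE x in lebesgue_on J. x \<in> J"
  unfolding AE_J by (intro exI[of _ "{}"]) simp

lemma L1_loc_imp_locally_integrable:
  assumes "L1_loc S f"
  shows "locally_integrable J (\<lambda>x. complex_of_real (f x))"
  unfolding locally_integrable_def
proof (intro ballI)
  fix c d assume "c \<in> J" "d \<in> J"
  then have "f absolutely_integrable_on {c..d}"
    using assms J_segment unfolding L1_loc_def by simp
  from absolutely_integrable_linear[OF this bounded_linear_of_real[where 'a = complex]]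
  show "(\<lambda>x. complex_of_real (f x)) absolutely_integrable_on {c..d}" by (simp add: o_def)
qed

lemma locally_integrable_coeffs:
  "locally_integrable J (\<lambda>x. complex_of_real (1 / p x))"
  "locally_integrable J (\<lambda>x. complex_of_real (q x))"
  "locally_integrable J (\<lambda>x. complex_of_real (r x))"
  by (rule L1_loc_imp_locally_integrable, use coeffs in \<open>simp add: sl_coefficients_def\<close>)+

lemma AE_p_pos: "AE x in lebesgue_on J. p x > 0" and AE_r_pos: "AE x in lebesgue_on J. r x > 0"
  using coeffs by (auto simp: sl_coefficients_def)

lemma AC_loc_continuous_on: "AC_loc S f \<Longrightarrow> continuous_on J f"
  using J_open by (rule continuous_on_open_interval)
    (auto simp: AC_loc_def intro: abs_continuous_on_imp_continuous_on)

lemma AC_loc_cong: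
  assumes "AC_loc S f" "\<And>x. x \<in> J \<Longrightarrow> f x = g x"
  shows "AC_loc S g"
  unfolding AC_loc_def
proof (intro ballI)
  fix c d assume cd: "c \<in> J" "d \<in> J"
  show "abs_continuous_on c d g"
    by (rule abs_continuous_on_cong[of c d f])
      (use assms cd J_segment[OF cd] in \<open>auto simp: AC_loc_def\<close>)
qed

lemma AC_loc_lincomb: "AC_loc S f \<Longrightarrow> AC_loc S g \<Longrightarrow> AC_loc S (\<lambda>x. \<alpha> * f x + \<beta> * g x)"
  unfolding AC_loc_def using abs_continuous_on_lincomb by blast

lemma AC_loc_mult: "AC_loc S f \<Longrightarrow> AC_loc S g \<Longrightarrow> AC_loc S (\<lambda>x. f x * g x)"
  unfolding AC_loc_def using abs_continuous_on_mult by blast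

lemma AC_loc_cnj: "AC_loc S f \<Longrightarrow> AC_loc S (\<lambda>x. cnj (f x))"
  unfolding AC_loc_def using abs_continuous_on_cnj by blast

lemma has_vector_derivative_cong_J:
  assumes "(f has_vector_derivative d) (at x)" "x \<in> J" "\<And>x. x \<in> J \<Longrightarrow> f x = g x"
  shows "(g has_vector_derivative d) (at x)"
  using has_vector_derivative_transform_within_open[OF assms(1) J_open assms(2,3)] .

text \<open>A locally absolutely continuous function is the integral of its almost everywhere
  derivative, and conversely.\<close>

lemma AC_loc_has_integral:
  assumes "AC_loc S F" "AE x in lebesgue_on J. (F has_vector_derivative f x) (at x)"
    and "c \<in> J" "d \<in> J" "c \<le> d"
  shows "(f has_integral (F d - F c)) {c..d}"
proof -
  obtain E where E: "negligible E" "\<forall>x\<in>J - E. (F has_vector_derivative f x) (at x)"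
    using assms(2) unfolding AE_J by blast
  show ?thesis
  proof (rule has_integral_abs_continuous[OF _ assms(5) E(1)])
    show "abs_continuous_on c d F" using assms(1,3,4) by (simp add: AC_loc_def)
    fix x assume "x \<in> {c..d} - E"
    then have "x \<in> J - E" using J_segment[OF assms(3,4)] by blast
    then show "(F has_vector_derivative f x) (at x within {c..d})"
      using E(2) has_vector_derivative_at_within by blast
  qed
qed

lemma AC_loc_iv:
  assumes f: "locally_integrable J f" and c: "c \<in> J" and F: "\<And>x. x \<in> J \<Longrightarrow> F x = k + iv c f x"
  shows "AC_loc S F" "AE x in lebesgue_on J. (F has_vector_derivative f x) (at x)"
proof -
  have kiv: "AC_loc S (\<lambda>x. k + iv c f x)"
    unfolding AC_loc_def
  proof (intro ballI)
    fix a b assume ab: "a \<in> J" "b \<in> J"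
    note ac = iv_abs_continuous_on[OF J_interval f c ab]
    show "abs_continuous_on a b (\<lambda>x. k + iv c f x)"
      by (rule abs_continuous_on_dominated[OF ac ac, of 1]) auto
  qed
  then show "AC_loc S F" by (rule AC_loc_cong) (simp add: F)
  have "\<forall>a\<in>J. \<forall>b\<in>J. \<exists>E. negligible E \<and> (\<forall>x\<in>{a<..<b} - E. (iv c f has_vector_derivative f x) (at x))"
    using iv_has_vector_derivative[OF J_interval f c] by blast
  then obtain E where E: "\<And>a b. a \<in> J \<Longrightarrow> b \<in> J \<Longrightarrow>
      negligible (E a b) \<and> (\<forall>x\<in>{a<..<b} - E a b. (iv c f has_vector_derivative f x) (at x))"
    by metis
  define Q where "Q = J \<inter> \<rat>"
  define N where "N = (\<Union>(a,b)\<in>Q \<times> Q. E a b)"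
  have "countable Q" unfolding Q_def using countable_rat by blast
  then have "negligible N"
    unfolding N_def using E by (intro negligible_countable_Union countable_image countable_SIGMA) (auto simp: Q_def)
  moreover have "(F has_vector_derivative f x) (at x)" if x: "x \<in> J - N" for x
  proof -
    obtain a b where ab: "a \<in> J" "b \<in> J" "a < x" "x < b"
      using x open_interval_between[OF J_open] by blast
    obtain a' b' where ab': "a' \<in> \<rat>" "a < a'" "a' < x" "b' \<in> \<rat>" "x < b'" "b' < b"
      using Rats_dense_in_real ab(3,4) by meson
    have "a' \<in> J" "b' \<in> J" using J_segment[OF ab(1,2)] ab' by auto
    then have "x \<in> {a'<..<b'} - E a' b'" using x ab' by (auto simp: N_def Q_def)
    then have "(iv c f has_vector_derivative f x) (at x)" using E[OF \<open>a' \<in> J\<close> \<open>b' \<in> J\<close>] by blast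
    then have "((\<lambda>x. k + iv c f x) has_vector_derivative f x) (at x)"
      using has_vector_derivative_add[OF has_vector_derivative_const, of "iv c f" "f x" "at x" k] by simp
    then show ?thesis
      by (rule has_vector_derivative_cong_J) (use x F in auto)
  qed
  ultimately show "AE x in lebesgue_on J. (F has_vector_derivative f x) (at x)"
    unfolding AE_J by blast
qed

lemma is_quasi_deriv_unique:
  assumes "is_quasi_deriv S g h" "is_quasi_deriv S g k" "x \<in> J"
  shows "h x = k x"
proof (rule continuous_on_ae_eq[OF J_open _ _ _ assms(3)])
  show "continuous_on J h" "continuous_on J k"
    using assms by (auto simp: is_quasi_deriv_def intro: AC_loc_continuous_on)
  have "AE x in lebesgue_on J. \<exists>d. (g has_vector_derivative d) (at x) \<and> h x = of_real (p x) * d"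
    "AE x in lebesgue_on J. \<exists>d. (g has_vector_derivative d) (at x) \<and> k x = of_real (p x) * d"
    using assms by (auto simp: is_quasi_deriv_def)
  then show "AE x in lebesgue_on J. h x = k x"
    by eventually_elim (auto dest: vector_derivative_unique_at)
qed

lemma quasi_deriv_eq:
  assumes "is_quasi_deriv S g h"
  shows "is_quasi_deriv S g (qd g)" "x \<in> J \<Longrightarrow> qd g x = h x"
proof -
  show 1: "is_quasi_deriv S g (qd g)"
    unfolding quasi_deriv_def by (rule someI[of "is_quasi_deriv S g", OF assms])
  show "x \<in> J \<Longrightarrow> qd g x = h x" using is_quasi_deriv_unique[OF 1 assms] .
qed

text \<open>The next two lemmas replace the chosen quasi-derivative by the first-order system for the pair
  \<open>(g, g\<^sup>[\<^sup>1\<^sup>])\<close>: any admissible second component \<open>h\<close> agrees with the quasi-derivative on \<open>J\<close>.\<close>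

lemma tau_eqI:
  assumes g: "AC_loc S g" and h: "AC_loc S h"
    and g': "AE x in lebesgue_on J. (g has_vector_derivative of_real (1 / p x) * h x) (at x)"
    and h': "AE x in lebesgue_on J. (h has_vector_derivative of_real (q x) * g x - of_real (r x) * w x) (at x)"
  shows "tau_eq S g w" "x \<in> J \<Longrightarrow> qd g x = h x"
proof -
  have "AE x in lebesgue_on J. \<exists>d. (g has_vector_derivative d) (at x) \<and> h x = of_real (p x) * d"
    using g' AE_p_pos
  proof eventually_elim
    case (elim x)
    then show ?case by (intro exI[of _ "of_real (1 / p x) * h x"]) simp
  qed
  then have qdh: "is_quasi_deriv S g h" using h by (simp add: is_quasi_deriv_def)
  note qde = quasi_deriv_eq[OF qdh]
  show "x \<in> J \<Longrightarrow> qd g x = h x" by (rule qde(2))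
  from h' AE_r_pos AE_in_J have "AE x in lebesgue_on J. \<exists>d. (qd g has_vector_derivative d) (at x) \<and>
            w x = (- d + of_real (q x) * g x) / of_real (r x)"
  proof eventually_elim
    case (elim x)
    have "(qd g has_vector_derivative of_real (q x) * g x - of_real (r x) * w x) (at x)"
      by (rule has_vector_derivative_cong_J[OF elim(1,3)]) (simp add: qde(2))
    then show ?case using elim(2)
      by (intro exI[of _ "of_real (q x) * g x - of_real (r x) * w x"]) simp
  qed
  then show "tau_eq S g w" using g qde(1) by (simp add: tau_eq_def)
qed

lemma tau_eqD:
  assumes "tau_eq S g w"
  shows "AC_loc S g" "AC_loc S (qd g)"
    "AE x in lebesgue_on J. (g has_vector_derivative of_real (1 / p x) * qd g x) (at x)"
    "AE x in lebesgue_on J. (qd g has_vector_derivative of_real (q x) * g x - of_real (r x) * w x) (at x)"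
proof -
  show "AC_loc S g" "AC_loc S (qd g)" using assms by (auto simp: tau_eq_def is_quasi_deriv_def)
  have "AE x in lebesgue_on J. \<exists>d. (g has_vector_derivative d) (at x) \<and> qd g x = of_real (p x) * d"
    using assms by (auto simp: tau_eq_def is_quasi_deriv_def)
  then show "AE x in lebesgue_on J. (g has_vector_derivative of_real (1 / p x) * qd g x) (at x)"
    using AE_p_pos by eventually_elim auto
  have "AE x in lebesgue_on J. \<exists>d. (qd g has_vector_derivative d) (at x) \<and>
            w x = (- d + of_real (q x) * g x) / of_real (r x)"
    using assms by (auto simp: tau_eq_def)
  then show "AE x in lebesgue_on J. (qd g has_vector_derivative of_real (q x) * g x - of_real (r x) * w x) (at x)"
    using AE_r_pos by eventually_elim auto
qed

lemma tau_eq_lincomb: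
  assumes f: "tau_eq S f fw" and g: "tau_eq S g gw"
  shows "tau_eq S (\<lambda>x. \<alpha> * f x + \<beta> * g x) (\<lambda>x. \<alpha> * fw x + \<beta> * gw x)"
    "x \<in> J \<Longrightarrow> qd (\<lambda>x. \<alpha> * f x + \<beta> * g x) x = \<alpha> * qd f x + \<beta> * qd g x"
proof -
  note F = tau_eqD[OF f] and G = tau_eqD[OF g]
  have 1: "AE x in lebesgue_on J. ((\<lambda>x. \<alpha> * f x + \<beta> * g x) has_vector_derivative
      of_real (1 / p x) * (\<alpha> * qd f x + \<beta> * qd g x)) (at x)"
    using F(3) G(3)
  proof eventually_elim
    case (elim x)
    from has_vector_derivative_add[OF has_vector_derivative_mult_right[OF elim(1)] has_vector_derivative_mult_right[OF elim(2)]]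
    show ?case by (simp add: algebra_simps)
  qed
  have 2: "AE x in lebesgue_on J. ((\<lambda>x. \<alpha> * qd f x + \<beta> * qd g x) has_vector_derivative
      of_real (q x) * (\<alpha> * f x + \<beta> * g x) - of_real (r x) * (\<alpha> * fw x + \<beta> * gw x)) (at x)"
    using F(4) G(4)
  proof eventually_elim
    case (elim x)
    from has_vector_derivative_add[OF has_vector_derivative_mult_right[OF elim(1)] has_vector_derivative_mult_right[OF elim(2)]]
    show ?case by (simp add: algebra_simps)
  qed
  note t = tau_eqI[OF AC_loc_lincomb[OF F(1) G(1)] AC_loc_lincomb[OF F(2) G(2)] 1 2]
  show "tau_eq S (\<lambda>x. \<alpha> * f x + \<beta> * g x) (\<lambda>x. \<alpha> * fw x + \<beta> * gw x)" by (rule t)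
  show "x \<in> J \<Longrightarrow> qd (\<lambda>x. \<alpha> * f x + \<beta> * g x) x = \<alpha> * qd f x + \<beta> * qd g x" by (rule t)
qed

lemma tau_eq_cnj:
  assumes f: "tau_eq S f w"
  shows "tau_eq S (\<lambda>x. cnj (f x)) (\<lambda>x. cnj (w x))" "x \<in> J \<Longrightarrow> qd (\<lambda>x. cnj (f x)) x = cnj (qd f x)"
proof -
  note F = tau_eqD[OF f]
  have 1: "AE x in lebesgue_on J. ((\<lambda>x. cnj (f x)) has_vector_derivative of_real (1 / p x) * cnj (qd f x)) (at x)"
    using F(3)
  proof eventually_elim
    case (elim x)
    from has_vector_derivative_cnj[OF elim] show ?case by simp
  qed
  have 2: "AE x in lebesgue_on J. ((\<lambda>x. cnj (qd f x)) has_vector_derivative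
      of_real (q x) * cnj (f x) - of_real (r x) * cnj (w x)) (at x)"
    using F(4)
  proof eventually_elim
    case (elim x)
    from has_vector_derivative_cnj[OF elim] show ?case by simp
  qed
  note t = tau_eqI[OF AC_loc_cnj[OF F(1)] AC_loc_cnj[OF F(2)] 1 2]
  show "tau_eq S (\<lambda>x. cnj (f x)) (\<lambda>x. cnj (w x))" by (rule t)
  show "x \<in> J \<Longrightarrow> qd (\<lambda>x. cnj (f x)) x = cnj (qd f x)" by (rule t)
qed

lemma tau_eq_cong:
  assumes g: "tau_eq S g w" and eq: "\<And>x. x \<in> J \<Longrightarrow> g x = k x" and w: "AE x in lebesgue_on J. w x = v x"
  shows "tau_eq S k v" "x \<in> J \<Longrightarrow> qd k x = qd g x"
proof -
  note G = tau_eqD[OF g]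
  have 1: "AE x in lebesgue_on J. (k has_vector_derivative of_real (1 / p x) * qd g x) (at x)"
    using G(3) AE_in_J by eventually_elim (rule has_vector_derivative_cong_J[OF _ _ eq])
  have 2: "AE x in lebesgue_on J. (qd g has_vector_derivative of_real (q x) * k x - of_real (r x) * v x) (at x)"
    using G(4) w AE_in_J by eventually_elim (simp add: eq)
  note t = tau_eqI[OF AC_loc_cong[OF G(1) eq] G(2) 1 2]
  show "tau_eq S k v" by (rule t)
  show "x \<in> J \<Longrightarrow> qd k x = qd g x" by (rule t)
qed

lemma wronskian_cong:
  assumes "tau_eq S f fw" "\<And>x. x \<in> J \<Longrightarrow> f x = f' x" "tau_eq S g gw" "\<And>x. x \<in> J \<Longrightarrow> g x = g' x" "x \<in> J"
  shows "wronskian S f g x = wronskian S f' g' x"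
  using tau_eq_cong(2)[OF assms(1,2), of fw] tau_eq_cong(2)[OF assms(3,4), of gw] assms(2,4,5)
  by (simp add: wronskian_def)

text \<open>Lagrange's identity. As a gauge integral it needs no separate integrability assumption.\<close>

lemma wronskian_has_integral:
  assumes f: "tau_eq S f fw" and g: "tau_eq S g gw" and cd: "c \<in> J" "d \<in> J" "c \<le> d"
  shows "((\<lambda>x. of_real (r x) * (fw x * g x - f x * gw x)) has_integral
            (wronskian S f g d - wronskian S f g c)) {c..d}"
proof (rule AC_loc_has_integral[OF _ _ cd])
  note F = tau_eqD[OF f] and G = tau_eqD[OF g]
  have W: "wronskian S f g = (\<lambda>x. 1 * (f x * qd g x) + (-1) * (qd f x * g x))"
    by (simp add: wronskian_def fun_eq_iff)
  show "AC_loc S (wronskian S f g)"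
    unfolding W by (intro AC_loc_lincomb AC_loc_mult F G)
  show "AE x in lebesgue_on J. (wronskian S f g has_vector_derivative
      of_real (r x) * (fw x * g x - f x * gw x)) (at x)"
    using F(3,4) G(3,4)
  proof eventually_elim
    case (elim x)
    from has_vector_derivative_diff[OF has_vector_derivative_mult[OF elim(1,4)] has_vector_derivative_mult[OF elim(2,3)]]
    show ?case unfolding wronskian_def[abs_def] by (simp add: algebra_simps)
  qed
qed

lemma initial_value_exists:
  assumes f: "locally_integrable J (\<lambda>x. of_real (r x) * f x)" and c: "c \<in> J"
  shows "\<exists>g. tau_eq S g (\<lambda>x. z * g x + f x) \<and> g c = \<alpha> \<and> qd g c = \<beta>"
proof -
  define B where "B = (\<lambda>x. complex_of_real (q x) + complex_of_real (r x) * (- z))"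
  have B: "locally_integrable J B"
    unfolding B_def
    by (intro locally_integrable_add locally_integrable_coeffs locally_integrable_mult_continuous J_interval continuous_on_const)
  have F: "locally_integrable J (\<lambda>x. of_real (r x) * f x * (- 1))"
    by (rule locally_integrable_mult_continuous[OF J_interval f continuous_on_const])
  obtain y y1 where y: "continuous_on J y" "continuous_on J y1"
    and eq: "\<forall>x\<in>J. y x = \<alpha> + iv c (\<lambda>t. of_real (1 / p t) * y1 t) x \<and>
        y1 x = \<beta> + iv c (\<lambda>t. B t * y t + of_real (r t) * f t * (- 1)) x"
    using linear_system_exists[OF J_open J_interval locally_integrable_coeffs(1) B c F] by blast
  have l1: "locally_integrable J (\<lambda>t. of_real (1 / p t) * y1 t)"
    by (rule locally_integrable_mult_continuous[OF J_interval locally_integrable_coeffs(1) y(2)])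
  have l2: "locally_integrable J (\<lambda>t. B t * y t + of_real (r t) * f t * (- 1))"
    by (intro locally_integrable_add F locally_integrable_mult_continuous[OF J_interval B y(1)])
  note a1 = AC_loc_iv[OF l1 c, of y \<alpha>] and a2 = AC_loc_iv[OF l2 c, of y1 \<beta>]
  have "AE x in lebesgue_on J. (y1 has_vector_derivative of_real (q x) * y x - of_real (r x) * (z * y x + f x)) (at x)"
    using a2(2) eq by (simp add: B_def algebra_simps)
  note t = tau_eqI[OF a1(1) a2(1) a1(2) this]
  have "tau_eq S y (\<lambda>x. z * y x + f x)" by (rule t) (use eq in auto)
  moreover have "y c = \<alpha>" using eq c by simp
  moreover have "qd y c = \<beta>"
  proof -
    have "qd y c = y1 c" by (rule t) (use eq c in auto)
    then show ?thesis using eq c by simp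
  qed
  ultimately show ?thesis by blast
qed

end

section \<open>The weighted Hilbert space\<close>

context sturm_liouville
begin

abbreviation "\<mu> \<equiv> wmeasure S"

lemma r_measurable [measurable]: "r \<in> borel_measurable (lebesgue_on J)"
  using coeffs by (simp add: sl_coefficients_def)

lemma AE_r_nonneg: "AE x in lebesgue_on J. 0 \<le> r x"
  using AE_r_pos by eventually_elim simp

text \<open>As \<open>r > 0\<close> almost everywhere, the weighted measure has the null sets of Lebesgue measure.\<close>

lemma AE_wmeasure: "(AE x in \<mu>. P x) \<longleftrightarrow> (AE x in lebesgue_on J. P x)"
proof -
  have "(AE x in \<mu>. P x) \<longleftrightarrow> (AE x in lebesgue_on J. 0 < r x \<longrightarrow> P x)"
    unfolding wmeasure_def by (subst AE_density) auto
  also have "\<dots> \<longleftrightarrow> (AE x in lebesgue_on J. P x)"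
  proof
    assume "AE x in lebesgue_on J. 0 < r x \<longrightarrow> P x"
    with AE_r_pos show "AE x in lebesgue_on J. P x" by eventually_elim simp
  next
    assume "AE x in lebesgue_on J. P x"
    then show "AE x in lebesgue_on J. 0 < r x \<longrightarrow> P x" by eventually_elim simp
  qed
  finally show ?thesis .
qed

lemma borel_measurable_wmeasure: "borel_measurable \<mu> = borel_measurable (lebesgue_on J)"
  unfolding wmeasure_def by (intro measurable_cong_sets) auto

lemma space_wmeasure: "space \<mu> = J"
  by (simp add: wmeasure_def)

lemma AE_wmeasure_I: "(\<And>x. x \<in> J \<Longrightarrow> P x) \<Longrightarrow> AE x in \<mu>. P x"
  by (rule AE_I2) (simp add: space_wmeasure)

lemma integrable_wmeasure_iff:
  fixes f :: "real \<Rightarrow> 'a::{banach, second_countable_topology}"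
  assumes "f \<in> borel_measurable \<mu>"
  shows "integrable \<mu> f \<longleftrightarrow> integrable (lebesgue_on J) (\<lambda>x. r x *\<^sub>R f x)"
  using assms unfolding borel_measurable_wmeasure unfolding wmeasure_def
  by (rule integrable_density[OF _ r_measurable AE_r_nonneg])

lemma integral_wmeasure:
  fixes f :: "real \<Rightarrow> 'a::{banach, second_countable_topology}"
  assumes "f \<in> borel_measurable \<mu>"
  shows "integral\<^sup>L \<mu> f = integral\<^sup>L (lebesgue_on J) (\<lambda>x. r x *\<^sub>R f x)"
  using assms unfolding borel_measurable_wmeasure unfolding wmeasure_def
  by (rule integral_density[OF _ r_measurable AE_r_nonneg])

lemma integrable_wmeasure_absolutely_integrable:
  fixes H :: "real \<Rightarrow> complex"
  assumes "integrable \<mu> H"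
  shows "(\<lambda>x. of_real (r x) * H x) absolutely_integrable_on J"
    "integral J (\<lambda>x. of_real (r x) * H x) = integral\<^sup>L \<mu> H"
proof -
  have m: "H \<in> borel_measurable \<mu>" using assms by simp
  have i: "integrable (lebesgue_on J) (\<lambda>x. of_real (r x) * H x)"
    using assms integrable_wmeasure_iff[OF m] by (simp add: scaleR_conv_of_real)
  then have "set_integrable lebesgue J (\<lambda>x. of_real (r x) * H x)"
    unfolding set_integrable_def by (subst (asm) integrable_restrict_space) auto
  then show "(\<lambda>x. of_real (r x) * H x) absolutely_integrable_on J" .
  show "integral J (\<lambda>x. of_real (r x) * H x) = integral\<^sup>L \<mu> H"
    using integral_wmeasure[OF m] lebesgue_integral_eq_integral[OF i] by (simp add: scaleR_conv_of_real)
qed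

lemma L2D:
  assumes "f \<in> L2 S"
  shows "f \<in> borel_measurable \<mu>" "integrable \<mu> (\<lambda>x. (cmod (f x))\<^sup>2)"
  using assms by (auto simp: L2_def)

lemma L2_cnj: "f \<in> L2 S \<Longrightarrow> (\<lambda>x. cnj (f x)) \<in> L2 S"
  unfolding L2_def
  using measurable_compose[of f \<mu> borel cnj borel]
    borel_measurable_continuous_onI[OF continuous_on_cnj[OF continuous_on_id]] by auto

lemma L2_bound:
  assumes g: "g \<in> borel_measurable \<mu>" and f: "f1 \<in> L2 S" "f2 \<in> L2 S"
    and bound: "AE x in \<mu>. cmod (g x) \<le> K * cmod (f1 x) + K * cmod (f2 x)"
  shows "g \<in> L2 S"
proof -
  have "integrable \<mu> (\<lambda>x. 2 * K\<^sup>2 * (cmod (f1 x))\<^sup>2 + 2 * K\<^sup>2 * (cmod (f2 x))\<^sup>2)"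
    using L2D(2)[OF f(1)] L2D(2)[OF f(2)] by (intro Bochner_Integration.integrable_add integrable_mult_right)
  then have "integrable \<mu> (\<lambda>x. (cmod (g x))\<^sup>2)"
  proof (rule Bochner_Integration.integrable_bound)
    show "(\<lambda>x. (cmod (g x))\<^sup>2) \<in> borel_measurable \<mu>" using g by measurable
    show "AE x in \<mu>. norm ((cmod (g x))\<^sup>2) \<le> norm (2 * K\<^sup>2 * (cmod (f1 x))\<^sup>2 + 2 * K\<^sup>2 * (cmod (f2 x))\<^sup>2)"
      using bound
    proof eventually_elim
      case (elim x)
      have "(cmod (g x))\<^sup>2 \<le> (K * cmod (f1 x) + K * cmod (f2 x))\<^sup>2"
        by (rule power_mono[OF elim]) simp
      also have "\<dots> \<le> 2 * (K * cmod (f1 x))\<^sup>2 + 2 * (K * cmod (f2 x))\<^sup>2"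
        using sum_squares_ge_zero[of "K * cmod (f1 x) - K * cmod (f2 x)" 0]
        by (simp add: power2_eq_square algebra_simps)
      finally show ?case by (simp add: power_mult_distrib)
    qed
  qed
  then show ?thesis using g by (simp add: L2_def)
qed

lemma L2_lincomb:
  assumes "f \<in> L2 S" "g \<in> L2 S"
  shows "(\<lambda>x. \<alpha> * f x + \<beta> * g x) \<in> L2 S"
proof (rule L2_bound[OF _ assms, where K = "cmod \<alpha> + cmod \<beta>"])
  show "(\<lambda>x. \<alpha> * f x + \<beta> * g x) \<in> borel_measurable \<mu>"
    using L2D(1)[OF assms(1)] L2D(1)[OF assms(2)] by measurable
  show "AE x in \<mu>. cmod (\<alpha> * f x + \<beta> * g x) \<le> (cmod \<alpha> + cmod \<beta>) * cmod (f x) + (cmod \<alpha> + cmod \<beta>) * cmod (g x)"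
  proof (rule AE_I2)
    fix x
    have "cmod (\<alpha> * f x + \<beta> * g x) \<le> cmod \<alpha> * cmod (f x) + cmod \<beta> * cmod (g x)"
      by (metis norm_mult norm_triangle_ineq)
    also have "\<dots> \<le> (cmod \<alpha> + cmod \<beta>) * cmod (f x) + (cmod \<alpha> + cmod \<beta>) * cmod (g x)"
      by (intro add_mono mult_right_mono) auto
    finally show "cmod (\<alpha> * f x + \<beta> * g x) \<le> (cmod \<alpha> + cmod \<beta>) * cmod (f x) + (cmod \<alpha> + cmod \<beta>) * cmod (g x)" .
  qed
qed

lemma L2_scale: "f \<in> L2 S \<Longrightarrow> (\<lambda>x. \<alpha> * f x) \<in> L2 S"
  using L2_lincomb[of f f \<alpha> 0] by simp

lemma L2_diff: "f \<in> L2 S \<Longrightarrow> g \<in> L2 S \<Longrightarrow> (\<lambda>x. f x - g x) \<in> L2 S"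
  using L2_lincomb[of f g 1 "-1"] by simp

lemma L2_mult_integrable:
  assumes "f \<in> L2 S" "g \<in> L2 S"
  shows "integrable \<mu> (\<lambda>x. f x * g x)"
proof -
  have "integrable \<mu> (\<lambda>x. (cmod (f x))\<^sup>2 + (cmod (g x))\<^sup>2)"
    using assms L2D(2) by (intro Bochner_Integration.integrable_add)
  then show ?thesis
  proof (rule Bochner_Integration.integrable_bound)
    show "(\<lambda>x. f x * g x) \<in> borel_measurable \<mu>"
      using L2D(1)[OF assms(1)] L2D(1)[OF assms(2)] by measurable
    show "AE x in \<mu>. norm (f x * g x) \<le> norm ((cmod (f x))\<^sup>2 + (cmod (g x))\<^sup>2)"
    proof (rule AE_I2)
      fix x
      have "2 * (cmod (f x) * cmod (g x)) \<le> (cmod (f x))\<^sup>2 + (cmod (g x))\<^sup>2"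
        using sum_squares_bound[of "cmod (f x)" "cmod (g x)"] by (simp add: mult.assoc)
      moreover have "0 \<le> cmod (f x) * cmod (g x)" by simp
      ultimately have "cmod (f x) * cmod (g x) \<le> (cmod (f x))\<^sup>2 + (cmod (g x))\<^sup>2" by linarith
      then show "norm (f x * g x) \<le> norm ((cmod (f x))\<^sup>2 + (cmod (g x))\<^sup>2)"
        by (simp add: norm_mult)
    qed
  qed
qed

lemma L2_inner_lincomb:
  assumes "f \<in> L2 S" "g \<in> L2 S" "h \<in> L2 S"
  shows "L2_inner S f (\<lambda>x. \<alpha> * g x + \<beta> * h x) = \<alpha> * L2_inner S f g + \<beta> * L2_inner S f h"
proof -
  have i: "integrable \<mu> (\<lambda>x. cnj (f x) * g x)" "integrable \<mu> (\<lambda>x. cnj (f x) * h x)"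
    using L2_mult_integrable[OF L2_cnj] assms by auto
  have "L2_inner S f (\<lambda>x. \<alpha> * g x + \<beta> * h x)
      = (\<integral>x. \<alpha> * (cnj (f x) * g x) + \<beta> * (cnj (f x) * h x) \<partial>\<mu>)"
    by (simp add: L2_inner_def algebra_simps)
  also have "\<dots> = \<alpha> * L2_inner S f g + \<beta> * L2_inner S f h"
    using i by (simp add: L2_inner_def)
  finally show ?thesis .
qed

lemma L2_inner_cnj: "cnj (L2_inner S f g) = L2_inner S g f"
  unfolding L2_inner_def by (simp add: mult.commute flip: Bochner_Integration.integral_cnj)

lemma L2_inner_lincomb_left:
  assumes "f \<in> L2 S" "g \<in> L2 S" "h \<in> L2 S"
  shows "L2_inner S (\<lambda>x. \<alpha> * g x + \<beta> * h x) f = cnj \<alpha> * L2_inner S g f + cnj \<beta> * L2_inner S h f"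
  using arg_cong[OF L2_inner_lincomb[OF assms, of \<alpha> \<beta>], of cnj] by (simp add: L2_inner_cnj)

lemma L2_inner_scale: 
  assumes "f \<in> L2 S" "g \<in> L2 S"
  shows "L2_inner S f (\<lambda>x. \<alpha> * g x) = \<alpha> * L2_inner S f g"
    "L2_inner S (\<lambda>x. \<alpha> * f x) g = cnj \<alpha> * L2_inner S f g"
  using L2_inner_lincomb[OF assms assms(2), of \<alpha> 0] L2_inner_lincomb_left[OF assms(2,1,1), of \<alpha> 0] by simp_all

lemma L2_norm_nonneg: "L2_norm S f \<ge> 0"
  by (simp add: L2_norm_def)

lemma L2_norm_sq: "(L2_norm S f)\<^sup>2 = (\<integral>x. (cmod (f x))\<^sup>2 \<partial>\<mu>)"
  by (simp add: L2_norm_def)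

lemma L2_inner_self: "L2_inner S f f = of_real ((L2_norm S f)\<^sup>2)"
proof -
  have "L2_inner S f f = (\<integral>x. of_real ((cmod (f x))\<^sup>2) \<partial>\<mu>)"
    unfolding L2_inner_def by (simp add: complex_norm_square mult.commute flip: of_real_power)
  also have "\<dots> = of_real (\<integral>x. (cmod (f x))\<^sup>2 \<partial>\<mu>)" by (rule integral_complex_of_real)
  finally show ?thesis unfolding L2_norm_sq .
qed

lemma AE_L2_inner_cong:
  assumes "AE x in \<mu>. f x = f' x" "AE x in \<mu>. g x = g' x"
    "f \<in> L2 S" "f' \<in> L2 S" "g \<in> L2 S" "g' \<in> L2 S"
  shows "L2_inner S f g = L2_inner S f' g'"
  unfolding L2_inner_def
proof (rule integral_cong_AE)
  show "AE x in \<mu>. cnj (f x) * g x = cnj (f' x) * g' x"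
    using assms(1,2) by eventually_elim simp
qed (use L2_mult_integrable[OF L2_cnj] assms in auto)

lemma L2_norm_eq_0:
  assumes "f \<in> L2 S" "L2_norm S f = 0"
  shows "AE x in \<mu>. f x = 0"
proof -
  have "(\<integral>x. (cmod (f x))\<^sup>2 \<partial>\<mu>) = 0" using L2_norm_sq[of f] assms(2) by simp
  then have "AE x in \<mu>. (cmod (f x))\<^sup>2 = 0"
    using integral_nonneg_eq_0_iff_AE[OF L2D(2)[OF assms(1)]] by simp
  then show ?thesis by eventually_elim simp
qed

lemma L2_Cauchy_Schwarz:
  assumes f: "f \<in> L2 S" and g: "g \<in> L2 S"
  shows "cmod (L2_inner S f g) \<le> L2_norm S f * L2_norm S g"
proof (cases "L2_norm S f = 0")
  case True
  have "AE x in \<mu>. cnj (f x) * g x = 0"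
    using L2_norm_eq_0[OF f True] by eventually_elim simp
  then have "L2_inner S f g = 0"
    unfolding L2_inner_def by (rule integral_eq_zero_AE)
  then show ?thesis by (simp add: L2_norm_nonneg)
next
  case False
  define n where "n = (L2_norm S f)\<^sup>2"
  define k where "k = L2_inner S f g"
  have n: "n > 0" using False by (simp add: n_def)
  define h where "h = (\<lambda>x. of_real n * g x + (- k) * f x)"
  have h: "h \<in> L2 S" unfolding h_def by (rule L2_lincomb[OF g f])
  have fh: "L2_inner S f h = 0"
    unfolding h_def L2_inner_lincomb[OF f g f] L2_inner_self by (simp add: n_def k_def)
  have "L2_inner S g h = of_real n * of_real ((L2_norm S g)\<^sup>2) - k * cnj k"
    unfolding h_def L2_inner_lincomb[OF g g f] L2_inner_self k_def by (simp add: L2_inner_cnj)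
  then have "L2_inner S h h = of_real n * (of_real n * of_real ((L2_norm S g)\<^sup>2) - k * cnj k)"
    by (subst (1) h_def, subst L2_inner_lincomb_left[OF h g f]) (simp add: fh)
  then have "of_real ((L2_norm S h)\<^sup>2) = (of_real (n * (n * (L2_norm S g)\<^sup>2 - (cmod k)\<^sup>2)) :: complex)"
    by (simp add: L2_inner_self complex_norm_square flip: of_real_power)
  then have "(L2_norm S h)\<^sup>2 = n * (n * (L2_norm S g)\<^sup>2 - (cmod k)\<^sup>2)"
    unfolding of_real_eq_iff .
  then have "0 \<le> n * (n * (L2_norm S g)\<^sup>2 - (cmod k)\<^sup>2)" by (metis zero_le_power2)
  then have "(cmod k)\<^sup>2 \<le> (L2_norm S f * L2_norm S g)\<^sup>2"
    using n by (simp add: zero_le_mult_iff n_def power_mult_distrib)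
  then show ?thesis
    unfolding k_def by (rule power2_le_imp_le) (simp add: L2_norm_nonneg)
qed

section \<open>Boundary values of the Wronskian\<close>

lemma end_nontrivial: "end_a S \<noteq> bot" "end_b S \<noteq> bot"
proof -
  have "\<not> eventually (\<lambda>x. False) (at_right (sl_a S))" "\<not> eventually (\<lambda>x. False) (at_left (sl_b S))"
    using ends_less dense unfolding eventually_at_right[OF ends_less] eventually_at_left[OF ends_less] by blast+
  then show "end_a S \<noteq> bot" "end_b S \<noteq> bot"
    unfolding end_a_def end_b_def by (simp_all add: trivial_limit_def eventually_filtermap)
qed

lemma real_of_ereal_in_J:
  assumes "sl_a S < y" "y < sl_b S"
  shows "real_of_ereal y \<in> J" "ereal (real_of_ereal y) = y"
proof -
  show e: "ereal (real_of_ereal y) = y" using assms by (cases y) auto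
  show "real_of_ereal y \<in> J" unfolding sl_int_def einterval_iff using assms e by simp
qed

lemma eventually_in_J: "eventually (\<lambda>x. x \<in> J) (end_a S)" "eventually (\<lambda>x. x \<in> J) (end_b S)"
proof -
  have "eventually (\<lambda>y. sl_a S < y \<and> y < sl_b S) (at_right (sl_a S))"
    "eventually (\<lambda>y. sl_a S < y \<and> y < sl_b S) (at_left (sl_b S))"
    unfolding eventually_at_right[OF ends_less] eventually_at_left[OF ends_less]
    using ends_less by blast+
  then show "eventually (\<lambda>x. x \<in> J) (end_a S)" "eventually (\<lambda>x. x \<in> J) (end_b S)"
    unfolding end_a_def end_b_def eventually_filtermap
    by (auto elim!: eventually_mono intro: real_of_ereal_in_J)
qed

text \<open>The two endpoints of the interval, as filters.\<close>

definition is_end :: "real filter \<Rightarrow> bool" where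
  "is_end F \<longleftrightarrow> F = end_a S \<or> F = end_b S"

lemma is_end [simp]: "is_end (end_a S)" "is_end (end_b S)"
  by (auto simp: is_end_def)

lemma is_endD: assumes "is_end F" shows "F \<noteq> bot" "eventually (\<lambda>x. x \<in> J) F"
  using assms end_nontrivial eventually_in_J by (auto simp: is_end_def)

lemma tendsto_integral_end_b:
  fixes H :: "real \<Rightarrow> complex"
  assumes H: "H absolutely_integrable_on J" and c: "c \<in> J"
  shows "((\<lambda>x. integral {c..x} H) \<longlongrightarrow> integral (J \<inter> {c..}) H) (end_b S)"
proof -
  have cb: "ereal c < sl_b S" "sl_a S < ereal c" using c by (auto simp: sl_int_def einterval_iff)
  have "((\<lambda>y. integral {c..real_of_ereal y} H) \<longlongrightarrow> integral (J \<inter> {c..}) H) (at_left (sl_b S))"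
  proof (rule tendsto_at_left_sequentially[OF cb(1)])
    fix X :: "nat \<Rightarrow> ereal"
    assume X: "\<And>n. X n < sl_b S" "\<And>n. ereal c < X n" "incseq X" "X \<longlonglongrightarrow> sl_b S"
    have XJ: "real_of_ereal (X n) \<in> J" "ereal (real_of_ereal (X n)) = X n" for n
      using real_of_ereal_in_J[of "X n"] X(1,2)[of n] cb(2) by (meson less_trans)+
    define h where "h = (\<lambda>n y. if y \<in> {c..real_of_ereal (X n)} then H y else 0)"
    have sub: "{c..real_of_ereal (X n)} \<inter> J = {c..real_of_ereal (X n)}" for n
      using J_segment[OF c XJ(1)] by blast
    have "(\<lambda>n. integral J (h n)) \<longlonglongrightarrow> integral J (\<lambda>y. if y \<in> {c..} then H y else 0)"
    proof (rule dominated_convergence(2)[where h = "\<lambda>x. norm (H x)"])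
      show "h n integrable_on J" for n
        unfolding h_def integrable_restrict_Int sub
        using set_integrable_subset[OF H _ J_segment[OF c XJ(1)]] set_lebesgue_integral_eq_integral(1) by auto
      show "(\<lambda>x. norm (H x)) integrable_on J"
        using absolutely_integrable_norm[OF H] set_lebesgue_integral_eq_integral(1) by (auto simp: o_def)
      show "norm (h n x) \<le> norm (H x)" for n x by (simp add: h_def)
      fix y assume y: "y \<in> J"
      show "(\<lambda>n. h n y) \<longlonglongrightarrow> (if y \<in> {c..} then H y else 0)"
      proof (rule tendsto_eventually)
        have "ereal y < sl_b S" using y by (auto simp: sl_int_def einterval_iff)
        then have "\<forall>\<^sub>F n in sequentially. ereal y < X n" using X(4) order_tendstoD(1) by blast
        then show "\<forall>\<^sub>F n in sequentially. h n y = (if y \<in> {c..} then H y else 0)"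
        proof eventually_elim
          case (elim n)
          then have "ereal y < ereal (real_of_ereal (X n))" using XJ(2) by simp
          then have "y < real_of_ereal (X n)" by (simp only: less_ereal.simps)
          then show ?case by (simp add: h_def)
        qed
      qed
    qed
    then show "(\<lambda>n. integral {c..real_of_ereal (X n)} H) \<longlonglongrightarrow> integral (J \<inter> {c..}) H"
      unfolding h_def integral_restrict_Int sub by (simp add: Int_commute)
  qed
  then show ?thesis unfolding end_b_def filterlim_filtermap .
qed

lemma tendsto_integral_end_a:
  fixes H :: "real \<Rightarrow> complex"
  assumes H: "H absolutely_integrable_on J" and c: "c \<in> J"
  shows "((\<lambda>x. integral {x..c} H) \<longlongrightarrow> integral (J \<inter> {..c}) H) (end_a S)"
proof -
  have cb: "ereal c < sl_b S" "sl_a S < ereal c" using c by (auto simp: sl_int_def einterval_iff)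
  have "((\<lambda>y. integral {real_of_ereal y..c} H) \<longlongrightarrow> integral (J \<inter> {..c}) H) (at_right (sl_a S))"
  proof (rule tendsto_at_right_sequentially[OF cb(2)])
    fix X :: "nat \<Rightarrow> ereal"
    assume X: "\<And>n. sl_a S < X n" "\<And>n. X n < ereal c" "decseq X" "X \<longlonglongrightarrow> sl_a S"
    have XJ: "real_of_ereal (X n) \<in> J" "ereal (real_of_ereal (X n)) = X n" for n
      using real_of_ereal_in_J[of "X n"] X(1,2)[of n] cb(1) by (meson less_trans)+
    define h where "h = (\<lambda>n y. if y \<in> {real_of_ereal (X n)..c} then H y else 0)"
    have sub: "{real_of_ereal (X n)..c} \<inter> J = {real_of_ereal (X n)..c}" for n
      using J_segment[OF XJ(1) c] by blast
    have "(\<lambda>n. integral J (h n)) \<longlonglongrightarrow> integral J (\<lambda>y. if y \<in> {..c} then H y else 0)"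
    proof (rule dominated_convergence(2)[where h = "\<lambda>x. norm (H x)"])
      show "h n integrable_on J" for n
        unfolding h_def integrable_restrict_Int sub
        using set_integrable_subset[OF H _ J_segment[OF XJ(1) c]] set_lebesgue_integral_eq_integral(1) by auto
      show "(\<lambda>x. norm (H x)) integrable_on J"
        using absolutely_integrable_norm[OF H] set_lebesgue_integral_eq_integral(1) by (auto simp: o_def)
      show "norm (h n x) \<le> norm (H x)" for n x by (simp add: h_def)
      fix y assume y: "y \<in> J"
      show "(\<lambda>n. h n y) \<longlonglongrightarrow> (if y \<in> {..c} then H y else 0)"
      proof (rule tendsto_eventually)
        have "sl_a S < ereal y" using y by (auto simp: sl_int_def einterval_iff)
        then have "\<forall>\<^sub>F n in sequentially. X n < ereal y" using X(4) order_tendstoD(2) by blast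
        then show "\<forall>\<^sub>F n in sequentially. h n y = (if y \<in> {..c} then H y else 0)"
        proof eventually_elim
          case (elim n)
          then have "ereal (real_of_ereal (X n)) < ereal y" using XJ(2) by simp
          then have "real_of_ereal (X n) < y" by (simp only: less_ereal.simps)
          then show ?case by (simp add: h_def)
        qed
      qed
    qed
    then show "(\<lambda>n. integral {real_of_ereal (X n)..c} H) \<longlonglongrightarrow> integral (J \<inter> {..c}) H"
      unfolding h_def integral_restrict_Int sub by (simp add: Int_commute)
  qed
  then show ?thesis unfolding end_a_def filterlim_filtermap .
qed

lemma T_maxD:
  assumes "(g, w) \<in> T_max S"
  shows "g \<in> L2 S" "w \<in> L2 S" "tau_eq S g w"
  using assms by (auto simp: T_max_def)

lemma T_max_lincomb:
  assumes "(f, fw) \<in> T_max S" "(g, gw) \<in> T_max S"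
  shows "(\<lambda>x. \<alpha> * f x + \<beta> * g x, \<lambda>x. \<alpha> * fw x + \<beta> * gw x) \<in> T_max S"
  using T_maxD[OF assms(1)] T_maxD[OF assms(2)] tau_eq_lincomb(1) L2_lincomb by (simp add: T_max_def)

lemma T_max_cnj: "(g, w) \<in> T_max S \<Longrightarrow> (\<lambda>x. cnj (g x), \<lambda>x. cnj (w x)) \<in> T_max S"
  using tau_eq_cnj(1) L2_cnj by (simp add: T_max_def)

text \<open>By Lagrange's identity the Wronskian of two elements of the maximal domain is an indefinite
  integral of an integrable function; the second claim is Green's formula.\<close>

lemma wronskian_limits:
  assumes f: "(f, fw) \<in> T_max S" and g: "(g, gw) \<in> T_max S"
  shows "is_end F \<Longrightarrow> (wronskian S f g \<longlongrightarrow> wronskian_at S f g F) F"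
    "wronskian_at S f g (end_b S) - wronskian_at S f g (end_a S) = (\<integral>x. fw x * g x - f x * gw x \<partial>\<mu>)"
proof -
  note F = T_maxD[OF f] and G = T_maxD[OF g]
  obtain c where c: "c \<in> J" using J_nonempty by blast
  have i: "integrable \<mu> (\<lambda>x. fw x * g x - f x * gw x)"
    using F(1,2) G(1,2) by (intro Bochner_Integration.integrable_diff L2_mult_integrable)
  define H where "H = (\<lambda>x. of_real (r x) * (fw x * g x - f x * gw x))"
  have H: "H absolutely_integrable_on J" "integral J H = (\<integral>x. fw x * g x - f x * gw x \<partial>\<mu>)"
    unfolding H_def by (rule integrable_wmeasure_absolutely_integrable[OF i])+
  have WH: "wronskian S f g d - wronskian S f g e = integral {e..d} H" if "e \<in> J" "d \<in> J" "e \<le> d" for d e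
    unfolding H_def using integral_unique[OF wronskian_has_integral[OF F(3) G(3) that]] by simp
  have e0: "integral {u..v} H = 0" if "v \<le> u" for u v :: real
    using that by (cases "v = u") auto
  define B where "B = wronskian S f g c + integral (J \<inter> {c..}) H"
  define A where "A = wronskian S f g c - integral (J \<inter> {..c}) H"
  have b: "(wronskian S f g \<longlongrightarrow> B) (end_b S)"
  proof (rule Lim_transform_eventually)
    show "((\<lambda>x. wronskian S f g c + integral {c..x} H) \<longlongrightarrow> B) (end_b S)"
      unfolding B_def by (intro tendsto_add tendsto_const tendsto_integral_end_b H c)
    have "eventually (\<lambda>y. ereal c < y \<and> y < sl_b S) (at_left (sl_b S))"
      using c by (auto simp: sl_int_def einterval_iff eventually_at_left[of "ereal c"])
    then have "eventually (\<lambda>x. c < x) (end_b S)"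
      unfolding end_b_def eventually_filtermap
    proof eventually_elim
      case (elim y)
      then show ?case by (cases y) auto
    qed
    then show "eventually (\<lambda>x. wronskian S f g c + integral {c..x} H = wronskian S f g x) (end_b S)"
      using eventually_in_J(2) by eventually_elim (use WH[OF c] in \<open>simp add: algebra_simps\<close>)
  qed
  have a: "(wronskian S f g \<longlongrightarrow> A) (end_a S)"
  proof (rule Lim_transform_eventually)
    show "((\<lambda>x. wronskian S f g c - integral {x..c} H) \<longlongrightarrow> A) (end_a S)"
      unfolding A_def by (intro tendsto_diff tendsto_const tendsto_integral_end_a H c)
    have "eventually (\<lambda>y. sl_a S < y \<and> y < ereal c) (at_right (sl_a S))"
      using c by (auto simp: sl_int_def einterval_iff eventually_at_right[of _ "ereal c"])
    then have "eventually (\<lambda>x. x < c) (end_a S)"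
      unfolding end_a_def eventually_filtermap
    proof eventually_elim
      case (elim y)
      then show ?case by (cases y) auto
    qed
    then show "eventually (\<lambda>x. wronskian S f g c - integral {x..c} H = wronskian S f g x) (end_a S)"
      using eventually_in_J(1)
    proof eventually_elim
      case (elim x)
      then show ?case using WH[OF elim(2) c] by (simp add: algebra_simps)
    qed
  qed
  have BA: "wronskian_at S f g (end_b S) = B" "wronskian_at S f g (end_a S) = A"
    unfolding wronskian_at_def using tendsto_Lim[OF end_nontrivial(2) b] tendsto_Lim[OF end_nontrivial(1) a] by auto
  show "is_end F \<Longrightarrow> (wronskian S f g \<longlongrightarrow> wronskian_at S f g F) F"
    using a b BA by (auto simp: is_end_def)
  have "integral (J \<inter> {..c}) H + integral (J \<inter> {c..}) H = integral J H"
  proof -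
    have "H integrable_on (J \<inter> {..c})" "H integrable_on (J \<inter> {c..})"
      by (auto intro!: set_lebesgue_integral_eq_integral(1) set_integrable_subset[OF H(1)])
    moreover have "negligible ((J \<inter> {..c}) \<inter> (J \<inter> {c..}))"
      by (rule negligible_subset[of "{c}"]) auto
    moreover have "J = (J \<inter> {..c}) \<union> (J \<inter> {c..})" by auto
    ultimately show ?thesis
      using has_integral_Un[of H _ "J \<inter> {..c}" _ "J \<inter> {c..}"] by (metis integrable_integral integral_unique)
  qed
  then show "wronskian_at S f g (end_b S) - wronskian_at S f g (end_a S) = (\<integral>x. fw x * g x - f x * gw x \<partial>\<mu>)"
    unfolding BA A_def B_def H(2)[symmetric] by (simp add: algebra_simps)
qed

lemma wronskian_at_eqI:
  assumes "is_end F" "(wronskian S f g \<longlongrightarrow> L) F"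
  shows "wronskian_at S f g F = L"
  unfolding wronskian_at_def using tendsto_Lim[OF is_endD(1)[OF assms(1)] assms(2)] .

lemma wronskian_at_lincomb:
  assumes h: "(h, hw) \<in> T_max S" and f: "(f, fw) \<in> T_max S" and g: "(g, gw) \<in> T_max S" and F: "is_end F"
  shows "wronskian_at S h (\<lambda>x. \<alpha> * f x + \<beta> * g x) F = \<alpha> * wronskian_at S h f F + \<beta> * wronskian_at S h g F"
proof (rule wronskian_at_eqI[OF F], rule Lim_transform_eventually)
  show "((\<lambda>x. \<alpha> * wronskian S h f x + \<beta> * wronskian S h g x) \<longlongrightarrow>
      \<alpha> * wronskian_at S h f F + \<beta> * wronskian_at S h g F) F"
    by (intro tendsto_intros wronskian_limits(1)[OF h f F] wronskian_limits(1)[OF h g F])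
  show "eventually (\<lambda>x. \<alpha> * wronskian S h f x + \<beta> * wronskian S h g x = wronskian S h (\<lambda>x. \<alpha> * f x + \<beta> * g x) x) F"
    using is_endD(2)[OF F]
  proof eventually_elim
    case (elim x)
    from tau_eq_lincomb(2)[OF T_maxD(3)[OF f] T_maxD(3)[OF g] elim]
    show ?case by (simp add: wronskian_def algebra_simps)
  qed
qed

lemma wronskian_at_cong:
  assumes h: "(h, hw) \<in> T_max S" and f: "(f, fw) \<in> T_max S" and F: "is_end F"
    and eq: "\<And>x. x \<in> J \<Longrightarrow> h x = h' x" "\<And>x. x \<in> J \<Longrightarrow> f x = f' x"
  shows "wronskian_at S h f F = wronskian_at S h' f' F"
proof (rule wronskian_at_eqI[OF F, symmetric], rule Lim_transform_eventually[OF wronskian_limits(1)[OF h f F]])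
  show "eventually (\<lambda>x. wronskian S h f x = wronskian S h' f' x) F"
    using is_endD(2)[OF F] by eventually_elim (rule wronskian_cong[OF T_maxD(3)[OF h] eq(1) T_maxD(3)[OF f] eq(2)])
qed

lemma wronskian_at_cnj:
  assumes h: "(h, hw) \<in> T_max S" and f: "(f, fw) \<in> T_max S" and F: "is_end F"
  shows "wronskian_at S (\<lambda>x. cnj (h x)) (\<lambda>x. cnj (f x)) F = cnj (wronskian_at S h f F)"
proof (rule wronskian_at_eqI[OF F], rule Lim_transform_eventually[OF tendsto_cnj[OF wronskian_limits(1)[OF h f F]]])
  show "eventually (\<lambda>x. cnj (wronskian S h f x) = wronskian S (\<lambda>x. cnj (h x)) (\<lambda>x. cnj (f x)) x) F"
    using is_endD(2)[OF F]
  proof eventually_elim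
    case (elim x)
    from tau_eq_cnj(2)[OF T_maxD(3)[OF h] elim] tau_eq_cnj(2)[OF T_maxD(3)[OF f] elim]
    show ?case by (simp add: wronskian_def)
  qed
qed

text \<open>The Pluecker relation of the two-by-two minors formed from four functions and their
  quasi-derivatives, in the limit.\<close>

lemma wronskian_at_Pluecker:
  assumes "(f1, v1) \<in> T_max S" "(f2, v2) \<in> T_max S" "(f, fw) \<in> T_max S" "(g, gw) \<in> T_max S" and F: "is_end F"
  shows "wronskian_at S f1 f2 F * wronskian_at S f g F
    = wronskian_at S f1 f F * wronskian_at S f2 g F - wronskian_at S f1 g F * wronskian_at S f2 f F"
proof -
  note l = wronskian_limits(1)[OF assms(1,2) F] wronskian_limits(1)[OF assms(3,4) F]
    wronskian_limits(1)[OF assms(1,3) F] wronskian_limits(1)[OF assms(2,4) F]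
    wronskian_limits(1)[OF assms(1,4) F] wronskian_limits(1)[OF assms(2,3) F]
  have "((\<lambda>x. wronskian S f1 f2 x * wronskian S f g x) \<longlongrightarrow> wronskian_at S f1 f2 F * wronskian_at S f g F) F"
    by (intro tendsto_mult l)
  moreover have "((\<lambda>x. wronskian S f1 f x * wronskian S f2 g x - wronskian S f1 g x * wronskian S f2 f x) \<longlongrightarrow>
      wronskian_at S f1 f F * wronskian_at S f2 g F - wronskian_at S f1 g F * wronskian_at S f2 f F) F"
    by (intro tendsto_mult tendsto_diff l)
  moreover have "(\<lambda>x. wronskian S f1 f2 x * wronskian S f g x)
      = (\<lambda>x. wronskian S f1 f x * wronskian S f2 g x - wronskian S f1 g x * wronskian S f2 f x)"
    by (simp add: wronskian_def fun_eq_iff algebra_simps)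
  ultimately show ?thesis using tendsto_unique[OF is_endD(1)[OF F]] by metis
qed

end

section \<open>Limit circle endpoints and the self-adjoint realization\<close>

text \<open>Both endpoints are in the limit circle case, and \<open>w1\<close>, \<open>w2\<close> define the generalized boundary
  values \<open>b0\<close> (written \<open>g~\<close>) and \<open>b1\<close> (written \<open>g~'\<close>).\<close>

locale limit_circle_problem = sturm_liouville +
  fixes w1 w2 :: "real \<Rightarrow> complex"
  assumes lc_a: "limit_circle_a S" and lc_b: "limit_circle_b S"
    and ref: "boundary_reference S w1 w2"
begin

abbreviation "b0 g F \<equiv> bval S w2 g F"
abbreviation "b1 g F \<equiv> bval' S w1 g F"

lemma continuous_on_J_measurable: "continuous_on J f \<Longrightarrow> f \<in> borel_measurable \<mu>"
  unfolding borel_measurable_wmeasure by (rule continuous_imp_measurable_on_sets_lebesgue) simp_all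

lemma indicator_segment_integrable:
  assumes "c \<in> J" "d \<in> J"
  shows "integrable \<mu> (\<lambda>x. indicator {c..d} x :: real)"
proof -
  have m: "(\<lambda>x. indicator {c..d} x :: real) \<in> borel_measurable \<mu>"
    unfolding borel_measurable_wmeasure by (intro measurable_restrict_space1 borel_measurable_indicator) simp
  have "L1_loc S r" using coeffs by (simp add: sl_coefficients_def)
  then have "r absolutely_integrable_on {c..d}"
    using J_segment[OF assms] unfolding L1_loc_def by simp
  then have "integrable lebesgue (\<lambda>x. indicator {c..d} x *\<^sub>R r x)"
    by (simp add: set_integrable_def)
  also have "(\<lambda>x. indicator {c..d} x *\<^sub>R r x) = (\<lambda>x. indicator J x *\<^sub>R (r x *\<^sub>R indicator {c..d} x))"
    using J_segment[OF assms] by (auto simp: fun_eq_iff indicator_def)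
  finally have "integrable (lebesgue_on J) (\<lambda>x. r x *\<^sub>R (indicator {c..d} x :: real))"
    by (subst integrable_restrict_space) auto
  then show ?thesis using integrable_wmeasure_iff[OF m] by simp
qed

lemma solves_continuous_on: "solves S z u \<Longrightarrow> continuous_on J u"
  unfolding solves_def using tau_eqD(1) AC_loc_continuous_on by blast

lemma solves_L2:
  assumes u: "solves S z u"
  shows "u \<in> L2 S"
proof -
  obtain c d where c: "c \<in> J" "set_integrable \<mu> {..c} (\<lambda>x. (cmod (u x))\<^sup>2)"
    and d: "d \<in> J" "set_integrable \<mu> {d..} (\<lambda>x. (cmod (u x))\<^sup>2)"
    using u lc_a lc_b unfolding limit_circle_a_def limit_circle_b_def by metis
  have cont: "continuous_on J u" using solves_continuous_on[OF u] .
  have m: "u \<in> borel_measurable \<mu>" using continuous_on_J_measurable[OF cont] .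
  have "bounded (u ` {c..d})"
    using continuous_on_subset[OF cont J_segment[OF c(1) d(1)]]
    by (intro compact_imp_bounded compact_continuous_image) auto
  then obtain K where K: "\<forall>y\<in>u ` {c..d}. cmod y \<le> K" unfolding bounded_iff by blast
  have "integrable \<mu> (\<lambda>x. indicator {..c} x *\<^sub>R (cmod (u x))\<^sup>2 + indicator {d..} x *\<^sub>R (cmod (u x))\<^sup>2
      + K\<^sup>2 * indicator {c..d} x)"
    using c(2) d(2) indicator_segment_integrable[OF c(1) d(1)] unfolding set_integrable_def
    by (intro Bochner_Integration.integrable_add integrable_mult_right)
  then have "integrable \<mu> (\<lambda>x. (cmod (u x))\<^sup>2)"
  proof (rule Bochner_Integration.integrable_bound)
    show "(\<lambda>x. (cmod (u x))\<^sup>2) \<in> borel_measurable \<mu>" using m by measurable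
    show "AE x in \<mu>. norm ((cmod (u x))\<^sup>2) \<le> norm (indicator {..c} x *\<^sub>R (cmod (u x))\<^sup>2 + indicator {d..} x *\<^sub>R (cmod (u x))\<^sup>2
      + K\<^sup>2 * indicator {c..d} x)"
    proof (rule AE_I2)
      fix x
      have "(cmod (u x))\<^sup>2 \<le> K\<^sup>2" if "x \<in> {c..d}"
        using K that by (intro power_mono) auto
      then show "norm ((cmod (u x))\<^sup>2) \<le> norm (indicator {..c} x *\<^sub>R (cmod (u x))\<^sup>2 + indicator {d..} x *\<^sub>R (cmod (u x))\<^sup>2
        + K\<^sup>2 * indicator {c..d} x)"
        by (auto simp: indicator_def)
    qed
  qed
  then show ?thesis using m by (simp add: L2_def)
qed

lemma solves_T_max: "solves S z u \<Longrightarrow> (u, \<lambda>x. z * u x) \<in> T_max S"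
  using solves_L2 L2_scale by (simp add: T_max_def solves_def)

lemma solves_lincomb:
  assumes "solves S z f" "solves S z g"
  shows "solves S z (\<lambda>x. \<alpha> * f x + \<beta> * g x)"
proof -
  have "(\<lambda>x. \<alpha> * (z * f x) + \<beta> * (z * g x)) = (\<lambda>x. z * (\<alpha> * f x + \<beta> * g x))"
    by (simp add: algebra_simps)
  then show ?thesis
    using tau_eq_lincomb(1)[of f "\<lambda>x. z * f x" g "\<lambda>x. z * g x" \<alpha> \<beta>] assms by (simp add: solves_def)
qed

lemma solves_cnj: "solves S z u \<Longrightarrow> solves S (cnj z) (\<lambda>x. cnj (u x))"
  unfolding solves_def using tau_eq_cnj(1)[of u "\<lambda>x. z * u x"] by simp

lemma locally_integrable_r_L2:
  assumes f: "f \<in> L2 S"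
  shows "locally_integrable J (\<lambda>x. of_real (r x) * f x)"
  unfolding locally_integrable_def
proof (intro ballI)
  fix c d assume cd: "c \<in> J" "d \<in> J"
  have "(\<lambda>x. indicator {c..d} x :: complex) \<in> L2 S"
  proof -
    have "(\<lambda>x. (cmod (indicator {c..d} x))\<^sup>2) = (\<lambda>x. indicator {c..d} x :: real)"
      by (auto simp: indicator_def)
    moreover have "(\<lambda>x. indicator {c..d} x :: complex) \<in> borel_measurable \<mu>"
      unfolding borel_measurable_wmeasure by (intro measurable_restrict_space1 borel_measurable_indicator) simp
    ultimately show ?thesis using indicator_segment_integrable[OF cd] by (simp add: L2_def)
  qed
  then have "(\<lambda>x. of_real (r x) * (indicator {c..d} x * f x)) absolutely_integrable_on J"
    by (intro integrable_wmeasure_absolutely_integrable(1) L2_mult_integrable f)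
  then have "(\<lambda>x. of_real (r x) * (indicator {c..d} x * f x)) absolutely_integrable_on {c..d}"
    by (rule set_integrable_subset) (use J_segment[OF cd] in auto)
  then show "(\<lambda>x. of_real (r x) * f x) absolutely_integrable_on {c..d}"
    by (rule set_integrable_cong[THEN iffD1, rotated -1]) auto
qed

text \<open>In the limit circle case every solution of the inhomogeneous equation with square integrable
  right-hand side \<open>f\<close> is square integrable: the Wronskians \<open>W(\<phi>, g)\<close>, \<open>W(\<theta>, g)\<close> with a
  fundamental system have the integrable derivatives \<open>- r \<phi> f\<close>, \<open>- r \<theta> f\<close>, hence are bounded,
  and \<open>g = \<phi> W(\<theta>, g) - \<theta> W(\<phi>, g)\<close>.\<close>

lemma wronskian_bounded:
  assumes u: "solves S z u" and g: "tau_eq S g (\<lambda>x. z * g x + f x)" and f: "f \<in> L2 S"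
  shows "\<exists>K. \<forall>x\<in>J. cmod (wronskian S u g x) \<le> K"
proof -
  obtain c where c: "c \<in> J" using J_nonempty by blast
  define H where "H = (\<lambda>x. of_real (r x) * (z * u x * g x - u x * (z * g x + f x)))"
  have "integrable \<mu> (\<lambda>x. u x * (-1 * f x))"
    by (intro L2_mult_integrable solves_L2[OF u] L2_scale f)
  then have "(\<lambda>x. of_real (r x) * (u x * (-1 * f x))) absolutely_integrable_on J"
    by (rule integrable_wmeasure_absolutely_integrable(1))
  moreover have "H = (\<lambda>x. of_real (r x) * (u x * (-1 * f x)))"
    by (simp add: H_def algebra_simps)
  ultimately have H: "H absolutely_integrable_on J" by simp
  define K where "K = integral J (\<lambda>x. cmod (H x))"
  have nH: "(\<lambda>x. cmod (H x)) integrable_on J"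
    using absolutely_integrable_norm[OF H] set_lebesgue_integral_eq_integral(1) by (auto simp: o_def)
  have d: "cmod (wronskian S u g y - wronskian S u g x) \<le> K" if xy: "x \<in> J" "y \<in> J" "x \<le> y" for x y
  proof -
    have hi: "(H has_integral (wronskian S u g y - wronskian S u g x)) {x..y}"
      unfolding H_def by (rule wronskian_has_integral[OF u[unfolded solves_def] g xy])
    have ni: "(\<lambda>x. cmod (H x)) integrable_on {x..y}"
      using nH J_segment[OF xy(1,2)] by (rule integrable_on_subinterval)
    have "cmod (integral {x..y} H) \<le> integral {x..y} (\<lambda>x. cmod (H x))"
      by (rule integral_norm_bound_integral[OF has_integral_integrable[OF hi] ni]) simp
    also have "\<dots> \<le> K"
      unfolding K_def using J_segment[OF xy(1,2)] by (rule integral_subset_le[OF _ ni nH]) simp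
    finally show ?thesis using integral_unique[OF hi] by simp
  qed
  have "cmod (wronskian S u g x) \<le> cmod (wronskian S u g c) + K" if x: "x \<in> J" for x
  proof -
    have "cmod (wronskian S u g x - wronskian S u g c) \<le> K"
      using d[OF c x] d[OF x c] by (cases "c \<le> x") (auto simp: norm_minus_commute)
    then show ?thesis using norm_triangle_ineq2[of "wronskian S u g x" "wronskian S u g c"] by linarith
  qed
  then show ?thesis by blast
qed

lemma fundamental_system:
  assumes c: "c \<in> J"
  obtains \<theta> \<phi> where "solves S z \<theta>" "solves S z \<phi>" "\<theta> c = 1" "qd \<theta> c = 0" "\<phi> c = 0" "qd \<phi> c = 1"
    "\<And>x. x \<in> J \<Longrightarrow> wronskian S \<theta> \<phi> x = 1"
proof -
  have z: "locally_integrable J (\<lambda>x. of_real (r x) * (0::complex))"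
    by (rule locally_integrable_mult_continuous[OF J_interval locally_integrable_coeffs(3)]) simp
  obtain \<theta> where \<theta>: "tau_eq S \<theta> (\<lambda>x. z * \<theta> x + 0)" "\<theta> c = 1" "qd \<theta> c = 0"
    using initial_value_exists[OF z c, of z 1 0] by blast
  obtain \<phi> where \<phi>: "tau_eq S \<phi> (\<lambda>x. z * \<phi> x + 0)" "\<phi> c = 0" "qd \<phi> c = 1"
    using initial_value_exists[OF z c, of z 0 1] by blast
  have const: "wronskian S \<theta> \<phi> y = wronskian S \<theta> \<phi> x" if "x \<in> J" "y \<in> J" "x \<le> y" for x y
    using wronskian_has_integral[OF \<theta>(1) \<phi>(1) that] by (simp add: algebra_simps)
  have "wronskian S \<theta> \<phi> x = 1" if x: "x \<in> J" for x
  proof -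
    have "wronskian S \<theta> \<phi> x = wronskian S \<theta> \<phi> c"
      using const[OF c x] const[OF x c] by (cases "c \<le> x") auto
    then show ?thesis using \<theta> \<phi> by (simp add: wronskian_def)
  qed
  then show ?thesis using that[of \<theta> \<phi>] \<theta> \<phi> by (simp add: solves_def)
qed

lemma inhomogeneous_solution_L2:
  assumes g: "tau_eq S g (\<lambda>x. z * g x + f x)" and f: "f \<in> L2 S"
  shows "g \<in> L2 S"
proof -
  obtain c where c: "c \<in> J" using J_nonempty by blast
  obtain \<theta> \<phi> where s: "solves S z \<theta>" "solves S z \<phi>" and W: "\<And>x. x \<in> J \<Longrightarrow> wronskian S \<theta> \<phi> x = 1"
    using fundamental_system[OF c] by metis
  obtain K1 K2 where K: "\<forall>x\<in>J. cmod (wronskian S \<theta> g x) \<le> K1" "\<forall>x\<in>J. cmod (wronskian S \<phi> g x) \<le> K2"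
    using wronskian_bounded[OF s(1) g f] wronskian_bounded[OF s(2) g f] by blast
  show ?thesis
  proof (rule L2_bound[OF _ solves_L2[OF s(1)] solves_L2[OF s(2)], where K = "max K1 K2"])
    show "g \<in> borel_measurable \<mu>"
      using tau_eqD(1)[OF g] by (intro continuous_on_J_measurable AC_loc_continuous_on)
    show "AE x in \<mu>. cmod (g x) \<le> max K1 K2 * cmod (\<theta> x) + max K1 K2 * cmod (\<phi> x)"
    proof (rule AE_wmeasure_I)
      fix x assume x: "x \<in> J"
      have "g x = g x * wronskian S \<theta> \<phi> x" using W[OF x] by simp
      also have "\<dots> = \<phi> x * wronskian S \<theta> g x - \<theta> x * wronskian S \<phi> g x"
        by (simp add: wronskian_def algebra_simps)
      finally have "cmod (g x) \<le> cmod (\<phi> x) * cmod (wronskian S \<theta> g x) + cmod (\<theta> x) * cmod (wronskian S \<phi> g x)"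
        using norm_triangle_ineq4 by (metis norm_mult)
      also have "\<dots> \<le> cmod (\<phi> x) * max K1 K2 + cmod (\<theta> x) * max K1 K2"
        using K x by (intro add_mono mult_left_mono) (auto simp: le_max_iff_disj)
      finally show "cmod (g x) \<le> max K1 K2 * cmod (\<theta> x) + max K1 K2 * cmod (\<phi> x)"
        by (simp add: algebra_simps)
    qed
  qed
qed

lemma reference_T_max: obtains x1 x2 where "(w1, x1) \<in> T_max S" "(w2, x2) \<in> T_max S"
  using ref unfolding boundary_reference_def by (auto simp: Domain_iff)

lemma reference_real: "x \<in> J \<Longrightarrow> cnj (w1 x) = w1 x" "x \<in> J \<Longrightarrow> cnj (w2 x) = w2 x"
  using ref unfolding boundary_reference_def by (auto simp: Reals_cnj_iff)

lemma reference_wronskian: "is_end F \<Longrightarrow> wronskian_at S w1 w2 F = 1"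
  using ref unfolding boundary_reference_def is_end_def by auto

lemma bval_lincomb:
  assumes f: "(f, fw) \<in> T_max S" and g: "(g, gw) \<in> T_max S" and F: "is_end F"
  shows "b0 (\<lambda>x. \<alpha> * f x + \<beta> * g x) F = \<alpha> * b0 f F + \<beta> * b0 g F"
    "b1 (\<lambda>x. \<alpha> * f x + \<beta> * g x) F = \<alpha> * b1 f F + \<beta> * b1 g F"
proof -
  obtain x1 x2 where x: "(w1, x1) \<in> T_max S" "(w2, x2) \<in> T_max S" by (rule reference_T_max)
  show "b0 (\<lambda>x. \<alpha> * f x + \<beta> * g x) F = \<alpha> * b0 f F + \<beta> * b0 g F"
    unfolding bval_def wronskian_at_lincomb[OF x(2) f g F] by (simp add: algebra_simps)
  show "b1 (\<lambda>x. \<alpha> * f x + \<beta> * g x) F = \<alpha> * b1 f F + \<beta> * b1 g F"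
    unfolding bval'_def wronskian_at_lincomb[OF x(1) f g F] ..
qed

lemma bval_cong:
  assumes f: "(f, fw) \<in> T_max S" and F: "is_end F" and eq: "\<And>x. x \<in> J \<Longrightarrow> f x = g x"
  shows "b0 f F = b0 g F" "b1 f F = b1 g F"
proof -
  obtain x1 x2 where x: "(w1, x1) \<in> T_max S" "(w2, x2) \<in> T_max S" by (rule reference_T_max)
  show "b0 f F = b0 g F" "b1 f F = b1 g F"
    unfolding bval_def bval'_def using wronskian_at_cong[OF x(1) f F refl eq] wronskian_at_cong[OF x(2) f F refl eq]
    by simp_all
qed

lemma bval_cnj:
  assumes f: "(f, fw) \<in> T_max S" and F: "is_end F"
  shows "b0 (\<lambda>x. cnj (f x)) F = cnj (b0 f F)" "b1 (\<lambda>x. cnj (f x)) F = cnj (b1 f F)"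
proof -
  obtain x1 x2 where x: "(w1, x1) \<in> T_max S" "(w2, x2) \<in> T_max S" by (rule reference_T_max)
  note cf = T_max_cnj[OF f]
  have "wronskian_at S w1 (\<lambda>x. cnj (f x)) F = wronskian_at S (\<lambda>x. cnj (w1 x)) (\<lambda>x. cnj (f x)) F"
    by (rule wronskian_at_cong[OF x(1) cf F]) (simp_all add: reference_real)
  moreover have "wronskian_at S w2 (\<lambda>x. cnj (f x)) F = wronskian_at S (\<lambda>x. cnj (w2 x)) (\<lambda>x. cnj (f x)) F"
    by (rule wronskian_at_cong[OF x(2) cf F]) (simp_all add: reference_real)
  ultimately show "b0 (\<lambda>x. cnj (f x)) F = cnj (b0 f F)" "b1 (\<lambda>x. cnj (f x)) F = cnj (b1 f F)"
    unfolding bval_def bval'_def using wronskian_at_cnj[OF x(1) f F] wronskian_at_cnj[OF x(2) f F] by simp_all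
qed

text \<open>The Pluecker relation with \<open>w1\<close>, \<open>w2\<close> expresses the boundary form through the generalized
  boundary values.\<close>

lemma wronskian_at_bval:
  assumes f: "(f, fw) \<in> T_max S" and g: "(g, gw) \<in> T_max S" and F: "is_end F"
  shows "wronskian_at S f g F = b0 f F * b1 g F - b1 f F * b0 g F"
proof -
  obtain x1 x2 where x: "(w1, x1) \<in> T_max S" "(w2, x2) \<in> T_max S" by (rule reference_T_max)
  show ?thesis
    using wronskian_at_Pluecker[OF x f g F] reference_wronskian[OF F]
    by (simp add: bval_def bval'_def)
qed


lemma T_00_iff: "(g, w) \<in> T_00 S w2 \<longleftrightarrow> (g, w) \<in> T_max S \<and> b0 g (end_a S) = 0 \<and> b0 g (end_b S) = 0"
  by (simp add: T_00_def)

text \<open>The boundary form of \<open>cnj g\<close> and \<open>g\<close> vanishes on this domain, so \<open>(g, \<tau> g)\<close> is real and the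
  imaginary part of \<open>(g, \<tau> g - z g)\<close> is \<open>- Im z \<parallel>g\<parallel>\<^sup>2\<close>.\<close>

lemma T_00_estimate:
  assumes g: "(g, w) \<in> T_00 S w2" and f: "f \<in> L2 S" and eq: "L2_eq S (\<lambda>x. w x - z * g x) f"
  shows "\<bar>Im z\<bar> * L2_norm S g \<le> L2_norm S f"
proof -
  have gT: "(g, w) \<in> T_max S" and b: "b0 g (end_a S) = 0" "b0 g (end_b S) = 0" using g by (auto simp: T_00_iff)
  note G = T_maxD[OF gT]
  note cg = T_max_cnj[OF gT]
  have "wronskian_at S (\<lambda>x. cnj (g x)) g F = 0" if "F = end_a S \<or> F = end_b S" for F
  proof -
    have F: "is_end F" using that by (simp add: is_end_def)
    show ?thesis
      unfolding wronskian_at_bval[OF cg gT F] bval_cnj[OF gT F] using that b by auto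
  qed
  then have "0 = (\<integral>x. cnj (w x) * g x - cnj (g x) * w x \<partial>\<mu>)"
    using wronskian_limits(2)[OF cg gT] by simp
  also have "\<dots> = L2_inner S w g - L2_inner S g w"
    unfolding L2_inner_def
    by (intro Bochner_Integration.integral_diff L2_mult_integrable L2_cnj G)
  finally have "cnj (L2_inner S g w) = L2_inner S g w" by (simp add: L2_inner_cnj)
  then have im: "Im (L2_inner S g w) = 0" by (simp add: complex_eq_iff)
  have "L2_inner S g f = L2_inner S g (\<lambda>x. 1 * w x + (- z) * g x)"
    using eq G f by (intro AE_L2_inner_cong L2_lincomb) (auto simp: L2_eq_def elim!: eventually_mono)
  also have "\<dots> = L2_inner S g w - z * of_real ((L2_norm S g)\<^sup>2)"
    unfolding L2_inner_lincomb[OF G(1,2,1)] L2_inner_self by simp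
  finally have "Im (L2_inner S g f) = - (Im z * (L2_norm S g)\<^sup>2)" using im by simp
  then have "\<bar>Im z\<bar> * (L2_norm S g)\<^sup>2 = \<bar>Im (L2_inner S g f)\<bar>" by (simp add: abs_mult)
  also have "\<dots> \<le> cmod (L2_inner S g f)" by (rule abs_Im_le_cmod)
  also have "\<dots> \<le> L2_norm S g * L2_norm S f" by (rule L2_Cauchy_Schwarz[OF G(1) f])
  finally have "L2_norm S g * (\<bar>Im z\<bar> * L2_norm S g) \<le> L2_norm S g * L2_norm S f"
    by (simp add: power2_eq_square algebra_simps)
  then show ?thesis
    using L2_norm_nonneg[of g] L2_norm_nonneg[of f]
    by (cases "L2_norm S g = 0") (auto simp: mult_le_cancel_left)
qed

lemma AE_eq_on_J:
  fixes f g :: "real \<Rightarrow> complex"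
  assumes "AE x in \<mu>. f x = g x" "continuous_on J f" "continuous_on J g" "x \<in> J"
  shows "f x = g x"
  using continuous_on_ae_eq[OF J_open assms(2,3) _ assms(4)] assms(1) unfolding AE_wmeasure by blast

lemma L2_norm_zero: "L2_norm S (\<lambda>x. 0) = 0"
  by (simp add: L2_norm_def)

lemma L2_zero: "(\<lambda>x. 0) \<in> L2 S"
  by (simp add: L2_def)

lemma T_00_injective:
  assumes "(g, w) \<in> T_00 S w2" "L2_eq S (\<lambda>x. w x - z * g x) (\<lambda>x. 0)" "Im z \<noteq> 0"
  shows "AE x in \<mu>. g x = 0"
proof -
  have "L2_norm S g = 0"
    using T_00_estimate[OF assms(1) L2_zero assms(2)] assms(3) L2_norm_nonneg[of g]
    by (simp add: L2_norm_zero mult_le_0_iff)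
  moreover have "g \<in> L2 S" using assms(1) T_maxD(1) by (auto simp: T_00_iff)
  ultimately show ?thesis using L2_norm_eq_0 by blast
qed

lemma solution_zero:
  assumes u: "solves S z u" and z: "Im z \<noteq> 0" and b: "b0 u (end_a S) = 0" "b0 u (end_b S) = 0" and x: "x \<in> J"
  shows "u x = 0"
proof -
  have "(u, \<lambda>x. z * u x) \<in> T_00 S w2" using solves_T_max[OF u] b by (simp add: T_00_iff)
  then have "AE x in \<mu>. u x = 0" by (rule T_00_injective[OF _ _ z]) (simp add: L2_eq_def)
  then show ?thesis
    by (rule AE_eq_on_J[OF _ solves_continuous_on[OF u] continuous_on_const x])
qed

lemma solution_eq:
  assumes u: "solves S z u" "solves S z v" and z: "Im z \<noteq> 0"
    and b: "b0 u (end_a S) = b0 v (end_a S)" "b0 u (end_b S) = b0 v (end_b S)" and x: "x \<in> J"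
  shows "u x = v x"
proof -
  have "1 * u x + (-1) * v x = 0"
  proof (rule solution_zero[OF solves_lincomb[OF u] z _ _ x])
    note T = solves_T_max[OF u(1)] solves_T_max[OF u(2)]
    show "b0 (\<lambda>x. 1 * u x + (-1) * v x) (end_a S) = 0" "b0 (\<lambda>x. 1 * u x + (-1) * v x) (end_b S) = 0"
      unfolding bval_lincomb(1)[OF T is_end(1)] bval_lincomb(1)[OF T is_end(2)] using b by simp_all
  qed
  then show ?thesis by simp
qed

text \<open>On the span of a fundamental system the map to the boundary values at \<open>a\<close> and \<open>b\<close> is injective,
  so its determinant \<open>D\<close> is nonzero and Cramer's rule applies.\<close>

lemma solution_with_bvals:
  assumes z: "Im z \<noteq> 0"
  shows "\<exists>u. solves S z u \<and> b0 u (end_a S) = \<alpha> \<and> b0 u (end_b S) = \<beta>"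
proof -
  obtain c where c: "c \<in> J" using J_nonempty by blast
  obtain \<theta> \<phi> where s: "solves S z \<theta>" "solves S z \<phi>" and i: "\<theta> c = 1" "qd \<theta> c = 0" "\<phi> c = 0" "qd \<phi> c = 1"
    using fundamental_system[OF c] by metis
  note T = solves_T_max[OF s(1)] solves_T_max[OF s(2)]
  define Pa Pb Qa Qb where "Pa = b0 \<theta> (end_a S)" "Pb = b0 \<theta> (end_b S)"
    "Qa = b0 \<phi> (end_a S)" "Qb = b0 \<phi> (end_b S)"
  have bl: "b0 (\<lambda>t. x * \<theta> t + y * \<phi> t) (end_a S) = x * Pa + y * Qa"
    "b0 (\<lambda>t. x * \<theta> t + y * \<phi> t) (end_b S) = x * Pb + y * Qb" for x y
    unfolding bval_lincomb(1)[OF T is_end(1)] bval_lincomb(1)[OF T is_end(2)] Pa_Pb_Qa_Qb_def by simp_all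
  have inj: "x = 0 \<and> y = 0" if xy: "x * Pa + y * Qa = 0" "x * Pb + y * Qb = 0" for x y
  proof -
    define u where "u = (\<lambda>t. x * \<theta> t + y * \<phi> t)"
    have u: "solves S z u" unfolding u_def by (rule solves_lincomb[OF s])
    have u0: "u t = 0" if "t \<in> J" for t
      by (rule solution_zero[OF u z _ _ that]) (use bl xy in \<open>simp_all add: u_def\<close>)
    have "wronskian S \<theta> u c = wronskian S \<theta> (\<lambda>t. 0 * \<theta> t + 0 * \<theta> t) c"
      using wronskian_cong[OF s(1)[unfolded solves_def] refl u[unfolded solves_def] _ c] u0 by simp
    then have "qd u c = 0"
      using tau_eq_lincomb(2)[OF s(1,1)[unfolded solves_def] c, of 0 0] i by (simp add: wronskian_def)
    moreover have "qd u c = y"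
      unfolding u_def using tau_eq_lincomb(2)[OF s[unfolded solves_def] c, of x y] i by simp
    moreover have "u c = x" using i by (simp add: u_def)
    ultimately show ?thesis using u0[OF c] by simp
  qed
  define D where "D = Pa * Qb - Qa * Pb"
  have "D \<noteq> 0"
  proof
    assume D: "D = 0"
    \<comment> \<open>If \<open>D = 0\<close>, the vectors \<open>(Qa, -Pa)\<close> and \<open>(Qb, -Pb)\<close> lie in the kernel.\<close>
    have "Qa = 0 \<and> - Pa = 0" by (rule inj) (use D in \<open>simp_all add: D_def algebra_simps\<close>)
    moreover have "Qb = 0 \<and> - Pb = 0" by (rule inj) (use D in \<open>simp_all add: D_def algebra_simps\<close>)
    ultimately show False using inj[of 1 0] by simp
  qed
  define x y where "x = (\<alpha> * Qb - \<beta> * Qa) / D" and "y = (\<beta> * Pa - \<alpha> * Pb) / D"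
  have "x * Pa + y * Qa = \<alpha> * D / D" "x * Pb + y * Qb = \<beta> * D / D"
    unfolding x_def y_def times_divide_eq_left add_divide_distrib[symmetric] by (simp_all add: D_def algebra_simps)
  then have "b0 (\<lambda>t. x * \<theta> t + y * \<phi> t) (end_a S) = \<alpha>" "b0 (\<lambda>t. x * \<theta> t + y * \<phi> t) (end_b S) = \<beta>"
    using bl \<open>D \<noteq> 0\<close> by simp_all
  then show ?thesis using solves_lincomb[OF s] by blast
qed

lemma resolvent_unique:
  assumes z: "Im z \<noteq> 0" and g: "is_resolvent_of S (T_00 S w2) z f g" and h: "is_resolvent_of S (T_00 S w2) z f h"
  shows "L2_eq S h g"
proof -
  obtain gw where gw: "(g, gw) \<in> T_00 S w2" "L2_eq S (\<lambda>x. gw x - z * g x) f"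
    using g by (auto simp: is_resolvent_of_def)
  obtain hw where hw: "(h, hw) \<in> T_00 S w2" "L2_eq S (\<lambda>x. hw x - z * h x) f"
    using h by (auto simp: is_resolvent_of_def)
  have T: "(h, hw) \<in> T_max S" "(g, gw) \<in> T_max S" using gw hw by (auto simp: T_00_iff)
  have "(\<lambda>x. 1 * h x + (-1) * g x, \<lambda>x. 1 * hw x + (-1) * gw x) \<in> T_00 S w2"
    using T_max_lincomb[OF T, of 1 "-1"] bval_lincomb(1)[OF T is_end(1), of 1 "-1"]
      bval_lincomb(1)[OF T is_end(2), of 1 "-1"] gw(1) hw(1) by (simp add: T_00_iff)
  moreover have "L2_eq S (\<lambda>x. (1 * hw x + (-1) * gw x) - z * (1 * h x + (-1) * g x)) (\<lambda>x. 0)"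
    using gw(2) hw(2) unfolding L2_eq_def by eventually_elim (simp add: algebra_simps)
  ultimately have "AE x in \<mu>. 1 * h x + (-1) * g x = 0" using z by (rule T_00_injective)
  then show ?thesis unfolding L2_eq_def by eventually_elim simp
qed

text \<open>Any solution of the inhomogeneous equation is square integrable; subtracting the solution of
  the homogeneous equation with the same boundary values gives the resolvent.\<close>

lemma resolvent_exists:
  assumes z: "Im z \<noteq> 0" and f: "f \<in> L2 S"
  shows "\<exists>g. is_resolvent_of S (T_00 S w2) z f g"
proof -
  obtain c where c: "c \<in> J" using J_nonempty by blast
  obtain g0 where g0: "tau_eq S g0 (\<lambda>x. z * g0 x + f x)"
    using initial_value_exists[OF locally_integrable_r_L2[OF f] c] by blast
  have g0L: "g0 \<in> L2 S" by (rule inhomogeneous_solution_L2[OF g0 f])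
  have T0: "(g0, \<lambda>x. z * g0 x + f x) \<in> T_max S"
    using g0 g0L L2_lincomb[OF g0L f, of z 1] by (simp add: T_max_def)
  obtain u where u: "solves S z u" "b0 u (end_a S) = b0 g0 (end_a S)" "b0 u (end_b S) = b0 g0 (end_b S)"
    using solution_with_bvals[OF z] by blast
  note Tu = solves_T_max[OF u(1)]
  have "(\<lambda>x. 1 * g0 x + (-1) * u x, \<lambda>x. 1 * (z * g0 x + f x) + (-1) * (z * u x)) \<in> T_00 S w2"
    using T_max_lincomb[OF T0 Tu, of 1 "-1"] bval_lincomb(1)[OF T0 Tu is_end(1), of 1 "-1"]
      bval_lincomb(1)[OF T0 Tu is_end(2), of 1 "-1"] u by (simp add: T_00_iff)
  moreover have "L2_eq S (\<lambda>x. (1 * (z * g0 x + f x) + (-1) * (z * u x)) - z * (1 * g0 x + (-1) * u x)) f"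
    unfolding L2_eq_def by (simp add: algebra_simps)
  ultimately show ?thesis unfolding is_resolvent_of_def by blast
qed

theorem nonreal_in_resolvent_set:
  assumes z: "Im z \<noteq> 0"
  shows "z \<in> resolvent_set S (T_00 S w2)"
  unfolding resolvent_set_def
proof (intro CollectI conjI ballI)
  fix f assume "f \<in> L2 S"
  then show "\<exists>g. is_resolvent_of S (T_00 S w2) z f g \<and> (\<forall>h. is_resolvent_of S (T_00 S w2) z f h \<longrightarrow> L2_eq S h g)"
    using resolvent_exists[OF z] resolvent_unique[OF z] by blast
next
  have "L2_norm S g \<le> inverse \<bar>Im z\<bar> * L2_norm S f"
    if f: "f \<in> L2 S" and g: "is_resolvent_of S (T_00 S w2) z f g" for f g
  proof -
    obtain gw where "(g, gw) \<in> T_00 S w2" "L2_eq S (\<lambda>x. gw x - z * g x) f"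
      using g by (auto simp: is_resolvent_of_def)
    from T_00_estimate[OF this(1) f this(2)] z show ?thesis by (simp add: field_simps)
  qed
  then show "\<exists>C. \<forall>f\<in>L2 S. \<forall>g. is_resolvent_of S (T_00 S w2) z f g \<longrightarrow> L2_norm S g \<le> C * L2_norm S f"
    by blast
qed

end

section \<open>The Donoghue m-function\<close>

text \<open>For every nonreal \<open>z\<close> the parameter \<open>u\<close> supplies two solutions, \<open>u 1 z\<close> and \<open>u 2 z\<close>, with
  generalized boundary values \<open>(0, 1)\<close> and \<open>(1, 0)\<close> at \<open>(a, b)\<close>.\<close>

locale donoghue_setup = limit_circle_problem +
  fixes u :: "nat \<Rightarrow> complex \<Rightarrow> real \<Rightarrow> complex"
  assumes u1: "\<And>z. Im z \<noteq> 0 \<Longrightarrow> solves S z (u 1 z) \<and> b0 (u 1 z) (end_a S) = 0 \<and> b0 (u 1 z) (end_b S) = 1"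
    and u2: "\<And>z. Im z \<noteq> 0 \<Longrightarrow> solves S z (u 2 z) \<and> b0 (u 2 z) (end_a S) = 1 \<and> b0 (u 2 z) (end_b S) = 0"
begin

abbreviation "N \<equiv> deficiency_space S \<i>"
abbreviation "ua j z \<equiv> b1 (u j z) (end_a S)"
abbreviation "ub j z \<equiv> b1 (u j z) (end_b S)"

lemma deficiency_space_iff: "f \<in> N \<longleftrightarrow> solves S \<i> f"
proof
  assume "f \<in> N"
  then obtain w where w: "(f, w) \<in> T_max S" "L2_eq S (\<lambda>x. w x - \<i> * f x) (\<lambda>x. 0)"
    by (auto simp: deficiency_space_def op_kernel_def)
  have "AE x in lebesgue_on J. w x - \<i> * f x = 0" using w(2) by (simp add: L2_eq_def AE_wmeasure)
  then have "AE x in lebesgue_on J. w x = \<i> * f x" by eventually_elim simp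
  then show "solves S \<i> f"
    unfolding solves_def by (rule tau_eq_cong(1)[OF T_maxD(3)[OF w(1)] refl])
next
  assume "solves S \<i> f"
  from solves_T_max[OF this] show "f \<in> N"
    unfolding deficiency_space_def op_kernel_def by (auto simp: L2_eq_def)
qed

text \<open>The solution for the parameter \<open>z\<close> with the boundary values of \<open>f\<close>.\<close>

definition ext :: "complex \<Rightarrow> (real \<Rightarrow> complex) \<Rightarrow> real \<Rightarrow> complex" where
  "ext z f = (\<lambda>x. b0 f (end_b S) * u 1 z x + b0 f (end_a S) * u 2 z x)"

lemma ext_solves: "Im z \<noteq> 0 \<Longrightarrow> solves S z (ext z f)"
  unfolding ext_def using u1 u2 solves_lincomb by blast

lemma ext_bval:
  assumes "Im z \<noteq> 0"
  shows "b0 (ext z f) (end_a S) = b0 f (end_a S)" "b0 (ext z f) (end_b S) = b0 f (end_b S)"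
proof -
  note T = solves_T_max[OF conjunct1[OF u1[OF assms]]] solves_T_max[OF conjunct1[OF u2[OF assms]]]
  show "b0 (ext z f) (end_a S) = b0 f (end_a S)" "b0 (ext z f) (end_b S) = b0 f (end_b S)"
    unfolding ext_def bval_lincomb(1)[OF T is_end(1)] bval_lincomb(1)[OF T is_end(2)]
    using u1[OF assms] u2[OF assms] by simp_all
qed

lemma ext_bval':
  assumes "Im z \<noteq> 0" "is_end F"
  shows "b1 (ext z f) F = b0 f (end_b S) * b1 (u 1 z) F + b0 f (end_a S) * b1 (u 2 z) F"
  unfolding ext_def
  by (rule bval_lincomb(2)[OF solves_T_max[OF conjunct1[OF u1[OF assms(1)]]] solves_T_max[OF conjunct1[OF u2[OF assms(1)]]] assms(2)])

text \<open>Green's formula for two solutions.\<close>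

lemma inner_solutions:
  assumes f: "solves S \<i> f" and g: "solves S z g"
  shows "- (z + \<i>) * L2_inner S f g
    = (cnj (b0 f (end_b S)) * b1 g (end_b S) - cnj (b1 f (end_b S)) * b0 g (end_b S))
    - (cnj (b0 f (end_a S)) * b1 g (end_a S) - cnj (b1 f (end_a S)) * b0 g (end_a S))"
proof -
  note Tf = solves_T_max[OF f] and Tg = solves_T_max[OF g]
  note Tc = T_max_cnj[OF Tf]
  have W: "wronskian_at S (\<lambda>x. cnj (f x)) g F = cnj (b0 f F) * b1 g F - cnj (b1 f F) * b0 g F" if "is_end F" for F
    unfolding wronskian_at_bval[OF Tc Tg that] bval_cnj[OF Tf that] ..
  have "(\<integral>x. cnj (\<i> * f x) * g x - cnj (f x) * (z * g x) \<partial>\<mu>) = (\<integral>x. - (z + \<i>) * (cnj (f x) * g x) \<partial>\<mu>)"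
    by (rule Bochner_Integration.integral_cong) (simp_all add: algebra_simps)
  also have "\<dots> = - (z + \<i>) * L2_inner S f g" unfolding L2_inner_def by simp
  finally show ?thesis using wronskian_limits(2)[OF Tc Tg] W by simp
qed

lemma u_i: "solves S \<i> (u 1 \<i>)" "solves S \<i> (u 2 \<i>)"
  using u1[of \<i>] u2[of \<i>] by simp_all

lemma cnj_u:
  assumes F: "is_end F"
  shows "cnj (b1 (u 1 \<i>) F) = b1 (u 1 (-\<i>)) F" "cnj (b1 (u 2 \<i>) F) = b1 (u 2 (-\<i>)) F"
proof -
  note T = solves_T_max[OF u_i(1)] solves_T_max[OF u_i(2)]
  have s: "solves S (-\<i>) (\<lambda>x. cnj (u 1 \<i> x))" "solves S (-\<i>) (\<lambda>x. cnj (u 2 \<i> x))"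
    using solves_cnj[OF u_i(1)] solves_cnj[OF u_i(2)] by simp_all
  have m: "solves S (-\<i>) (u 1 (-\<i>))" "solves S (-\<i>) (u 2 (-\<i>))" using u1[of "-\<i>"] u2[of "-\<i>"] by simp_all
  have e1: "cnj (u 1 \<i> x) = u 1 (-\<i>) x" if "x \<in> J" for x
    using that u1[of \<i>] u1[of "-\<i>"]
    by (intro solution_eq[OF s(1) m(1)]) (simp_all add: bval_cnj(1)[OF T(1)] del: One_nat_def)
  have e2: "cnj (u 2 \<i> x) = u 2 (-\<i>) x" if "x \<in> J" for x
    using that u2[of \<i>] u2[of "-\<i>"]
    by (intro solution_eq[OF s(2) m(2)]) (simp_all add: bval_cnj(1)[OF T(2)] del: One_nat_def)
  show "cnj (b1 (u 1 \<i>) F) = b1 (u 1 (-\<i>)) F"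
    unfolding bval_cnj(2)[OF T(1) F, symmetric] by (rule bval_cong(2)[OF T_max_cnj[OF T(1)] F e1])
  show "cnj (b1 (u 2 \<i>) F) = b1 (u 2 (-\<i>)) F"
    unfolding bval_cnj(2)[OF T(2) F, symmetric] by (rule bval_cong(2)[OF T_max_cnj[OF T(2)] F e2])
qed

text \<open>The Wronskian of two solutions for the same \<open>z\<close> takes the same value at both endpoints.\<close>

lemma ub2_eq_ua1:
  assumes "Im z \<noteq> 0"
  shows "ub 2 z = - ua 1 z"
proof -
  note T = solves_T_max[OF conjunct1[OF u1[OF assms]]] solves_T_max[OF conjunct1[OF u2[OF assms]]]
  have "(\<integral>x. z * u 1 z x * u 2 z x - u 1 z x * (z * u 2 z x) \<partial>\<mu>) = 0"
    by (simp add: algebra_simps)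
  then have "wronskian_at S (u 1 z) (u 2 z) (end_b S) = wronskian_at S (u 1 z) (u 2 z) (end_a S)"
    using wronskian_limits(2)[OF T] by simp
  then show ?thesis
    unfolding wronskian_at_bval[OF T is_end(1)] wronskian_at_bval[OF T is_end(2)]
    using u1[OF assms] u2[OF assms] by simp
qed

text \<open>The Gram--Schmidt process for \<open>u 1 \<i>\<close>, \<open>u 2 \<i>\<close>: the second vector before normalization is \<open>e2\<close>,
  the normalizing constants are \<open>c1\<close>, \<open>c2\<close>, and the result is \<open>v1\<close>, \<open>v2\<close>.\<close>

definition "\<kappa> = Im (ub 2 \<i>) / Im (ub 1 \<i>)"
definition "e2 = (\<lambda>x. u 2 \<i> x - of_real \<kappa> * u 1 \<i> x)"
definition "c1 = inverse (L2_norm S (u 1 \<i>))"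
definition "c2 = inverse (L2_norm S e2)"
definition "v1 = (\<lambda>x. of_real c1 * u 1 \<i> x)"
definition "v2 = (\<lambda>x. of_real c2 * e2 x)"

lemma e2_solves: "solves S \<i> e2"
  using solves_lincomb[OF u_i(2,1), of 1 "- of_real \<kappa>"] by (simp add: e2_def)

lemma v_solves: "solves S \<i> v1" "solves S \<i> v2"
  using solves_lincomb[OF u_i(1,1), of "of_real c1" 0] solves_lincomb[OF e2_solves e2_solves, of "of_real c2" 0]
  by (simp_all add: v1_def v2_def)

lemma e2_bval:
  assumes "is_end F"
  shows "b0 e2 F = b0 (u 2 \<i>) F - of_real \<kappa> * b0 (u 1 \<i>) F" "b1 e2 F = b1 (u 2 \<i>) F - of_real \<kappa> * b1 (u 1 \<i>) F"
  using bval_lincomb[OF solves_T_max[OF u_i(2)] solves_T_max[OF u_i(1)] assms, of 1 "- of_real \<kappa>"]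
  by (simp_all add: e2_def)

lemma v_bval:
  assumes "is_end F"
  shows "b0 v1 F = of_real c1 * b0 (u 1 \<i>) F" "b1 v1 F = of_real c1 * b1 (u 1 \<i>) F"
    "b0 v2 F = of_real c2 * (b0 (u 2 \<i>) F - of_real \<kappa> * b0 (u 1 \<i>) F)"
    "b1 v2 F = of_real c2 * (b1 (u 2 \<i>) F - of_real \<kappa> * b1 (u 1 \<i>) F)"
  using bval_lincomb[OF solves_T_max[OF u_i(1)] solves_T_max[OF u_i(1)] assms, of "of_real c1" 0]
    bval_lincomb[OF solves_T_max[OF e2_solves] solves_T_max[OF e2_solves] assms, of "of_real c2" 0]
  by (simp_all add: v1_def v2_def e2_bval[OF assms])

lemma norm_pos:
  assumes f: "solves S z f" and F: "is_end F" and "b0 f F \<noteq> 0"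
  shows "L2_norm S f > 0"
proof (rule ccontr)
  assume "\<not> L2_norm S f > 0"
  then have "L2_norm S f = 0" using L2_norm_nonneg[of f] by simp
  then have ae: "AE x in \<mu>. f x = 0" using L2_norm_eq_0 solves_L2[OF f] by blast
  have f0: "f x = 0" if "x \<in> J" for x
    by (rule AE_eq_on_J[OF ae solves_continuous_on[OF f] continuous_on_const that])
  have "b0 f F = b0 (\<lambda>x. 0 * f x + 0 * f x) F"
    by (rule bval_cong(1)[OF solves_T_max[OF f] F]) (simp add: f0)
  also have "\<dots> = 0" using bval_lincomb(1)[OF solves_T_max[OF f] solves_T_max[OF f] F, of 0 0] by simp
  finally show False using assms(3) by simp
qed

lemma u1_norm_pos: "L2_norm S (u 1 \<i>) > 0"
  using u1[of \<i>] by (intro norm_pos[OF u_i(1) is_end(2)]) simp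

lemma e2_norm_pos: "L2_norm S e2 > 0"
  using u1[of \<i>] u2[of \<i>] by (intro norm_pos[OF e2_solves is_end(1)]) (simp add: e2_bval)

lemma inner_u1_u1: "L2_inner S (u 1 \<i>) (u 1 \<i>) = - of_real (Im (ub 1 \<i>))"
proof -
  have "- (\<i> + \<i>) * L2_inner S (u 1 \<i>) (u 1 \<i>) = ub 1 \<i> - cnj (ub 1 \<i>)"
    unfolding inner_solutions[OF u_i(1,1)] using u1[of \<i>] by simp
  also have "\<dots> = - (\<i> + \<i>) * - of_real (Im (ub 1 \<i>))" by (simp add: complex_eq_iff)
  finally show ?thesis by (subst (asm) mult_cancel_left) (simp add: complex_eq_iff)
qed

lemma inner_u1_u2: "L2_inner S (u 1 \<i>) (u 2 \<i>) = - of_real (Im (ub 2 \<i>))"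
proof -
  have ua: "ua 1 \<i> = - ub 2 \<i>" using ub2_eq_ua1[of \<i>] by simp
  have "- (\<i> + \<i>) * L2_inner S (u 1 \<i>) (u 2 \<i>) = ub 2 \<i> - cnj (ub 2 \<i>)"
    unfolding inner_solutions[OF u_i(1,2)] using u1[of \<i>] u2[of \<i>] ua by simp
  also have "\<dots> = - (\<i> + \<i>) * - of_real (Im (ub 2 \<i>))" by (simp add: complex_eq_iff)
  finally show ?thesis by (subst (asm) mult_cancel_left) (simp add: complex_eq_iff)
qed

text \<open>The coefficient \<open>\<kappa>\<close> is the one of the Gram--Schmidt process.\<close>

lemma inner_u1_e2: "L2_inner S (u 1 \<i>) e2 = 0"
proof -
  have ne: "Im (ub 1 \<i>) \<noteq> 0"
    using inner_u1_u1 u1_norm_pos by (auto simp: L2_inner_self)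
  have "L2_inner S (u 1 \<i>) e2 = L2_inner S (u 1 \<i>) (\<lambda>x. 1 * u 2 \<i> x + (- of_real \<kappa>) * u 1 \<i> x)"
    by (simp add: e2_def)
  also have "\<dots> = - of_real (Im (ub 2 \<i>)) + of_real \<kappa> * of_real (Im (ub 1 \<i>))"
    unfolding L2_inner_lincomb[OF solves_L2[OF u_i(1)] solves_L2[OF u_i(2)] solves_L2[OF u_i(1)]] inner_u1_u1 inner_u1_u2
    by simp
  also have "\<dots> = 0" using ne by (simp add: \<kappa>_def)
  finally show ?thesis .
qed

lemma v_L2: "v1 \<in> L2 S" "v2 \<in> L2 S"
  using v_solves solves_L2 by blast+

lemma v_orthonormal:
  "L2_inner S v1 v1 = 1" "L2_inner S v2 v2 = 1" "L2_inner S v1 v2 = 0" "L2_inner S v2 v1 = 0"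
proof -
  note L = solves_L2[OF u_i(1)] solves_L2[OF e2_solves]
  note sc = L2_scale[OF L(1), of "of_real c1"] L2_scale[OF L(2), of "of_real c2"]
  have "c1 * L2_norm S (u 1 \<i>) = 1" "c2 * L2_norm S e2 = 1"
    using u1_norm_pos e2_norm_pos by (simp_all add: c1_def c2_def)
  then have n: "(c1 * L2_norm S (u 1 \<i>))\<^sup>2 = 1" "(c2 * L2_norm S e2)\<^sup>2 = 1" by simp_all
  have "L2_inner S v1 v1 = of_real ((c1 * L2_norm S (u 1 \<i>))\<^sup>2)"
    unfolding v1_def L2_inner_scale(2)[OF L(1) sc(1)] L2_inner_scale(1)[OF L(1,1)] L2_inner_self
    by (simp add: power2_eq_square)
  then show "L2_inner S v1 v1 = 1" unfolding n by simp
  have "L2_inner S v2 v2 = of_real ((c2 * L2_norm S e2)\<^sup>2)"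
    unfolding v2_def L2_inner_scale(2)[OF L(2) sc(2)] L2_inner_scale(1)[OF L(2,2)] L2_inner_self
    by (simp add: power2_eq_square)
  then show "L2_inner S v2 v2 = 1" unfolding n by simp
  show "L2_inner S v1 v2 = 0"
    unfolding v1_def v2_def L2_inner_scale(2)[OF L(1) sc(2)] L2_inner_scale(1)[OF L(1,2)] inner_u1_e2 by simp
  then show "L2_inner S v2 v1 = 0" using L2_inner_cnj[of v1 v2] by simp
qed

lemma inner_v_lincomb:
  assumes f: "f \<in> L2 S" and eq: "\<And>x. x \<in> J \<Longrightarrow> f x = \<alpha> * v1 x + \<beta> * v2 x"
  shows "L2_inner S v1 f = \<alpha>" "L2_inner S v2 f = \<beta>" "(L2_norm S f)\<^sup>2 = (cmod \<alpha>)\<^sup>2 + (cmod \<beta>)\<^sup>2"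
proof -
  define g where "g = (\<lambda>x. \<alpha> * v1 x + \<beta> * v2 x)"
  have g: "g \<in> L2 S" unfolding g_def by (rule L2_lincomb[OF v_L2])
  have fg: "AE x in \<mu>. f x = g x" by (rule AE_wmeasure_I) (simp add: eq g_def)
  have g1: "L2_inner S v1 g = \<alpha>" "L2_inner S v2 g = \<beta>"
    unfolding g_def L2_inner_lincomb[OF v_L2(1) v_L2] L2_inner_lincomb[OF v_L2(2) v_L2] v_orthonormal by simp_all
  show "L2_inner S v1 f = \<alpha>" "L2_inner S v2 f = \<beta>"
    using AE_L2_inner_cong[OF _ fg v_L2(1) v_L2(1) f g] AE_L2_inner_cong[OF _ fg v_L2(2) v_L2(2) f g] g1 by simp_all
  have "L2_inner S f f = L2_inner S g g" by (rule AE_L2_inner_cong[OF fg fg f g f g])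
  also have "\<dots> = cnj \<alpha> * \<alpha> + cnj \<beta> * \<beta>"
    by (subst (1) g_def, subst L2_inner_lincomb_left[OF g v_L2]) (simp add: g1)
  also have "\<dots> = of_real ((cmod \<alpha>)\<^sup>2 + (cmod \<beta>)\<^sup>2)"
    by (simp add: complex_norm_square mult.commute flip: of_real_power)
  finally show "(L2_norm S f)\<^sup>2 = (cmod \<alpha>)\<^sup>2 + (cmod \<beta>)\<^sup>2"
    unfolding L2_inner_self of_real_eq_iff .
qed

text \<open>The coefficients \<open>\<alpha>\<close>, \<open>\<beta>\<close> below are those for which both sides have equal boundary values.\<close>

lemma N_expansion:
  assumes f: "f \<in> N" and x: "x \<in> J"
  shows "f x = L2_inner S v1 f * v1 x + L2_inner S v2 f * v2 x"
proof -
  have sf: "solves S \<i> f" using f by (simp add: deficiency_space_iff)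
  have c: "c1 > 0" "c2 > 0" using u1_norm_pos e2_norm_pos by (simp_all add: c1_def c2_def)
  define \<beta> where "\<beta> = b0 f (end_a S) / of_real c2"
  define \<alpha> where "\<alpha> = (b0 f (end_b S) + of_real \<kappa> * b0 f (end_a S)) / of_real c1"
  have eq: "f t = \<alpha> * v1 t + \<beta> * v2 t" if t: "t \<in> J" for t
  proof (rule solution_eq[OF sf solves_lincomb[OF v_solves] _ _ _ t])
    note T = solves_T_max[OF v_solves(1)] solves_T_max[OF v_solves(2)]
    show "b0 f (end_a S) = b0 (\<lambda>t. \<alpha> * v1 t + \<beta> * v2 t) (end_a S)"
      unfolding bval_lincomb(1)[OF T is_end(1)] v_bval[OF is_end(1)]
      using u1[of \<i>] u2[of \<i>] c by (simp add: \<beta>_def)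
    show "b0 f (end_b S) = b0 (\<lambda>t. \<alpha> * v1 t + \<beta> * v2 t) (end_b S)"
      unfolding bval_lincomb(1)[OF T is_end(2)] v_bval[OF is_end(2)]
      using u1[of \<i>] u2[of \<i>] c by (simp add: \<alpha>_def \<beta>_def)
  qed simp
  show ?thesis
    using eq[OF x] inner_v_lincomb[OF solves_L2[OF sf] eq] by simp
qed

lemma orth_proj_N:
  assumes g: "g \<in> L2 S"
  shows "orth_proj S N g \<in> N"
    "x \<in> J \<Longrightarrow> orth_proj S N g x = L2_inner S v1 g * v1 x + L2_inner S v2 g * v2 x"
proof -
  define h where "h = (\<lambda>x. L2_inner S v1 g * v1 x + L2_inner S v2 g * v2 x)"
  have hs: "solves S \<i> h" unfolding h_def by (rule solves_lincomb[OF v_solves])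
  have hL: "h \<in> L2 S" by (rule solves_L2[OF hs])
  have hi: "L2_inner S v1 h = L2_inner S v1 g" "L2_inner S v2 h = L2_inner S v2 g"
    using inner_v_lincomb(1,2)[OF hL, of "L2_inner S v1 g" "L2_inner S v2 g"] by (simp_all add: h_def)
  have orth: "L2_inner S n (\<lambda>x. g x - h x) = 0" if n: "n \<in> N" for n
  proof -
    have nL: "n \<in> L2 S" using n solves_L2 by (simp add: deficiency_space_iff)
    have gh: "(\<lambda>x. g x - h x) \<in> L2 S" by (rule L2_diff[OF g hL])
    have z: "L2_inner S w (\<lambda>x. g x - h x) = L2_inner S w g - L2_inner S w h" if "w \<in> L2 S" for w
      using L2_inner_lincomb[OF that g hL, of 1 "-1"] by simp
    define m where "m = (\<lambda>x. L2_inner S v1 n * v1 x + L2_inner S v2 n * v2 x)"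
    have mL: "m \<in> L2 S" unfolding m_def by (rule L2_lincomb[OF v_L2])
    have nm: "AE x in \<mu>. n x = m x"
      by (rule AE_wmeasure_I) (simp add: m_def N_expansion[OF n])
    have "L2_inner S n (\<lambda>x. g x - h x) = L2_inner S m (\<lambda>x. g x - h x)"
      by (rule AE_L2_inner_cong[OF nm _ nL mL gh gh]) simp
    also have "\<dots> = 0"
      unfolding m_def L2_inner_lincomb_left[OF gh v_L2] z[OF v_L2(1)] z[OF v_L2(2)] hi by simp
    finally show ?thesis .
  qed
  have "h \<in> N \<and> (\<forall>n\<in>N. L2_inner S n (\<lambda>x. g x - h x) = 0)"
    using hs orth by (simp add: deficiency_space_iff)
  then have "\<exists>h. h \<in> N \<and> (\<forall>n\<in>N. L2_inner S n (\<lambda>x. g x - h x) = 0)" by blast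
  then have P: "orth_proj S N g \<in> N \<and> (\<forall>n\<in>N. L2_inner S n (\<lambda>x. g x - orth_proj S N g x) = 0)"
    unfolding orth_proj_def by (rule someI_ex)
  then show PN: "orth_proj S N g \<in> N" by blast
  have PL: "orth_proj S N g \<in> L2 S" using PN solves_L2 by (simp add: deficiency_space_iff)
  have vi: "L2_inner S w (orth_proj S N g) = L2_inner S w g" if w: "solves S \<i> w" for w
  proof -
    have "L2_inner S w (\<lambda>x. g x - orth_proj S N g x) = 0"
      using P w by (simp add: deficiency_space_iff)
    then show ?thesis using L2_inner_lincomb[OF solves_L2[OF w] g PL, of 1 "-1"] by simp
  qed
  show "x \<in> J \<Longrightarrow> orth_proj S N g x = L2_inner S v1 g * v1 x + L2_inner S v2 g * v2 x"
    using N_expansion[OF PN] vi[OF v_solves(1)] vi[OF v_solves(2)] by simp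
qed

lemma resolvent_of:
  assumes z: "Im z \<noteq> 0" and f: "f \<in> L2 S"
  shows "is_resolvent_of S (T_00 S w2) z f (resolvent S (T_00 S w2) z f)"
    "resolvent S (T_00 S w2) z f \<in> L2 S"
proof -
  show 1: "is_resolvent_of S (T_00 S w2) z f (resolvent S (T_00 S w2) z f)"
    unfolding resolvent_def using resolvent_exists[OF z f] by (rule someI_ex)
  then show "resolvent S (T_00 S w2) z f \<in> L2 S"
    unfolding is_resolvent_of_def T_00_iff using T_maxD(1) by blast
qed

text \<open>On the deficiency space the resolvent is explicit: \<open>f\<close> and \<open>ext z f\<close> have the same boundary
  values and are eigenfunctions of \<open>\<tau>\<close> for \<open>\<i>\<close> and \<open>z\<close>.\<close>

lemma resolvent_N:
  assumes z: "Im z \<noteq> 0" "z \<noteq> \<i>" and f: "f \<in> N"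
  shows "is_resolvent_of S (T_00 S w2) z f (\<lambda>x. (f x - ext z f x) / (\<i> - z))"
proof -
  have sf: "solves S \<i> f" using f by (simp add: deficiency_space_iff)
  note Tf = solves_T_max[OF sf] and Te = solves_T_max[OF ext_solves[OF z(1)]]
  define \<gamma> where "\<gamma> = 1 / (\<i> - z)"
  have g: "\<gamma> * (\<i> - z) = 1" using z(2) by (simp add: \<gamma>_def)
  have T: "(\<lambda>x. \<gamma> * f x + (-\<gamma>) * ext z f x, \<lambda>x. \<gamma> * (\<i> * f x) + (-\<gamma>) * (z * ext z f x)) \<in> T_00 S w2"
    unfolding T_00_iff bval_lincomb(1)[OF Tf Te is_end(1)] bval_lincomb(1)[OF Tf Te is_end(2)] ext_bval[OF z(1)]
    using T_max_lincomb[OF Tf Te, of \<gamma> "-\<gamma>" f] by simp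
  have eq: "(\<lambda>x. (\<gamma> * (\<i> * f x) + (-\<gamma>) * (z * ext z f x)) - z * (\<gamma> * f x + (-\<gamma>) * ext z f x)) = f"
  proof
    fix x
    have "(\<gamma> * (\<i> * f x) + (-\<gamma>) * (z * ext z f x)) - z * (\<gamma> * f x + (-\<gamma>) * ext z f x) = (\<gamma> * (\<i> - z)) * f x"
      by (simp add: algebra_simps)
    then show "(\<gamma> * (\<i> * f x) + (-\<gamma>) * (z * ext z f x)) - z * (\<gamma> * f x + (-\<gamma>) * ext z f x) = f x"
      unfolding g by simp
  qed
  have h: "(\<lambda>x. (f x - ext z f x) / (\<i> - z)) = (\<lambda>x. \<gamma> * f x + (-\<gamma>) * ext z f x)"
    by (simp add: \<gamma>_def fun_eq_iff diff_divide_distrib)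
  show ?thesis
    unfolding is_resolvent_of_def h 
    by (intro exI conjI, rule T) (simp only: L2_eq_def fun_cong[OF eq], simp)
qed

abbreviation "M \<equiv> donoghue_m S (T_00 S w2) N"

lemma M_maps_N:
  assumes z: "Im z \<noteq> 0" and f: "f \<in> N"
  shows "M z f \<in> N"
proof -
  have sf: "solves S \<i> f" using f by (simp add: deficiency_space_iff)
  have "orth_proj S N f \<in> N" by (rule orth_proj_N(1)[OF solves_L2[OF sf]])
  then have "orth_proj S N f \<in> L2 S" using solves_L2 by (simp add: deficiency_space_iff)
  then have "solves S \<i> (orth_proj S N (resolvent S (T_00 S w2) z (orth_proj S N f)))"
    using orth_proj_N(1)[OF resolvent_of(2)[OF z]] by (simp add: deficiency_space_iff)
  from solves_lincomb[OF sf this] show ?thesis unfolding donoghue_m_def deficiency_space_iff .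
qed

text \<open>The sesquilinear form whose values on the basis vectors are the entries \<open>W\<^sub>j\<^sub>k(z)\<close>; Green's
  formula turns it into a boundary form.\<close>

definition Wform :: "complex \<Rightarrow> (real \<Rightarrow> complex) \<Rightarrow> (real \<Rightarrow> complex) \<Rightarrow> complex" where
  "Wform z f g = - (z + \<i>) * L2_inner S f (ext z g)"

lemma M_formula:
  assumes z: "Im z \<noteq> 0" "z \<noteq> \<i>" and f: "f \<in> N" and x: "x \<in> J"
  shows "M z f x = - \<i> * f x
    - ((Wform z v1 v1 * L2_inner S v1 f + Wform z v1 v2 * L2_inner S v2 f) * v1 x
     + (Wform z v2 v1 * L2_inner S v1 f + Wform z v2 v2 * L2_inner S v2 f) * v2 x)"
proof -
  have sf: "solves S \<i> f" using f by (simp add: deficiency_space_iff)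
  have fL: "f \<in> L2 S" by (rule solves_L2[OF sf])
  define fp where "fp = orth_proj S N f"
  have fpN: "fp \<in> N" unfolding fp_def by (rule orth_proj_N(1)[OF fL])
  have fpf: "fp t = f t" if "t \<in> J" for t
    unfolding fp_def orth_proj_N(2)[OF fL that] using N_expansion[OF f that] by simp
  have sp: "solves S \<i> fp" using fpN by (simp add: deficiency_space_iff)
  have fpL: "fp \<in> L2 S" by (rule solves_L2[OF sp])
  have "b0 fp F = b0 f F" if "is_end F" for F
    by (rule bval_cong(1)[OF solves_T_max[OF sp] that fpf])
  then have ext_fp: "ext z fp = ext z f" by (simp add: ext_def)
  have eL: "ext z g \<in> L2 S" for g by (rule solves_L2[OF ext_solves[OF z(1)]])
  \<comment> \<open>The projection \<open>fp\<close> of \<open>f\<close> agrees with \<open>f\<close> on \<open>J\<close> only; the values outside are unspecified.\<close>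
  define R where "R = resolvent S (T_00 S w2) z fp"
  define \<gamma> where "\<gamma> = 1 / (\<i> - z)"
  define h where "h = (\<lambda>x. \<gamma> * fp x + (-\<gamma>) * ext z f x)"
  have hL: "h \<in> L2 S" unfolding h_def by (rule L2_lincomb[OF fpL eL])
  have RL: "R \<in> L2 S" unfolding R_def by (rule resolvent_of(2)[OF z(1) fpL])
  have "(\<lambda>x. (fp x - ext z fp x) / (\<i> - z)) = h"
    by (simp add: h_def \<gamma>_def fun_eq_iff diff_divide_distrib ext_fp)
  then have "is_resolvent_of S (T_00 S w2) z fp h"
    using resolvent_N[OF z fpN] by simp
  from resolvent_unique[OF z(1) this resolvent_of(1)[OF z(1) fpL]]
  have Rh: "AE x in \<mu>. R x = h x" by (simp add: L2_eq_def R_def)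
  have inner_R: "L2_inner S w R = \<gamma> * (L2_inner S w f - L2_inner S w (ext z f))" if w: "w \<in> L2 S" for w
  proof -
    have "AE x in \<mu>. fp x = f x" by (rule AE_wmeasure_I) (rule fpf)
    then have "L2_inner S w fp = L2_inner S w f" by (intro AE_L2_inner_cong w fpL fL) simp_all
    moreover have "L2_inner S w R = L2_inner S w h" by (rule AE_L2_inner_cong[OF _ Rh w w RL hL]) simp
    ultimately show ?thesis
      unfolding h_def L2_inner_lincomb[OF w fpL eL] by (simp add: algebra_simps)
  qed
  define a1 a2 where "a1 = L2_inner S v1 f" and "a2 = L2_inner S v2 f"
  have b0f: "b0 f F = a1 * b0 v1 F + a2 * b0 v2 F" if F: "is_end F" for F
  proof -
    have "b0 f F = b0 (\<lambda>x. a1 * v1 x + a2 * v2 x) F"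
      unfolding a1_def a2_def by (rule bval_cong(1)[OF solves_T_max[OF sf] F]) (rule N_expansion[OF f])
    then show ?thesis
      unfolding bval_lincomb(1)[OF solves_T_max[OF v_solves(1)] solves_T_max[OF v_solves(2)] F] .
  qed
  have ext_f: "ext z f = (\<lambda>x. a1 * ext z v1 x + a2 * ext z v2 x)"
    unfolding ext_def b0f[OF is_end(1)] b0f[OF is_end(2)] by (simp add: fun_eq_iff algebra_simps)
  have W: "(z + \<i>) * L2_inner S w (ext z f) = - (Wform z w v1 * a1 + Wform z w v2 * a2)" if "w \<in> L2 S" for w
    unfolding ext_f L2_inner_lincomb[OF that eL eL] Wform_def by (simp add: algebra_simps)
  have zg: "(z\<^sup>2 + 1) * \<gamma> = - (z + \<i>)"
  proof -
    have "z\<^sup>2 + 1 = - (z + \<i>) * (\<i> - z)" by (simp add: power2_eq_square algebra_simps)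
    then show ?thesis using z(2) by (simp add: \<gamma>_def)
  qed
  have "M z f x = z * f x + (z\<^sup>2 + 1) * (L2_inner S v1 R * v1 x + L2_inner S v2 R * v2 x)"
    unfolding donoghue_m_def fp_def[symmetric] R_def[symmetric] orth_proj_N(2)[OF RL x] ..
  also have "\<dots> = z * f x + ((z\<^sup>2 + 1) * \<gamma>) * ((a1 * v1 x + a2 * v2 x)
       - (L2_inner S v1 (ext z f) * v1 x + L2_inner S v2 (ext z f) * v2 x))"
    unfolding inner_R[OF v_L2(1)] inner_R[OF v_L2(2)] a1_def a2_def by (simp add: algebra_simps)
  also have "a1 * v1 x + a2 * v2 x = f x" unfolding a1_def a2_def by (rule N_expansion[OF f x, symmetric])
  also have "z * f x + ((z\<^sup>2 + 1) * \<gamma>) * (f x - (L2_inner S v1 (ext z f) * v1 x + L2_inner S v2 (ext z f) * v2 x))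
     = - \<i> * f x + (((z + \<i>) * L2_inner S v1 (ext z f)) * v1 x + ((z + \<i>) * L2_inner S v2 (ext z f)) * v2 x)"
    unfolding zg by (simp add: algebra_simps)
  also have "\<dots> = - \<i> * f x
    - ((Wform z v1 v1 * L2_inner S v1 f + Wform z v1 v2 * L2_inner S v2 f) * v1 x
     + (Wform z v2 v1 * L2_inner S v1 f + Wform z v2 v2 * L2_inner S v2 f) * v2 x)"
    unfolding W[OF v_L2(1)] W[OF v_L2(2)] a1_def a2_def by (simp add: algebra_simps)
  finally show ?thesis .
qed

lemma M_at_i:
  assumes "z\<^sup>2 + 1 = 0"
  shows "M z f = (\<lambda>x. z * f x)"
  unfolding donoghue_m_def assms by simp

theorem M_bounded:
  assumes z: "Im z \<noteq> 0"
  shows "bounded_op_on S N (M z)"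
  unfolding bounded_op_on_def
proof (intro conjI ballI allI)
  show "f \<in> N \<Longrightarrow> M z f \<in> N" for f by (rule M_maps_N[OF z])
next
  fix f g \<alpha> \<beta> assume f: "f \<in> N" and g: "g \<in> N"
  have fgL: "f \<in> L2 S" "g \<in> L2 S" using f g solves_L2 by (simp_all add: deficiency_space_iff)
  have fg: "(\<lambda>x. \<alpha> * f x + \<beta> * g x) \<in> N"
    using f g solves_lincomb by (simp add: deficiency_space_iff)
  show "L2_eq S (M z (\<lambda>x. \<alpha> * f x + \<beta> * g x)) (\<lambda>x. \<alpha> * M z f x + \<beta> * M z g x)"
  proof (cases "z\<^sup>2 + 1 = 0")
    case True
    then show ?thesis unfolding M_at_i[OF True] L2_eq_def by (simp add: algebra_simps)
  next
    case False
    then have zi: "z \<noteq> \<i>" by auto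
    show ?thesis
      unfolding L2_eq_def
    proof (rule AE_wmeasure_I)
      fix x assume x: "x \<in> J"
      show "M z (\<lambda>x. \<alpha> * f x + \<beta> * g x) x = \<alpha> * M z f x + \<beta> * M z g x"
        unfolding M_formula[OF z zi f x] M_formula[OF z zi g x] M_formula[OF z zi fg x]
          L2_inner_lincomb[OF v_L2(1) fgL] L2_inner_lincomb[OF v_L2(2) fgL]
        by (simp add: algebra_simps)
    qed
  qed
next
  show "\<exists>C. \<forall>f\<in>N. L2_norm S (M z f) \<le> C * L2_norm S f"
  proof (cases "z\<^sup>2 + 1 = 0")
    case True
    have "L2_norm S (M z f) = cmod z * L2_norm S f" for f
      unfolding M_at_i[OF True] L2_norm_def
      by (simp add: norm_mult power_mult_distrib real_sqrt_mult)
    then show ?thesis by (intro exI[of _ "cmod z"]) simp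
  next
    case False
    then have zi: "z \<noteq> \<i>" by auto
    define m11 m12 m21 m22 where "m11 = - \<i> - Wform z v1 v1" and "m12 = - Wform z v1 v2"
      and "m21 = - Wform z v2 v1" and "m22 = - \<i> - Wform z v2 v2"
    define C where "C = cmod m11 + cmod m12 + cmod m21 + cmod m22"
    have "L2_norm S (M z f) \<le> C * L2_norm S f" if f: "f \<in> N" for f
    proof -
      define a1 a2 where "a1 = L2_inner S v1 f" and "a2 = L2_inner S v2 f"
      have MN: "M z f \<in> L2 S" using M_maps_N[OF z f] solves_L2 by (simp add: deficiency_space_iff)
      have fL: "f \<in> L2 S" using f solves_L2 by (simp add: deficiency_space_iff)
      have "M z f x = (m11 * a1 + m12 * a2) * v1 x + (m21 * a1 + m22 * a2) * v2 x" if x: "x \<in> J" for x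
        unfolding M_formula[OF z zi f x]
        using N_expansion[OF f x] by (simp add: m11_def m12_def m21_def m22_def a1_def a2_def algebra_simps)
      from inner_v_lincomb(3)[OF MN this]
      have "L2_norm S (M z f) = sqrt ((cmod (m11 * a1 + m12 * a2))\<^sup>2 + (cmod (m21 * a1 + m22 * a2))\<^sup>2)"
        using L2_norm_nonneg[of "M z f"] by (metis real_sqrt_abs abs_of_nonneg)
      also have "\<dots> \<le> cmod (m11 * a1 + m12 * a2) + cmod (m21 * a1 + m22 * a2)"
        by (rule order_trans[OF sqrt_sum_squares_le_sum_abs]) simp
      also have "\<dots> \<le> (cmod m11 * cmod a1 + cmod m12 * cmod a2) + (cmod m21 * cmod a1 + cmod m22 * cmod a2)"
        by (intro add_mono order_trans[OF norm_triangle_ineq]) (simp_all add: norm_mult)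
      also have "\<dots> \<le> (cmod m11 * L2_norm S f + cmod m12 * L2_norm S f) + (cmod m21 * L2_norm S f + cmod m22 * L2_norm S f)"
      proof -
        have "(L2_norm S f)\<^sup>2 = (cmod a1)\<^sup>2 + (cmod a2)\<^sup>2"
          unfolding a1_def a2_def by (rule inner_v_lincomb(3)[OF fL N_expansion[OF f]])
        then have "(cmod a1)\<^sup>2 \<le> (L2_norm S f)\<^sup>2" "(cmod a2)\<^sup>2 \<le> (L2_norm S f)\<^sup>2" by simp_all
        then have "cmod a1 \<le> L2_norm S f" "cmod a2 \<le> L2_norm S f"
          using L2_norm_nonneg[of f] by (auto intro: power2_le_imp_le)
        then show ?thesis by (intro add_mono mult_left_mono) auto
      qed
      finally show ?thesis by (simp add: C_def algebra_simps)
    qed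
    then show ?thesis by blast
  qed
qed

lemma Wform_bval:
  assumes z: "Im z \<noteq> 0" and f: "solves S \<i> f"
  shows "Wform z f g
    = (cnj (b0 f (end_b S)) * b1 (ext z g) (end_b S) - cnj (b1 f (end_b S)) * b0 g (end_b S))
    - (cnj (b0 f (end_a S)) * b1 (ext z g) (end_a S) - cnj (b1 f (end_a S)) * b0 g (end_a S))"
  unfolding Wform_def inner_solutions[OF f ext_solves[OF z]] ext_bval[OF z] ..

lemma Wform_values:
  assumes z: "Im z \<noteq> 0"
  shows "Wform z v1 v1 = of_real c1 ^ 2 * (ub 1 z - ub 1 (-\<i>))" (is ?A)
    and "Wform z v1 v2 = of_real c1 * of_real c2 * (of_real \<kappa> * (ub 1 (-\<i>) - ub 1 z) + ub 2 z + ua 1 (-\<i>))" (is ?B)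
    and "Wform z v2 v1 = - (of_real c1 * of_real c2 * (of_real \<kappa> * (ub 1 z - ub 1 (-\<i>)) + ub 2 (-\<i>) + ua 1 z))" (is ?C)
    and "Wform z v2 v2 = of_real c2 ^ 2 * ((ub 2 (-\<i>) - ub 2 z + of_real \<kappa> * (ub 1 z - ub 1 (-\<i>))) * of_real \<kappa>
                 + ua 2 (-\<i>) - ua 2 z + of_real \<kappa> * (ua 1 z - ua 1 (-\<i>)))" (is ?D)
proof -
  note b = u1[of \<i>, simplified, THEN conjunct2] u2[of \<i>, simplified, THEN conjunct2]
  note ev = v_bval[OF is_end(1)] v_bval[OF is_end(2)] ext_bval'[OF z is_end(1)] ext_bval'[OF z is_end(2)]
    cnj_u[OF is_end(1), symmetric] cnj_u[OF is_end(2), symmetric]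
  show ?A ?B ?C ?D
    unfolding Wform_bval[OF z v_solves(1)] Wform_bval[OF z v_solves(2)] ev
    using b by (simp_all add: power2_eq_square algebra_simps)
qed

end

theorem theorem6p1:
  fixes S :: sl_problem
    and w1 w2 :: "real \<Rightarrow> complex"
    and u :: "nat \<Rightarrow> complex \<Rightarrow> real \<Rightarrow> complex"
    and v :: "nat \<Rightarrow> real \<Rightarrow> complex"
    and c :: "nat \<Rightarrow> real"
    and \<kappa> :: real
    and W :: "nat \<Rightarrow> nat \<Rightarrow> complex \<Rightarrow> complex"
    and ua' ub' :: "nat \<Rightarrow> complex \<Rightarrow> complex"
    and N :: "(real \<Rightarrow> complex) set"
    and M :: "complex \<Rightarrow> (real \<Rightarrow> complex) \<Rightarrow> real \<Rightarrow> complex"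
  assumes coeffs: "sl_coefficients S"
    and lc_a: "limit_circle_a S" and lc_b: "limit_circle_b S"
    and ref: "boundary_reference S w1 w2"
    and u1: "\<And>z. z \<in> resolvent_set S (T_00 S w2) \<Longrightarrow>
      solves S z (u 1 z) \<and> bval S w2 (u 1 z) (end_a S) = 0 \<and> bval S w2 (u 1 z) (end_b S) = 1"
    and u2: "\<And>z. z \<in> resolvent_set S (T_00 S w2) \<Longrightarrow>
      solves S z (u 2 z) \<and> bval S w2 (u 2 z) (end_a S) = 1 \<and> bval S w2 (u 2 z) (end_b S) = 0"
  defines "ua' \<equiv> \<lambda>j z. bval' S w1 (u j z) (end_a S)"
    and "ub' \<equiv> \<lambda>j z. bval' S w1 (u j z) (end_b S)"
    and "\<kappa> \<equiv> Im (ub' 2 \<i>) / Im (ub' 1 \<i>)"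
    and "N \<equiv> deficiency_space S \<i>"
    and "M \<equiv> donoghue_m S (T_00 S w2) N"
  assumes c1: "c 1 = inverse (L2_norm S (u 1 \<i>))"
    and c2: "c 2 = inverse (L2_norm S (\<lambda>x. u 2 \<i> x - \<kappa> * u 1 \<i> x))"
    and v1: "v 1 = (\<lambda>x. c 1 * u 1 \<i> x)"
    and v2: "v 2 = (\<lambda>x. c 2 * (u 2 \<i> x - \<kappa> * u 1 \<i> x))"
    and W11: "\<And>z. W 1 1 z = (c 1)\<^sup>2 * (ub' 1 z - ub' 1 (-\<i>))"
    and W12: "\<And>z. W 1 2 z =
      c 1 * c 2 * (\<kappa> * (ub' 1 (-\<i>) - ub' 1 z) + ub' 2 z + ua' 1 (-\<i>))"
    and W21: "\<And>z. W 2 1 z =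
      - (c 1 * c 2 * (\<kappa> * (ub' 1 z - ub' 1 (-\<i>)) + ub' 2 (-\<i>) + ua' 1 z))"
    and W22: "\<And>z. W 2 2 z =
      (c 2)\<^sup>2 * ((ub' 2 (-\<i>) - ub' 2 z + \<kappa> * (ub' 1 z - ub' 1 (-\<i>))) * \<kappa>
                 + ua' 2 (-\<i>) - ua' 2 z + \<kappa> * (ua' 1 z - ua' 1 (-\<i>)))"
  shows "(\<forall>z. z \<notin> \<real> \<longrightarrow> bounded_op_on S N (M z)) \<and>
    (\<forall>f\<in>N. L2_eq S (M \<i> f) (\<lambda>x. \<i> * f x) \<and> L2_eq S (M (-\<i>) f) (\<lambda>x. - \<i> * f x)) \<and>
    (\<forall>z. z \<notin> \<real> \<and> z \<noteq> \<i> \<and> z \<noteq> -\<i> \<longrightarrow>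
      (\<forall>f\<in>N.
        L2_eq S (M z f)
          (\<lambda>x. - (\<Sum>j\<in>{1,2}. \<Sum>k\<in>{1,2}.
              (\<i> * (if j = k then 1 else 0) + W j k z) * L2_inner S (v k) f * v j x)) \<and>
        L2_eq S (M z f)
          (\<lambda>x. - \<i> * f x - (\<Sum>j\<in>{1,2}. \<Sum>k\<in>{1,2}. W j k z * L2_inner S (v k) f * v j x))))"
proof -
  interpret lc: limit_circle_problem S w1 w2
    by unfold_locales (fact coeffs lc_a lc_b ref)+
  interpret D: donoghue_setup S w1 w2 u
    by unfold_locales (use u1 u2 lc.nonreal_in_resolvent_set in blast)+
  have Im: "Im z \<noteq> 0" if "z \<notin> \<real>" for z using that complex_is_Real_iff by blast
  have \<kappa>: "\<kappa> = D.\<kappa>" by (simp add: \<kappa>_def D.\<kappa>_def ub'_def)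
  have e2: "(\<lambda>x. u 2 \<i> x - \<kappa> * u 1 \<i> x) = D.e2" unfolding D.e2_def \<kappa> ..
  have c: "c 1 = D.c1" "c 2 = D.c2" unfolding c1 c2 e2 D.c1_def D.c2_def by (rule refl)+
  have v: "v 1 = D.v1" "v 2 = D.v2"
    unfolding v1 v2 D.v1_def D.v2_def c e2[symmetric] by (rule refl)+
  have W: "W 1 1 z = D.Wform z D.v1 D.v1" "W 1 2 z = D.Wform z D.v1 D.v2"
    "W 2 1 z = D.Wform z D.v2 D.v1" "W 2 2 z = D.Wform z D.v2 D.v2" if "z \<notin> \<real>" for z
    unfolding D.Wform_values[OF Im[OF that]] W11 W12 W21 W22 c \<kappa> ua'_def ub'_def by simp_all
  have main: "M z f x = - \<i> * f x - (\<Sum>j\<in>{1,2}. \<Sum>k\<in>{1,2}. W j k z * L2_inner S (v k) f * v j x)"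
    if "z \<notin> \<real>" "z \<noteq> \<i>" "f \<in> N" "x \<in> sl_int S" for z f x
    using D.M_formula[OF Im[OF that(1)] that(2) that(3)[unfolded N_def] that(4)]
    unfolding M_def N_def by (simp add: W[OF that(1)] v algebra_simps del: One_nat_def)
  have expand: "f x = L2_inner S (v 1) f * v 1 x + L2_inner S (v 2) f * v 2 x"
    if "f \<in> N" "x \<in> sl_int S" for f x
    unfolding v by (rule D.N_expansion[OF that[unfolded N_def]])
  show ?thesis
  proof (intro conjI allI impI ballI)
    show "bounded_op_on S N (M z)" if "z \<notin> \<real>" for z
      unfolding N_def M_def by (rule D.M_bounded[OF Im[OF that]])
    show "L2_eq S (M \<i> f) (\<lambda>x. \<i> * f x)" "L2_eq S (M (-\<i>) f) (\<lambda>x. - \<i> * f x)" for f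
      unfolding N_def M_def by (simp_all add: D.M_at_i L2_eq_def)
  next
    fix z f assume z: "z \<notin> \<real> \<and> z \<noteq> \<i> \<and> z \<noteq> -\<i>" and f: "f \<in> N"
    show "L2_eq S (M z f)
          (\<lambda>x. - (\<Sum>j\<in>{1,2}. \<Sum>k\<in>{1,2}.
              (\<i> * (if j = k then 1 else 0) + W j k z) * L2_inner S (v k) f * v j x))"
      unfolding L2_eq_def
    proof (rule lc.AE_wmeasure_I)
      fix x assume x: "x \<in> sl_int S"
      show "M z f x = - (\<Sum>j\<in>{1,2}. \<Sum>k\<in>{1,2}.
              (\<i> * (if j = k then 1 else 0) + W j k z) * L2_inner S (v k) f * v j x)"
        using main[OF _ _ f x] z expand[OF f x] by (simp add: algebra_simps del: One_nat_def)
    qed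
    show "L2_eq S (M z f)
          (\<lambda>x. - \<i> * f x - (\<Sum>j\<in>{1,2}. \<Sum>k\<in>{1,2}. W j k z * L2_inner S (v k) f * v j x))"
      unfolding L2_eq_def by (rule lc.AE_wmeasure_I) (use main z f in blast)
  qed
qed

end
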